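(* Let $\Gamma\subset\mathbb{R}$ be a separated set and let $\mathcal{G}\in W\cap C(\mathbb{R})$ be such that $\#\big(\mathrm{Zer}(\hat{\mathcal{G}})\cap(x,x+1)\big)<\infty$ for every $x\in\mathbb{R}$. The following statements are equivalent: (i) the $\Gamma$-shifts of $\mathcal{G}$ are not $l^\infty$-stable; (ii) the $\Gamma$-shifts of $\mathcal{G}$ are not $c_0$-stable; (iii) the $\Gamma$-shifts of $\mathcal{G}$ are not $c_{00}$-stable; (iv) there is a set $\Gamma^\ast\in W(\Gamma)$ such that the $\Gamma^\ast$-translates of $\mathcal{G}$ are not $l^\infty$-independent, i.e. there are non-trivial (not all zero) coefficients $\{c_{\gamma^\ast}\}\in l^\infty(\Gamma^\ast)$ such that $\sum_{\gamma^\ast\in\Gamma^\ast}c_{\gamma^\ast}\mathcal{G}(x-\gamma^\ast)\equiv0$; (v) there is a set $\Gamma^\ast\in W(\Gamma)$ and a non-zero sequence $\mathbf{c}=\{c_{\gamma^\ast}\}\in l^\infty(\Gamma^\ast)$ such that the measure $\mu=\sum_{\gamma^\ast\in\Gamma^\ast}c_{\gamma^\ast}\delta_{\gamma^\ast}$ is a sparse crystalline measure whose spectrum lies in $\mathrm{Zer}(\hat{\mathcal{G}})$.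
   Context: Fourier transform: $\hat f(x)=\int_{\mathbb{R}} e^{-2\pi i xt}f(t)\,dt$. $W$ (without argument) denotes the Wiener amalgam space of measurable $f:\mathbb{R}\to\mathbb{C}$ with $\|f\|_W:=\sum_{k\in\mathbb{Z}}\|f\|_{L^\infty(k,k+1)}<\infty$; for $\mathcal{G}\in W$ the function $\hat{\mathcal{G}}$ is continuous, and $\mathrm{Zer}(\hat{\mathcal{G}}):=\{t\in\mathbb{R}:\hat{\mathcal{G}}(t)=0\}$. A set $\Gamma\subset\mathbb{R}$ is separated if $\Delta(\Gamma):=\inf_{\gamma,\gamma'\in\Gamma,\gamma\ne\gamma'}|\gamma-\gamma'|>0$. The $\Gamma$-shifts of $\mathcal{G}$ are $l^\infty$-stable (respectively $c_0$-stable, $c_{00}$-stable) if there exist positive constants $C_1,C_2$ with $C_1\|\mathbf{c}\|_\infty\le\|\sum_{\gamma\in\Gamma}c_\gamma\mathcal{G}(\cdot-\gamma)\|_{\infty}\le C_2\|\mathbf{c}\|_\infty$ for every $\mathbf{c}\in l^\infty(\Gamma)$ (respectively for every $\mathbf{c}\in c_0(\Gamma)$, i.e. sequences tending to zero; for every finitely supported sequence $\mathbf{c}$). Weak limits: a sequence of separated sets $\Gamma_k\subset\mathbb{R}$ with $\inf_k\Delta(\Gamma_k)>0$ converges weakly to a separated set $\Gamma'\subset\mathbb{R}$ if for every $\epsilon>0$ and $R>0$ there is an integer $l=l(\epsilon,R)$ such that $\Gamma_k\cap(-R,R)\subset\Gamma'+(-\epsilon,\epsilon)$ and $\Gamma'\cap(-R,R)\subset\Gamma_k+(-\epsilon,\epsilon)$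 for all $k\ge l$. $W(\Gamma)$ (with argument a separated set) denotes the set of all weak limits of sequences of translates $\Gamma-x_k$, $x_k\in\mathbb{R}$. Crystalline measures: an atomic measure $\mu=\sum_{\lambda}c_\lambda\delta_\lambda$ with support $\Lambda=\{\lambda: c_\lambda\neq0\}$ is a crystalline measure if $\mu$ is a tempered distribution, its distributional Fourier transform $\hat\mu$ (defined by $\langle\hat\mu,\phi\rangle=\langle\mu,\hat\phi\rangle$ for Schwartz $\phi$) is again an atomic measure $\hat\mu=\sum_{s\in S}a_s\delta_s$ (all $a_s\ne0$), and both the support $\Lambda$ and the spectrum $S$ are locally finite sets. It is sparse if its support is separated. *)

theory Defs
  imports "HOL-Probability.Essential_Supremum"
begin

subsection \<open>Fourier transform and the Wiener amalgam space\<close>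

definition fourier :: "(real \<Rightarrow> complex) \<Rightarrow> real \<Rightarrow> complex" where
  "fourier f x = (LINT t|lebesgue. exp (- (2 * complex_of_real pi * \<i> * of_real x * of_real t)) * f t)"

definition zeros :: "(real \<Rightarrow> complex) \<Rightarrow> real set" where
  "zeros f = {t. f t = 0}"

definition Linf_norm :: "real set \<Rightarrow> (real \<Rightarrow> complex) \<Rightarrow> ennreal" where
  "Linf_norm A f = esssup (restrict_space lebesgue A) (\<lambda>x. ennreal (norm (f x)))"

definition wiener_norm :: "(real \<Rightarrow> complex) \<Rightarrow> ennreal" where
  "wiener_norm f = (\<Sum>\<^sub>\<infinity>k\<in>(UNIV :: int set). Linf_norm {of_int k<..<of_int k + 1} f)"

definition wiener :: "(real \<Rightarrow> complex) set" where
  "wiener = {f \<in> borel_measurable lebesgue. wiener_norm f < \<infinity>}"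

subsection \<open>Separated sets and their weak limits\<close>

text \<open>Extended reals are used so that the infimum over no pairs (a set with at most one
  point) is \<open>\<infinity>\<close>; thus the empty set and singletons are separated.\<close>

definition separation :: "real set \<Rightarrow> ereal" where
  "separation \<Gamma> = (INF (x, y) \<in> {(x, y). x \<in> \<Gamma> \<and> y \<in> \<Gamma> \<and> x \<noteq> y}. ereal \<bar>x - y\<bar>)"

definition separated_set :: "real set \<Rightarrow> bool" where
  "separated_set \<Gamma> \<longleftrightarrow> separation \<Gamma> > 0"

text \<open>The union of the balls of radius \<open>\<epsilon>\<close> around the points of a set is its Minkowski sum with the
  open interval from \<open>-\<epsilon>\<close> to \<open>\<epsilon>\<close>.\<close>

definition weakly_converges :: "(nat \<Rightarrow> real set) \<Rightarrow> real set \<Rightarrow> bool" where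
  "weakly_converges \<Gamma>s \<Gamma>' \<longleftrightarrow>
     (\<forall>k. separated_set (\<Gamma>s k)) \<and> (INF k. separation (\<Gamma>s k)) > 0 \<and> separated_set \<Gamma>' \<and>
     (\<forall>\<epsilon>>0. \<forall>R>0. \<exists>l. \<forall>k\<ge>l.
        \<Gamma>s k \<inter> {-R<..<R} \<subseteq> (\<Union>\<gamma>\<in>\<Gamma>'. ball \<gamma> \<epsilon>) \<and>
        \<Gamma>' \<inter> {-R<..<R} \<subseteq> (\<Union>\<gamma>\<in>\<Gamma>s k. ball \<gamma> \<epsilon>))"

definition weak_limits :: "real set \<Rightarrow> real set set" where
  "weak_limits \<Gamma> = {\<Gamma>'. \<exists>x :: nat \<Rightarrow> real. weakly_converges (\<lambda>k. (\<lambda>\<gamma>. \<gamma> - x k) ` \<Gamma>) \<Gamma>'}"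

subsection \<open>Sequence spaces and stability of shifts\<close>

text \<open>A sequence indexed by \<open>\<Gamma>\<close> is a function on the reals of which only the values on \<open>\<Gamma>\<close>
  are ever used. The supremum norm is taken in the extended nonnegative reals, where the supremum
  over the empty set is 0.\<close>

definition sup_norm :: "real set \<Rightarrow> (real \<Rightarrow> complex) \<Rightarrow> ennreal" where
  "sup_norm \<Gamma> c = (SUP \<gamma>\<in>\<Gamma>. ennreal (norm (c \<gamma>)))"

definition linf_seqs :: "real set \<Rightarrow> (real \<Rightarrow> complex) set" where
  "linf_seqs \<Gamma> = {c. bounded (c ` \<Gamma>)}"

definition c0_seqs :: "real set \<Rightarrow> (real \<Rightarrow> complex) set" where
  "c0_seqs \<Gamma> = {c. \<forall>\<epsilon>>0. finite {\<gamma> \<in> \<Gamma>. norm (c \<gamma>) \<ge> \<epsilon>}}"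

definition c00_seqs :: "real set \<Rightarrow> (real \<Rightarrow> complex) set" where
  "c00_seqs \<Gamma> = {c. finite {\<gamma> \<in> \<Gamma>. c \<gamma> \<noteq> 0}}"

text \<open>For continuous \<open>G\<close> in the Wiener space, separated \<open>\<Gamma>\<close> and bounded \<open>c\<close> this series
  converges absolutely at every point.\<close>

definition shift_series :: "(real \<Rightarrow> complex) \<Rightarrow> real set \<Rightarrow> (real \<Rightarrow> complex) \<Rightarrow> real \<Rightarrow> complex" where
  "shift_series G \<Gamma> c x = (\<Sum>\<^sub>\<infinity>\<gamma>\<in>\<Gamma>. c \<gamma> * G (x - \<gamma>))"

definition stable_shifts :: "(real \<Rightarrow> complex) set \<Rightarrow> real set \<Rightarrow> (real \<Rightarrow> complex) \<Rightarrow> bool" where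
  "stable_shifts X \<Gamma> G \<longleftrightarrow>
     (\<exists>C1 C2 :: real. C1 > 0 \<and> C2 > 0 \<and>
       (\<forall>c\<in>X. ennreal C1 * sup_norm \<Gamma> c \<le> Linf_norm UNIV (shift_series G \<Gamma> c) \<and>
              Linf_norm UNIV (shift_series G \<Gamma> c) \<le> ennreal C2 * sup_norm \<Gamma> c))"

definition linf_stable :: "real set \<Rightarrow> (real \<Rightarrow> complex) \<Rightarrow> bool" where
  "linf_stable \<Gamma> G \<longleftrightarrow> stable_shifts (linf_seqs \<Gamma>) \<Gamma> G"

definition c0_stable :: "real set \<Rightarrow> (real \<Rightarrow> complex) \<Rightarrow> bool" where
  "c0_stable \<Gamma> G \<longleftrightarrow> stable_shifts (c0_seqs \<Gamma>) \<Gamma> G"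

definition c00_stable :: "real set \<Rightarrow> (real \<Rightarrow> complex) \<Rightarrow> bool" where
  "c00_stable \<Gamma> G \<longleftrightarrow> stable_shifts (c00_seqs \<Gamma>) \<Gamma> G"

definition linf_independent :: "real set \<Rightarrow> (real \<Rightarrow> complex) \<Rightarrow> bool" where
  "linf_independent \<Gamma> G \<longleftrightarrow>
     \<not> (\<exists>c\<in>linf_seqs \<Gamma>. (\<exists>\<gamma>\<in>\<Gamma>. c \<gamma> \<noteq> 0) \<and> (\<forall>x. shift_series G \<Gamma> c x = 0))"

subsection \<open>Tempered distributions\<close>

definition iter_deriv :: "nat \<Rightarrow> (real \<Rightarrow> complex) \<Rightarrow> real \<Rightarrow> complex" where
  "iter_deriv n f = ((\<lambda>g x. vector_derivative g (at x)) ^^ n) f"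

definition smooth :: "(real \<Rightarrow> complex) \<Rightarrow> bool" where
  "smooth f \<longleftrightarrow> (\<forall>n x. iter_deriv n f differentiable at x)"

definition test_functions :: "(real \<Rightarrow> complex) set" where
  "test_functions = {\<phi>. smooth \<phi> \<and> (\<exists>R. \<forall>x. \<bar>x\<bar> > R \<longrightarrow> \<phi> x = 0)}"

definition schwartz :: "(real \<Rightarrow> complex) set" where
  "schwartz = {\<phi>. smooth \<phi> \<and> (\<forall>m n. bdd_above (range (\<lambda>x. \<bar>x\<bar> ^ m * norm (iter_deriv n \<phi> x))))}"

definition schwartz_seminorm :: "nat \<Rightarrow> nat \<Rightarrow> (real \<Rightarrow> complex) \<Rightarrow> real" where
  "schwartz_seminorm m n \<phi> = (SUP x. \<bar>x\<bar> ^ m * norm (iter_deriv n \<phi> x))"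

text \<open>The topology of the Schwartz space is generated by the seminorms above, so continuity of a
  linear functional is domination by finitely many of them. Values of \<open>T\<close> outside the Schwartz
  space are irrelevant.\<close>

definition tempered_distribution :: "((real \<Rightarrow> complex) \<Rightarrow> complex) \<Rightarrow> bool" where
  "tempered_distribution T \<longleftrightarrow>
     (\<forall>\<phi>\<in>schwartz. \<forall>\<psi>\<in>schwartz. T (\<lambda>x. \<phi> x + \<psi> x) = T \<phi> + T \<psi>) \<and>
     (\<forall>a. \<forall>\<phi>\<in>schwartz. T (\<lambda>x. a * \<phi> x) = a * T \<phi>) \<and>
     (\<exists>C N. \<forall>\<phi>\<in>schwartz. norm (T \<phi>) \<le> C * (\<Sum>m\<le>N. \<Sum>n\<le>N. schwartz_seminorm m n \<phi>))"

definition distr_fourier :: "((real \<Rightarrow> complex) \<Rightarrow> complex) \<Rightarrow> (real \<Rightarrow> complex) \<Rightarrow> complex" where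
  "distr_fourier T \<phi> = T (fourier \<phi>)"

subsection \<open>Crystalline measures\<close>

text \<open>The atomic measure with mass \<open>c x\<close> at each point \<open>x\<close> is represented by its mass function \<open>c\<close>;
  the support of the measure is the set of its atoms. An atomic measure has finite total variation
  on bounded intervals.\<close>

definition atomic_measure :: "(real \<Rightarrow> complex) \<Rightarrow> bool" where
  "atomic_measure c \<longleftrightarrow> (\<forall>R. (\<lambda>x. norm (c x)) summable_on {-R..R})"

definition atoms :: "(real \<Rightarrow> complex) \<Rightarrow> real set" where
  "atoms c = {x. c x \<noteq> 0}"

definition locally_finite_set :: "real set \<Rightarrow> bool" where
  "locally_finite_set A \<longleftrightarrow> (\<forall>R. finite (A \<inter> {-R..R}))"

text \<open>A measure and a distribution are identified when they agree on test functions. Schwartz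
  functions are not used here because the series need not converge absolutely for them, even if
  the measure is a tempered distribution; by density of the test functions there is at most one
  tempered \<open>T\<close> for a given \<open>c\<close>.\<close>

definition distr_of_atomic :: "((real \<Rightarrow> complex) \<Rightarrow> complex) \<Rightarrow> (real \<Rightarrow> complex) \<Rightarrow> bool" where
  "distr_of_atomic T c \<longleftrightarrow>
     atomic_measure c \<and> (\<forall>\<phi>\<in>test_functions. T \<phi> = (\<Sum>\<^sub>\<infinity>x. c x * \<phi> x))"

text \<open>The measure with masses \<open>c\<close> is a tempered distribution, and its Fourier transform is the
  atomic measure with masses \<open>a\<close>.\<close>

definition atomic_fourier :: "(real \<Rightarrow> complex) \<Rightarrow> (real \<Rightarrow> complex) \<Rightarrow> bool" where
  "atomic_fourier c a \<longleftrightarrow>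
     (\<exists>T. tempered_distribution T \<and> distr_of_atomic T c \<and> distr_of_atomic (distr_fourier T) a)"

definition crystalline_with_spectrum :: "(real \<Rightarrow> complex) \<Rightarrow> real set \<Rightarrow> bool" where
  "crystalline_with_spectrum c S \<longleftrightarrow>
     (\<exists>a. atomic_fourier c a \<and> S = atoms a) \<and> locally_finite_set (atoms c) \<and> locally_finite_set S"

definition sparse_crystalline_with_spectrum :: "(real \<Rightarrow> complex) \<Rightarrow> real set \<Rightarrow> bool" where
  "sparse_crystalline_with_spectrum c S \<longleftrightarrow>
     crystalline_with_spectrum c S \<and> separated_set (atoms c)"

end

theory Submission
  imports Defs "HOL-Probability.Characteristic_Functions" "HOL-Library.Diagonal_Subsequence"
begin

text \<open>
  Write \<open>f = \<Sum> c \<gamma> G(\<cdot> - \<gamma>)\<close> for the shift series, which is the convolution of \<open>G\<close> with the measure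
  \<open>\<mu> = \<Sum> c \<gamma> \<delta>\<^sub>\<gamma>\<close>. The upper stability bound always holds, because a function with an amalgam
  majorant has uniformly bounded sums over the shifts by a separated set (\<open>shift_bound\<close>). So only
  the lower bound matters, and stability passes from \<open>l\<^sup>\<infinity>\<close> to \<open>c\<^sub>0\<close> to \<open>c\<^sub>0\<^sub>0\<close>.

  The cycle is closed through weak limits. If the lower bound fails on bounded sequences, there are
  normalised sequences with nearly vanishing series; translating a nearly maximal coefficient to the
  origin and passing to a limit of both the sets and the coefficients yields a weak limit of \<open>\<Gamma>\<close> with
  a non-trivial vanishing series (\<open>weak_compactness\<close>). Conversely, let a series over a weak limit
  vanish. Multiplying its coefficients by a slowly varying cutoff changes the series little, since
  \<open>\<tau>(\<gamma>) - \<tau>(x)\<close> is small wherever \<open>G(x - \<gamma>)\<close> is not; the finitely many points that remain can be moved to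
  nearby points of a translate of \<open>\<Gamma>\<close>, which contradicts stability on finitely supported sequences
  (\<open>dependent_limit_imp_not_c00_stable\<close>).

  It remains to see that \<open>f = 0\<close> holds exactly if \<open>\<mu>\<close> is crystalline with spectrum in the zeros of the
  transform of \<open>G\<close>. For a test function \<open>\<eta>\<close> let \<open>F(x) = \<langle>\<mu>, (\<eta> e\<^sub>x)^\<rangle>\<close>, with \<open>e\<^sub>x(t) = exp(2\<pi>ixt)\<close>; this bounded
  function is the part of \<open>\<mu>\<close> with frequencies in the support of \<open>\<eta>\<close> (\<open>spectral_part\<close>). Its convolution
  with \<open>G\<close> is \<open>f\<close> tested against a translate of the transform of \<open>\<eta>\<close> (\<open>convolution_identity\<close>).
  If \<open>\<mu>\<close> is crystalline, \<open>F\<close> is a finite combination of exponentials whose frequencies are zeros of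
  the transform of \<open>G\<close>, so \<open>F * G = 0\<close>; letting \<open>\<eta>\<close> run through dilates of a plateau, one recovers
  \<open>f\<close> and gets \<open>f = 0\<close>. If \<open>f = 0\<close>, then \<open>F * G = 0\<close> for all \<open>\<eta>\<close>. When \<open>\<eta>\<close> is supported very near a point
  \<open>t\<^sub>0\<close>, Bernstein's inequality says that \<open>F\<close> is nearly a multiple of \<open>exp(2\<pi>it\<^sub>0x)\<close>, on which convolution
  with \<open>G\<close> acts as multiplication by the value of its transform at \<open>t\<^sub>0\<close>. If this value is not zero,
  the sup norm of \<open>F\<close> is at most half of itself, hence \<open>F = 0\<close>; a partition of unity removes the
  restriction on the support. So the spectrum of \<open>\<mu>\<close> lies in the zeros. Near an isolated zero \<open>s\<close> the
  support of \<open>\<eta>\<close> may be shrunk to \<open>s\<close> without changing \<open>F\<close>, and Bernstein's inequality in the limit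
  says that \<open>F\<close> is exactly a multiple of \<open>exp(2\<pi>isx)\<close>: the transform of \<open>\<mu>\<close> has a point mass at \<open>s\<close> and
  no derivatives of one (\<open>dirac_decomposition\<close>).
\<close>


section \<open>Smooth functions and a smooth step\<close>

lemma iter_deriv_0 [simp]: "iter_deriv 0 f = f"
  by (simp add: iter_deriv_def)

lemma iter_deriv_Suc_left:
  "iter_deriv (Suc n) f = (\<lambda>x. vector_derivative (iter_deriv n f) (at x))"
  by (simp add: iter_deriv_def)

lemma iter_deriv_Suc:
  assumes "\<And>x. (f has_vector_derivative f' x) (at x)"
  shows "iter_deriv (Suc n) f = iter_deriv n f'"
proof -
  have "(\<lambda>x. vector_derivative f (at x)) = f'"
    using assms by (auto intro: vector_derivative_at)
  then show ?thesis
    by (simp add: iter_deriv_def funpow_Suc_right del: funpow.simps)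
qed

lemma smoothD:
  assumes "smooth f"
  obtains f' where "smooth f'" "\<And>x. (f has_vector_derivative f' x) (at x)"
proof -
  define f' where "f' = (\<lambda>x. vector_derivative f (at x))"
  have d: "(f has_vector_derivative f' x) (at x)" for x
    using assms[unfolded smooth_def, rule_format, of 0 x]
    by (simp add: f'_def vector_derivative_works)
  have "smooth f'"
    using assms unfolding smooth_def iter_deriv_Suc[OF d, symmetric] by blast
  with d that show ?thesis by blast
qed

text \<open>Smoothness is proved by coinduction: a class of functions closed under differentiation consists of
  smooth functions. This avoids formulas for higher derivatives.\<close>

lemma smooth_coinduct:
  assumes "P f"
    and step: "\<And>g. P g \<Longrightarrow> \<exists>g'. P g' \<and> (\<forall>x. (g has_vector_derivative g' x) (at x))"
  shows "smooth f"
proof -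
  have "\<exists>g. P g \<and> iter_deriv n f = g" for n
  proof (induction n)
    case 0
    then show ?case using assms(1) by auto
  next
    case (Suc n)
    then obtain g where g: "P g" "iter_deriv n f = g" by blast
    then obtain g' where g': "P g'" "\<And>x. (g has_vector_derivative g' x) (at x)"
      using step by blast
    then have "iter_deriv (Suc n) f = g'"
      unfolding iter_deriv_Suc_left g(2) by (auto intro: vector_derivative_at)
    then show ?case using g'(1) by blast
  qed
  then show ?thesis
    unfolding smooth_def by (metis step differentiableI_vector)
qed

lemma smooth_const [simp, intro]: "smooth (\<lambda>x. c)"
  by (rule smooth_coinduct[where P = "\<lambda>f. \<exists>c. f = (\<lambda>x. c)"]) (auto intro!: exI[of _ "\<lambda>x. 0"])

lemma smoothI:
  assumes "\<And>x. (f has_vector_derivative f' x) (at x)" "smooth f'"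
  shows "smooth f"
proof (rule smooth_coinduct[where P = "\<lambda>g. g = f \<or> smooth g"])
  fix g assume "g = f \<or> smooth g"
  then show "\<exists>g'. (g' = f \<or> smooth g') \<and> (\<forall>x. (g has_vector_derivative g' x) (at x))"
    using assms by (metis smoothD)
qed simp

lemma smooth_of_real [simp, intro]: "smooth (\<lambda>x. of_real x)"
  by (rule smoothI[where f' = "\<lambda>x. 1"])
     (auto intro!: derivative_eq_intros has_vector_derivative_of_real)

text \<open>The derivative of a product, reciprocal or affine reparametrisation of smooth functions is again
  built from smooth functions by these operations, so the whole closure is closed under
  differentiation and one coinduction covers all of them.\<close>

inductive smooth_closure :: "(real \<Rightarrow> complex) \<Rightarrow> bool" where
  base: "smooth f \<Longrightarrow> smooth_closure f"
| add: "smooth_closure f \<Longrightarrow> smooth_closure g \<Longrightarrow> smooth_closure (\<lambda>x. f x + g x)"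
| mult: "smooth_closure f \<Longrightarrow> smooth_closure g \<Longrightarrow> smooth_closure (\<lambda>x. f x * g x)"
| inverse: "smooth_closure f \<Longrightarrow> (\<And>x. f x \<noteq> 0) \<Longrightarrow> smooth_closure (\<lambda>x. inverse (f x))"
| affine: "smooth_closure f \<Longrightarrow> smooth_closure (\<lambda>x. f (a * x + b))"

lemma smooth_closure_deriv:
  assumes "smooth_closure f"
  shows "\<exists>f'. smooth_closure f' \<and> (\<forall>x. (f has_vector_derivative f' x) (at x))"
  using assms
proof induction
  case (base f)
  then show ?case by (metis smoothD smooth_closure.base)
next
  case (add f g)
  then obtain f' g' where d: "smooth_closure f'" "smooth_closure g'"
    "\<And>x. (f has_vector_derivative f' x) (at x)" "\<And>x. (g has_vector_derivative g' x) (at x)"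
    by blast
  show ?case
    by (rule exI[of _ "\<lambda>x. f' x + g' x"]) (intro conjI allI smooth_closure.add d has_vector_derivative_add)
next
  case (mult f g)
  then obtain f' g' where d: "smooth_closure f'" "smooth_closure g'"
    "\<And>x. (f has_vector_derivative f' x) (at x)" "\<And>x. (g has_vector_derivative g' x) (at x)"
    by blast
  show ?case
    by (rule exI[of _ "\<lambda>x. f x * g' x + f' x * g x"])
       (intro conjI allI smooth_closure.add smooth_closure.mult d mult.hyps has_vector_derivative_mult)
next
  case (inverse f)
  then obtain f' where d: "smooth_closure f'" "\<And>x. (f has_vector_derivative f' x) (at x)"
    by blast
  have "((\<lambda>x. inverse (f x)) has_vector_derivative (- 1) * (f' x * (inverse (f x) * inverse (f x)))) (at x)" for x
    using Deriv.has_derivative_inverse[OF inverse.hyps(2) d(2)[of x, unfolded has_vector_derivative_def]]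
    unfolding has_vector_derivative_def by (simp add: algebra_simps)
  then show ?case
    by (intro exI[of _ "\<lambda>x. (- 1) * (f' x * (inverse (f x) * inverse (f x)))"])
       (intro conjI allI smooth_closure.mult d inverse.hyps smooth_closure.inverse
          smooth_closure.base[OF smooth_const])
next
  case (affine f a b)
  then obtain f' where d: "smooth_closure f'" "\<And>x. (f has_vector_derivative f' x) (at x)"
    by blast
  have "((\<lambda>x. f (a * x + b)) has_vector_derivative of_real a * f' (a * x + b)) (at x)" for x
  proof -
    have "((\<lambda>x. a * x + b) has_vector_derivative a) (at x)"
      by (auto intro!: derivative_eq_intros)
    from vector_diff_chain_at[OF this d(2)] show ?thesis
      by (simp add: o_def scaleR_conv_of_real)
  qed
  then show ?case
    by (intro exI[of _ "\<lambda>x. of_real a * f' (a * x + b)"])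
       (use smooth_closure.mult[OF smooth_closure.base[OF smooth_const] smooth_closure.affine[OF d(1)]] in auto)
qed

lemma smooth_closure_smooth: "smooth_closure f \<Longrightarrow> smooth f"
  by (rule smooth_coinduct[where P = smooth_closure]) (use smooth_closure_deriv in auto)

lemma smooth_add [intro]: "smooth f \<Longrightarrow> smooth g \<Longrightarrow> smooth (\<lambda>x. f x + g x)"
  by (rule smooth_closure_smooth, rule smooth_closure.add; rule smooth_closure.base)

lemma smooth_mult [intro]: "smooth f \<Longrightarrow> smooth g \<Longrightarrow> smooth (\<lambda>x. f x * g x)"
  by (rule smooth_closure_smooth, rule smooth_closure.mult; rule smooth_closure.base)

lemma smooth_inverse [intro]: "smooth f \<Longrightarrow> (\<And>x. f x \<noteq> 0) \<Longrightarrow> smooth (\<lambda>x. inverse (f x))"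
  by (rule smooth_closure_smooth, rule smooth_closure.inverse, rule smooth_closure.base)

lemma smooth_affine: "smooth f \<Longrightarrow> smooth (\<lambda>x. f (a * x + b))"
  by (rule smooth_closure_smooth, rule smooth_closure.affine, rule smooth_closure.base)

lemma smooth_diff [intro]: "smooth f \<Longrightarrow> smooth g \<Longrightarrow> smooth (\<lambda>x. f x - g x)"
  using smooth_add[OF _ smooth_mult[OF smooth_const[of "-1"]], of f g] by simp

lemma smooth_exp_imag: "smooth (\<lambda>t. exp (\<i> * of_real (a * t)))"
proof (rule smooth_coinduct[where P = "\<lambda>f. \<exists>c. f = (\<lambda>t. c * exp (\<i> * of_real (a * t)))"])
  show "\<exists>c. (\<lambda>t. exp (\<i> * of_real (a * t))) = (\<lambda>t. c * exp (\<i> * of_real (a * t)))"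
    by (rule exI[of _ 1]) auto
next
  fix g assume "\<exists>c. g = (\<lambda>t. c * exp (\<i> * of_real (a * t)))"
  then obtain c where g: "g = (\<lambda>t. c * exp (\<i> * of_real (a * t)))" by blast
  have "(g has_vector_derivative (c * \<i> * of_real a) * exp (\<i> * of_real (a * t))) (at t)" for t
  proof -
    have "((\<lambda>z. c * exp (\<i> * (of_real a * z))) has_field_derivative
        c * \<i> * of_real a * exp (\<i> * (of_real a * of_real t))) (at (of_real t))"
      by (auto intro!: derivative_eq_intros)
    from has_vector_derivative_real_field[OF this] show ?thesis unfolding g of_real_mult by blast
  qed
  then show "\<exists>g'. (\<exists>c. g' = (\<lambda>t. c * exp (\<i> * of_real (a * t)))) \<and> (\<forall>x. (g has_vector_derivative g' x) (at x))"
    by (intro exI[of _ "\<lambda>t. (c * \<i> * of_real a) * exp (\<i> * of_real (a * t))"]) auto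
qed

lemma smooth_continuous: "smooth f \<Longrightarrow> continuous_on S f"
  by (metis continuous_at_imp_continuous_on has_vector_derivative_continuous smoothD)

text \<open>The flat function \<open>exp(-1/x)\<close>, multiplied by a polynomial in \<open>1/x\<close>: with the polynomial factor the
  class is closed under differentiation.\<close>

definition exp_flat :: "real poly \<Rightarrow> real \<Rightarrow> complex" where
  "exp_flat p x = (if x > 0 then of_real (poly p (1 / x) * exp (- (1 / x))) else 0)"

lemma poly_exp_decay: "((\<lambda>y. poly p y * exp (- y)) \<longlongrightarrow> 0) at_top" for p :: "real poly"
proof -
  have "((\<lambda>y. \<Sum>i\<le>degree p. coeff p i * (y ^ i / exp y)) \<longlongrightarrow> 0) at_top"
    by (rule tendsto_null_sum) (rule tendsto_mult_right_zero, rule tendsto_power_div_exp_0)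
  then show ?thesis
    by (simp add: poly_altdef sum_distrib_right exp_minus divide_inverse mult.assoc)
qed

text \<open>The chain rule gives \<open>(p(1/x) exp(-1/x))' = (p - p')(1/x) exp(-1/x) / x\<^sup>2\<close>; at the origin the exponential beats
  every power of \<open>1/x\<close>.\<close>

lemma exp_flat_deriv:
  "(exp_flat p has_vector_derivative exp_flat ([:0,0,1:] * (p - pderiv p)) x) (at x)"
proof -
  consider "x > 0" | "x < 0" | "x = 0" by linarith
  then show ?thesis
  proof cases
    case 1
    let ?q = "[:0,0,1:] * (p - pderiv p)"
    have "((\<lambda>x. poly p (1 / x) * exp (- (1 / x))) has_real_derivative
        poly ?q (1 / x) * exp (- (1 / x))) (at x)"
      using 1 by (auto intro!: derivative_eq_intros DERIV_chain2[OF poly_DERIV]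
          simp: field_simps power2_eq_square)
    then have "((\<lambda>x. complex_of_real (poly p (1 / x) * exp (- (1 / x)))) has_vector_derivative
        of_real (poly ?q (1 / x) * exp (- (1 / x)))) (at x)"
      by (intro has_vector_derivative_of_real) (simp add: has_real_derivative_iff_has_vector_derivative)
    then have "((\<lambda>x. complex_of_real (poly p (1 / x) * exp (- (1 / x)))) has_vector_derivative
        exp_flat ?q x) (at x)"
      using 1 by (simp add: exp_flat_def)
    then show ?thesis
      by (rule has_vector_derivative_transform_within_open[where S = "{0<..}"])
         (use 1 in \<open>auto simp: exp_flat_def\<close>)
  next
    case 2
    have "((\<lambda>x. 0) has_vector_derivative exp_flat ([:0,0,1:] * (p - pderiv p)) x) (at x)"
      using 2 by (auto simp: exp_flat_def)
    then show ?thesis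
      by (rule has_vector_derivative_transform_within_open[where S = "{..<0}"])
         (use 2 in \<open>auto simp: exp_flat_def\<close>)
  next
    case 3
    have r: "((\<lambda>x. poly (pCons 0 p) (1 / x) * exp (- (1 / x))) \<longlongrightarrow> 0) (at_right 0)"
      by (rule filterlim_compose[OF poly_exp_decay])
         (simp add: divide_inverse filterlim_inverse_at_top_right)
    have "((\<lambda>h. exp_flat p h /\<^sub>R h) \<longlongrightarrow> 0) (at_right 0)"
    proof (rule Lim_transform_eventually)
      show "((\<lambda>x. complex_of_real (poly (pCons 0 p) (1 / x) * exp (- (1 / x)))) \<longlongrightarrow> 0) (at_right 0)"
        using tendsto_of_real[OF r, where 'a = complex] by simp
      show "\<forall>\<^sub>F x in at_right 0. complex_of_real (poly (pCons 0 p) (1 / x) * exp (- (1 / x))) = exp_flat p x /\<^sub>R x"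
        by (rule eventually_at_right_less[THEN eventually_mono])
           (auto simp: exp_flat_def scaleR_conv_of_real field_simps)
    qed
    moreover have "((\<lambda>h. exp_flat p h /\<^sub>R h) \<longlongrightarrow> 0) (at_left 0)"
      by (rule Lim_transform_eventually[OF tendsto_const])
         (auto simp: eventually_at_filter exp_flat_def)
    ultimately have "((\<lambda>h. exp_flat p h /\<^sub>R h) \<longlongrightarrow> 0) (at 0)"
      by (simp add: filterlim_split_at)
    then have "((\<lambda>h. norm (exp_flat p h) / \<bar>h\<bar>) \<longlongrightarrow> 0) (at 0)"
      using tendsto_norm_zero by (force simp: divide_inverse mult.commute)
    then have "(exp_flat p has_vector_derivative 0) (at 0)"
      unfolding has_vector_derivative_def has_derivative_at
      by (simp add: exp_flat_def[of p 0])
    then show ?thesis by (simp add: 3 exp_flat_def)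
  qed
qed

lemma smooth_exp_flat: "smooth (exp_flat p)"
  by (rule smooth_coinduct[where P = "\<lambda>f. \<exists>p. f = exp_flat p"]) (use exp_flat_deriv in blast)+

definition smooth_step :: "real \<Rightarrow> complex" where
  "smooth_step x = exp_flat 1 x * inverse (exp_flat 1 x + exp_flat 1 (1 - x))"

lemma exp_flat_1_sum_nonzero: "exp_flat 1 x + exp_flat 1 (1 - x) \<noteq> 0"
proof -
  have "Re (exp_flat 1 x + exp_flat 1 (1 - x)) > 0"
    by (auto simp: exp_flat_def add_pos_pos)
  then show ?thesis by (metis less_irrefl zero_complex.simps(1))
qed

lemma smooth_smooth_step: "smooth smooth_step"
proof -
  have "smooth (\<lambda>x. exp_flat 1 (-1 * x + 1))" by (intro smooth_affine smooth_exp_flat)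
  then have "smooth (\<lambda>x. exp_flat 1 (1 - x))" by (simp add: algebra_simps)
  then show ?thesis
    unfolding smooth_step_def[abs_def]
    by (intro smooth_mult smooth_inverse smooth_add smooth_exp_flat exp_flat_1_sum_nonzero)
qed

lemma smooth_step_0: "x \<le> 0 \<Longrightarrow> smooth_step x = 0"
  by (auto simp: smooth_step_def exp_flat_def)

lemma smooth_step_1: "x \<ge> 1 \<Longrightarrow> smooth_step x = 1"
  using exp_flat_1_sum_nonzero[of x] by (auto simp: smooth_step_def exp_flat_def)

section \<open>Unordered sums and integrals\<close>

lemma integrable_count_space_iff:
  fixes f :: "'a \<Rightarrow> 'b :: {banach, second_countable_topology}"
  shows "integrable (count_space A) f \<longleftrightarrow> (\<lambda>a. norm (f a)) summable_on A"
  unfolding abs_summable_equivalent Infinite_Set_Sum.abs_summable_on_def by simp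

lemma integral_count_space_infsum:
  fixes f :: "'a \<Rightarrow> complex"
  assumes "(\<lambda>a. norm (f a)) summable_on A"
  shows "integral\<^sup>L (count_space A) f = infsum f A"
  using infsetsum_infsum[OF abs_summable_equivalent[THEN iffD1, OF assms]]
  by (simp only: infsetsum_def)

lemma norm_infsum_le:
  fixes f :: "'a \<Rightarrow> complex"
  assumes "w summable_on A" "\<And>a. a \<in> A \<Longrightarrow> norm (f a) \<le> w a"
  shows "f summable_on A" "(\<lambda>a. norm (f a)) summable_on A" "norm (infsum f A) \<le> infsum w A"
proof -
  show n: "(\<lambda>a. norm (f a)) summable_on A"
    by (rule summable_on_comparison_test[OF assms(1)]) (use assms(2) in auto)
  then show "f summable_on A" by (rule abs_summable_summable)
  have "norm (infsum f A) \<le> infsum (\<lambda>a. norm (f a)) A"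
    using n by (rule norm_infsum_bound)
  also have "\<dots> \<le> infsum w A"
    using assms n by (intro infsum_mono) auto
  finally show "norm (infsum f A) \<le> infsum w A" .
qed

text \<open>Unordered sums are integrals for the counting measure, so Lebesgue's theorem applies to them.\<close>

lemma infsum_dominated_convergence:
  fixes f :: "nat \<Rightarrow> 'a \<Rightarrow> complex"
  assumes w: "w summable_on A"
    and bound: "\<And>n a. a \<in> A \<Longrightarrow> norm (f n a) \<le> w a"
    and lim: "\<And>a. a \<in> A \<Longrightarrow> (\<lambda>n. f n a) \<longlonglongrightarrow> g a"
  shows "(\<lambda>n. infsum (f n) A) \<longlonglongrightarrow> infsum g A"
proof -
  have bg: "norm (g a) \<le> w a" if "a \<in> A" for a
    using tendsto_norm[OF lim[OF that]] bound[OF that] by (intro Lim_bounded[of _ _ 0]) auto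
  have "norm (w a) = w a" if "a \<in> A" for a
    using bg[OF that] norm_ge_zero[of "g a"] by (simp del: norm_ge_zero)
  then have iw: "integrable (count_space A) w"
    unfolding integrable_count_space_iff using w by (simp cong: summable_on_cong)
  have "(\<lambda>n. integral\<^sup>L (count_space A) (f n)) \<longlonglongrightarrow> integral\<^sup>L (count_space A) g"
    by (rule integral_dominated_convergence[OF _ _ iw])
       (use bound lim in \<open>auto simp: AE_count_space\<close>)
  moreover have "integral\<^sup>L (count_space A) (f n) = infsum (f n) A" for n
    by (intro integral_count_space_infsum norm_infsum_le(2)[OF w bound])
  moreover have "integral\<^sup>L (count_space A) g = infsum g A"
    by (intro integral_count_space_infsum norm_infsum_le(2)[OF w bg])
  ultimately show ?thesis by simp
qed

text \<open>The index set is enumerated by natural numbers, padding with zero functions if it is finite,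
  because the theorem on integrating a series is stated for sequences.\<close>

lemma infsum_integral_swap:
  fixes f :: "'a \<Rightarrow> 'b \<Rightarrow> complex"
  assumes A: "countable A"
    and meas: "\<And>a. a \<in> A \<Longrightarrow> f a \<in> borel_measurable M"
    and sm: "\<And>x. (\<lambda>a. norm (f a x)) summable_on A"
    and bound: "\<And>x. infsum (\<lambda>a. norm (f a x)) A \<le> w x"
    and w: "integrable M w"
  shows "(\<integral>x. infsum (\<lambda>a. f a x) A \<partial>M) = infsum (\<lambda>a. \<integral>x. f a x \<partial>M) A"
proof -
  define I where "I = to_nat_on A ` A"
  define h where "h = (\<lambda>n. if n \<in> I then f (from_nat_into A n) else (\<lambda>x. 0))"
  have bij: "bij_betw (from_nat_into A) I A"
    unfolding I_def using A by (auto simp: bij_betw_def inj_on_def image_iff)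
  have inA: "from_nat_into A n \<in> A" if "n \<in> I" for n
    using that bij by (auto simp: bij_betw_def)
  have hm: "h n \<in> borel_measurable M" for n
    using meas inA by (auto simp: h_def)
  have smh: "(\<lambda>n. norm (h n x)) summable_on UNIV"
    and nh: "infsum (\<lambda>n. norm (h n x)) UNIV = infsum (\<lambda>a. norm (f a x)) A"
    and ih: "infsum (\<lambda>n. h n x) UNIV = infsum (\<lambda>a. f a x) A" for x
  proof -
    have "(\<lambda>n. norm (f (from_nat_into A n) x)) summable_on I"
      using sm[of x] summable_on_reindex_bij_betw[OF bij, of "\<lambda>a. norm (f a x)"] by simp
    then show "(\<lambda>n. norm (h n x)) summable_on UNIV"
      by (rule summable_on_cong_neutral[THEN iffD1, rotated -1]) (auto simp: h_def)
    have "infsum (\<lambda>n. norm (f (from_nat_into A n) x)) I = infsum (\<lambda>n. norm (h n x)) UNIV"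
      by (rule infsum_cong_neutral) (auto simp: h_def)
    then show "infsum (\<lambda>n. norm (h n x)) UNIV = infsum (\<lambda>a. norm (f a x)) A"
      using infsum_reindex_bij_betw[OF bij, of "\<lambda>a. norm (f a x)"] by simp
    have "infsum (\<lambda>n. f (from_nat_into A n) x) I = infsum (\<lambda>n. h n x) UNIV"
      by (rule infsum_cong_neutral) (auto simp: h_def)
    then show "infsum (\<lambda>n. h n x) UNIV = infsum (\<lambda>a. f a x) A"
      using infsum_reindex_bij_betw[OF bij, of "\<lambda>a. f a x"] by simp
  qed
  have hb: "norm (h n x) \<le> w x" for n x
  proof -
    have "norm (h n x) = infsum (\<lambda>n. norm (h n x)) {n}" by simp
    also have "\<dots> \<le> infsum (\<lambda>n. norm (h n x)) UNIV"
      by (intro infsum_mono_neutral smh) auto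
    finally show ?thesis using nh bound[of x] by simp
  qed
  have hi: "integrable M (h n)" for n
    by (rule Bochner_Integration.integrable_bound[OF w hm]) (use hb in \<open>auto intro!: AE_I2 intro: order_trans[OF _ abs_ge_self]\<close>)
  have sn: "summable (\<lambda>n. norm (h n x))" for x
    using smh[of x] by (rule summable_on_imp_summable)
  have sI: "summable (\<lambda>n. \<integral>x. norm (h n x) \<partial>M)"
  proof (rule bounded_imp_summable)
    fix n
    have "(\<Sum>k\<le>n. \<integral>x. norm (h k x) \<partial>M) = (\<integral>x. (\<Sum>k\<le>n. norm (h k x)) \<partial>M)"
      by (rule Bochner_Integration.integral_sum[symmetric]) (use hi in auto)
    also have "\<dots> \<le> (\<integral>x. w x \<partial>M)"
    proof (rule integral_mono)
      fix x
      have "(\<Sum>k\<le>n. norm (h k x)) \<le> infsum (\<lambda>n. norm (h n x)) UNIV"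
        by (intro finite_sum_le_infsum smh) auto
      then show "(\<Sum>k\<le>n. norm (h k x)) \<le> w x" using nh bound[of x] by simp
    qed (use hi w in auto)
    finally show "(\<Sum>k\<le>n. \<integral>x. norm (h k x) \<partial>M) \<le> (\<integral>x. w x \<partial>M)" .
  qed auto
  have suminf_infsum: "suminf z = infsum z UNIV" if "(\<lambda>n. norm (z n)) summable_on UNIV" for z :: "nat \<Rightarrow> complex"
    using has_sum_imp_sums[OF has_sum_infsum[OF abs_summable_summable[OF that]]]
    by (simp add: sums_iff)
  have s1: "(\<Sum>n. h n x) = infsum (\<lambda>a. f a x) A" for x
    using suminf_infsum[OF smh] ih by simp
  note int = integral_suminf[of M h, OF hi AE_I2[OF sn] sI]
  have "summable (\<lambda>n. norm (norm (\<integral>x. h n x \<partial>M)))"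
    by (rule summable_comparison_test'[OF sI]) (simp add: integral_norm_bound)
  then have "(\<lambda>n. norm (\<integral>x. h n x \<partial>M)) summable_on UNIV"
    by (rule norm_summable_imp_summable_on)
  from suminf_infsum[OF this] int
  have "(\<integral>x. infsum (\<lambda>a. f a x) A \<partial>M) = infsum (\<lambda>n. \<integral>x. h n x \<partial>M) UNIV"
    unfolding s1 by simp
  also have "\<dots> = infsum (\<lambda>n. \<integral>x. f (from_nat_into A n) x \<partial>M) I"
    by (rule infsum_cong_neutral) (auto simp: h_def)
  also have "\<dots> = infsum (\<lambda>a. \<integral>x. f a x \<partial>M) A"
    using infsum_reindex_bij_betw[OF bij, of "\<lambda>a. \<integral>x. f a x \<partial>M"] by simp
  finally show "(\<integral>x. infsum (\<lambda>a. f a x) A \<partial>M) = infsum (\<lambda>a. \<integral>x. f a x \<partial>M) A" .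
qed

lemma integral_mult_infsum_swap:
  fixes f :: "'a \<Rightarrow> 'b \<Rightarrow> complex" and w :: "'b \<Rightarrow> complex"
  assumes "countable A" and w: "integrable M w"
    and meas: "\<And>a. a \<in> A \<Longrightarrow> f a \<in> borel_measurable M"
    and sm: "\<And>x. (\<lambda>a. norm (f a x)) summable_on A"
    and bound: "\<And>x. infsum (\<lambda>a. norm (f a x)) A \<le> B"
  shows "(\<integral>x. w x * infsum (\<lambda>a. f a x) A \<partial>M) = infsum (\<lambda>a. \<integral>x. w x * f a x \<partial>M) A"
proof -
  have norm: "infsum (\<lambda>a. norm (w x * f a x)) A = norm (w x) * infsum (\<lambda>a. norm (f a x)) A" for x
    unfolding norm_mult by (rule infsum_cmult_right')
  have "(\<integral>x. infsum (\<lambda>a. w x * f a x) A \<partial>M) = infsum (\<lambda>a. \<integral>x. w x * f a x \<partial>M) A"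
  proof (rule infsum_integral_swap[OF \<open>countable A\<close>])
    show "(\<lambda>x. w x * f a x) \<in> borel_measurable M" if "a \<in> A" for a
      using w meas[OF that] by simp
    show "(\<lambda>a. norm (w x * f a x)) summable_on A" for x
      unfolding norm_mult by (rule summable_on_cmult_right[OF sm])
    show "infsum (\<lambda>a. norm (w x * f a x)) A \<le> norm (w x) * B" for x
      unfolding norm by (rule mult_left_mono[OF bound norm_ge_zero])
    show "integrable M (\<lambda>x. norm (w x) * B)" using w by auto
  qed
  then show ?thesis by (simp only: infsum_cmult_right')
qed

section \<open>Amalgam majorants\<close>

text \<open>For continuous functions this is membership in the Wiener amalgam space, with an explicit sequence
  of bounds on unit intervals. It also covers the transforms of test functions, for which a bound by
  \<open>C / (1 + t\<^sup>2)\<close> is at hand.\<close>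

definition amalgam :: "(real \<Rightarrow> complex) \<Rightarrow> bool" where
  "amalgam g \<longleftrightarrow> (\<exists>b :: int \<Rightarrow> real. b summable_on UNIV \<and> (\<forall>t. norm (g t) \<le> b \<lfloor>t\<rfloor>))"

text \<open>The floor function pushes Lebesgue measure forward to the counting measure on the integers.\<close>

lemma integrable_floor:
  fixes b :: "int \<Rightarrow> real"
  assumes "b summable_on UNIV" "\<And>k. b k \<ge> 0"
  shows "integrable lborel (\<lambda>t::real. b \<lfloor>t\<rfloor>)"
proof -
  have "distr lborel (count_space UNIV) (floor :: real \<Rightarrow> int) = count_space UNIV"
  proof (rule measure_eqI_countable[where A = UNIV])
    fix k :: int
    have "(floor :: real \<Rightarrow> int) -` {k} = {of_int k..<of_int k + 1}"
      by (auto simp: floor_eq_iff)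
    then show "emeasure (distr lborel (count_space UNIV) (floor :: real \<Rightarrow> int)) {k} = emeasure (count_space UNIV) {k}"
      by (simp add: emeasure_distr)
  qed auto
  moreover have "integrable (count_space UNIV) b"
    using assms by (simp add: integrable_count_space_iff)
  ultimately have "integrable (distr lborel (count_space UNIV) (floor :: real \<Rightarrow> int)) b"
    by simp
  then show ?thesis
    by (subst (asm) integrable_distr_eq) auto
qed

lemma amalgamE:
  assumes "amalgam g"
  obtains b :: "int \<Rightarrow> real" where "b summable_on UNIV" "\<And>k. b k \<ge> 0" "\<And>t. norm (g t) \<le> b \<lfloor>t\<rfloor>"
proof -
  from assms obtain b :: "int \<Rightarrow> real" where b: "b summable_on UNIV" "\<And>t. norm (g t) \<le> b \<lfloor>t\<rfloor>"
    by (auto simp: amalgam_def)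
  have "b k \<ge> 0" for k
    using b(2)[of "of_int k"] norm_ge_zero[of "g (of_int k)"] by (simp del: norm_ge_zero)
  with b that show ?thesis by blast
qed

lemma amalgam_integrable:
  assumes "amalgam g" "g \<in> borel_measurable borel"
  shows "integrable lborel g"
proof -
  obtain b :: "int \<Rightarrow> real" where b: "b summable_on UNIV" "\<And>k. b k \<ge> 0" "\<And>t. norm (g t) \<le> b \<lfloor>t\<rfloor>"
    using amalgamE[OF assms(1)] by blast
  show ?thesis
    by (rule Bochner_Integration.integrable_bound[OF integrable_floor[OF b(1,2)]])
       (use b assms(2) in auto)
qed

lemma summable_on_int_inverse_square: "(\<lambda>k::int. C / (1 + (of_int k)\<^sup>2)) summable_on (UNIV :: int set)" for C :: real
proof -
  have "(\<lambda>n::nat. 1 / (1 + (real n)\<^sup>2)) summable_on UNIV"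
  proof (rule norm_summable_imp_summable_on, rule summable_comparison_test')
    show "summable (\<lambda>n. 1 / (real (n))\<^sup>2)"
      using inverse_power_summable[of 2, where 'a = real] by (simp add: inverse_eq_divide)
    show "norm (norm (1 / (1 + (real n)\<^sup>2))) \<le> 1 / (real n)\<^sup>2" if "n \<ge> 1" for n
      using that by (auto intro!: divide_left_mono mult_pos_pos add_pos_nonneg)
  qed
  note n = this
  have "(\<lambda>k::int. 1 / (1 + (of_int k :: real)\<^sup>2)) summable_on range int"
    by (subst summable_on_reindex) (use n in \<open>auto simp: o_def\<close>)
  moreover have "(\<lambda>k::int. 1 / (1 + (of_int k :: real)\<^sup>2)) summable_on range (\<lambda>n. - int n)"
    by (subst summable_on_reindex) (use n in \<open>auto simp: o_def inj_on_def\<close>)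
  ultimately have "(\<lambda>k::int. 1 / (1 + (of_int k :: real)\<^sup>2)) summable_on (range int \<union> range (\<lambda>n. - int n))"
    by (rule summable_on_union)
  moreover have "range int \<union> range (\<lambda>n. - int n) = UNIV"
  proof (rule UNIV_eq_I[symmetric])
    show "k \<in> range int \<union> range (\<lambda>n. - int n)" for k by (cases k rule: int_cases2) auto
  qed
  ultimately have "(\<lambda>k::int. C * (1 / (1 + (of_int k :: real)\<^sup>2))) summable_on UNIV"
    by (intro summable_on_cmult_right) simp
  then show ?thesis by simp
qed

lemma decay_amalgam:
  assumes "\<And>t. norm (g t) * (1 + t\<^sup>2) \<le> C"
  shows "amalgam g"
  unfolding amalgam_def
proof (intro exI conjI allI)
  show "(\<lambda>k::int. (3 * C) / (1 + (of_int k)\<^sup>2)) summable_on UNIV"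
    by (rule summable_on_int_inverse_square)
  fix t :: real
  have "(of_int \<lfloor>t\<rfloor>)\<^sup>2 \<le> (\<bar>t\<bar> + 1)\<^sup>2"
    by (rule power2_le_iff_abs_le[THEN iffD2]) linarith+
  also have "1 + (\<bar>t\<bar> + 1)\<^sup>2 \<le> 3 * (1 + t\<^sup>2)"
  proof -
    have "0 \<le> (\<bar>t\<bar> - 1)\<^sup>2 + t\<^sup>2" by simp
    then show ?thesis unfolding power2_eq_square by (simp add: algebra_simps)
  qed
  finally have "1 + (of_int \<lfloor>t\<rfloor>)\<^sup>2 \<le> 3 * (1 + t\<^sup>2)" by simp
  then have "norm (g t) * (1 + (of_int \<lfloor>t\<rfloor>)\<^sup>2) \<le> norm (g t) * (3 * (1 + t\<^sup>2))"
    by (rule mult_left_mono) simp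
  also have "\<dots> \<le> 3 * C" using assms[of t] by (simp add: algebra_simps)
  finally show "norm (g t) \<le> (3 * C) / (1 + (of_int \<lfloor>t\<rfloor>)\<^sup>2)"
    by (simp add: pos_le_divide_eq add_pos_nonneg)
qed

lemma integrable_inverse_square: "integrable lborel (\<lambda>t. C / (1 + t\<^sup>2))" for C :: real
proof -
  have "amalgam (\<lambda>t. of_real (C / (1 + t\<^sup>2)))"
  proof (rule decay_amalgam[where C = "\<bar>C\<bar>"])
    fix t :: real
    have "1 + t\<^sup>2 > 0" by (simp add: add_pos_nonneg)
    then show "norm (complex_of_real (C / (1 + t\<^sup>2))) * (1 + t\<^sup>2) \<le> \<bar>C\<bar>"
      unfolding norm_of_real abs_divide by simp
  qed
  then have "integrable lborel (\<lambda>t. complex_of_real (C / (1 + t\<^sup>2)))"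
    by (rule amalgam_integrable) simp
  then show ?thesis by (simp only: complex_of_real_integrable_eq)
qed

text \<open>The product \<open>f(x) g(y)\<close> is integrable on the plane, and a kernel of modulus at most 1 keeps it so. The
  kernels in question are characters.\<close>

lemma Fubini_bounded_kernel:
  fixes f g :: "real \<Rightarrow> complex" and K :: "real \<Rightarrow> real \<Rightarrow> complex"
  assumes f: "integrable lborel f" and g: "integrable lborel g"
    and K: "continuous_on UNIV (\<lambda>(x, y). K x y)" "\<And>x y. norm (K x y) \<le> 1"
  shows "(LBINT y. LBINT x. f x * g y * K x y) = (LBINT x. LBINT y. f x * g y * K x y)"
proof -
  have Km: "(\<lambda>(x, y). K x y) \<in> borel_measurable (lborel \<Otimes>\<^sub>M lborel)"
    using borel_measurable_continuous_onI[OF K(1)] by (simp add: borel_prod[symmetric] lborel_prod[symmetric] cong: measurable_cong_sets)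
  have fm: "f \<in> borel_measurable borel" and gm: "g \<in> borel_measurable borel"
    using f g by auto
  have Ky: "K x \<in> borel_measurable borel" for x
  proof -
    have "continuous_on UNIV (\<lambda>y. (x, y))" by (intro continuous_intros)
    from continuous_on_compose2[OF K(1) this] show ?thesis
      by (intro borel_measurable_continuous_onI) simp
  qed
  have "integrable (lborel \<Otimes>\<^sub>M lborel) (case_prod (\<lambda>x y. f x * g y * K x y))"
  proof (rule lborel_pair.Fubini_integrable)
    show "case_prod (\<lambda>x y. f x * g y * K x y) \<in> borel_measurable (lborel \<Otimes>\<^sub>M lborel)"
      using Km fm gm by (simp add: case_prod_beta')
    have iy: "integrable lborel (\<lambda>y. f x * g y * K x y)" for x
      by (rule Bochner_Integration.integrable_bound[of _ "\<lambda>y. f x * g y"])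
         (use f g K Ky fm gm in \<open>auto simp: norm_mult intro!: mult_left_le\<close>)
    then show "AE x in lborel. integrable lborel (\<lambda>y. case_prod (\<lambda>x y. f x * g y * K x y) (x, y))"
      by simp
    show "integrable lborel (\<lambda>x. LBINT y. norm (case_prod (\<lambda>x y. f x * g y * K x y) (x, y)))"
    proof (rule Bochner_Integration.integrable_bound)
      show "integrable lborel (\<lambda>x. norm (f x) * (LBINT y. norm (g y)))" using f by auto
      show "(\<lambda>x. LBINT y. norm (case_prod (\<lambda>x y. f x * g y * K x y) (x, y))) \<in> borel_measurable lborel"
        using Km fm gm by (simp add: case_prod_beta')
      show "AE x in lborel. norm (LBINT y. norm (case_prod (\<lambda>x y. f x * g y * K x y) (x, y)))
          \<le> norm (norm (f x) * (LBINT y. norm (g y)))"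
      proof (rule AE_I2)
        fix x
        have "(LBINT y. norm (f x * g y * K x y)) \<le> (LBINT y. norm (f x) * norm (g y))"
          by (intro integral_mono integrable_norm iy)
             (use g K in \<open>auto simp: norm_mult intro!: mult_left_le\<close>)
        then show "norm (LBINT y. norm (case_prod (\<lambda>x y. f x * g y * K x y) (x, y)))
          \<le> norm (norm (f x) * (LBINT y. norm (g y)))"
          by simp
      qed
    qed
  qed
  from lborel_pair.Fubini_integral[OF this] show ?thesis .
qed

section \<open>Characters and the Fourier transform of test functions\<close>

definition chr :: "real \<Rightarrow> real \<Rightarrow> complex" where
  "chr x t = exp (\<i> * of_real (2 * pi * x * t))"

lemma norm_chr [simp]: "norm (chr x t) = 1"
  by (simp add: chr_def)

lemma chr_0 [simp]: "chr 0 t = 1" "chr x 0 = 1"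
  by (simp_all add: chr_def)

lemma chr_add_left: "chr (x + y) t = chr x t * chr y t"
  by (simp add: chr_def exp_add[symmetric] algebra_simps)

lemma chr_add_right: "chr x (s + t) = chr x s * chr x t"
  by (simp add: chr_def exp_add[symmetric] algebra_simps)

lemma chr_commute: "chr x t = chr t x"
  by (simp add: chr_def mult_ac)

lemma chr_minus: "chr (- x) t = chr x (- t)"
  by (simp add: chr_def)

lemma chr_mult_minus [simp]: "chr x t * chr (- x) t = 1" "chr (- x) t * chr x t = 1"
  using chr_add_left[of x "-x" t] by (simp_all add: mult.commute)

lemma chr_scale: "chr (a * x) t = chr x (a * t)"
  by (simp add: chr_def mult_ac)

lemma continuous_on_chr [continuous_intros]:
  "continuous_on S f \<Longrightarrow> continuous_on S g \<Longrightarrow> continuous_on S (\<lambda>z. chr (f z) (g z))"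
  unfolding chr_def by (intro continuous_intros)

lemma borel_measurable_chr [measurable]: "chr x \<in> borel_measurable borel"
  by (intro borel_measurable_continuous_onI continuous_intros)

lemma smooth_chr: "smooth (chr x)"
  using smooth_exp_imag[of "2 * pi * x"] by (simp add: chr_def[abs_def])

lemma chr_has_vector_derivative_left:
  "((\<lambda>x. chr x t) has_vector_derivative (2 * of_real pi * \<i> * of_real t) * chr x t) (at x within S)"
proof -
  have "((\<lambda>z. exp (\<i> * (2 * of_real pi * z * of_real t))) has_field_derivative
      (2 * of_real pi * \<i> * of_real t) * exp (\<i> * (2 * of_real pi * of_real x * of_real t))) (at (of_real x))"
    by (auto intro!: derivative_eq_intros)
  from has_vector_derivative_real_field[OF this] show ?thesis
    by (simp add: chr_def)
qed

lemma chr_has_vector_derivative_right: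
  "(chr x has_vector_derivative (2 * of_real pi * \<i> * of_real x) * chr x t) (at t within S)"
proof -
  have "chr x = (\<lambda>t. chr t x)" by (simp add: fun_eq_iff chr_commute)
  then show ?thesis using chr_has_vector_derivative_left[of x t S] by simp
qed

lemma fourier_eq_lborel:
  assumes "f \<in> borel_measurable borel"
  shows "fourier f x = (LBINT t. chr (- x) t * f t)"
proof -
  have "fourier f x = (LINT t|lebesgue. chr (- x) t * f t)"
    unfolding fourier_def chr_def by (simp add: mult_ac)
  also have "\<dots> = (LBINT t. chr (- x) t * f t)"
    by (rule integral_completion) (use assms in simp)
  finally show ?thesis .
qed

lemma integrable_chr_mult:
  assumes "integrable lborel f"
  shows "integrable lborel (\<lambda>t. chr x t * f t)"
  by (rule Bochner_Integration.integrable_bound[OF assms]) (use assms in \<open>auto simp: norm_mult\<close>)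

lemma norm_fourier_le:
  assumes "integrable lborel f"
  shows "norm (fourier f x) \<le> (LBINT t. norm (f t))"
proof -
  have "norm (fourier f x) = norm (LBINT t. chr (- x) t * f t)"
    using assms by (subst fourier_eq_lborel) auto
  also have "\<dots> \<le> (LBINT t. norm (chr (- x) t * f t))" by (rule integral_norm_bound)
  finally show ?thesis by (simp add: norm_mult)
qed

lemma continuous_fourier:
  assumes f: "integrable lborel f"
  shows "continuous_on UNIV (fourier f)"
proof (rule continuous_at_imp_continuous_on, rule ballI)
  fix x
  have fm: "f \<in> borel_measurable borel" using f by auto
  have "fourier f \<midarrow>x\<rightarrow> fourier f x"
    unfolding tendsto_at_iff_sequentially o_def
  proof (intro allI impI)
    fix X assume X: "\<forall>i. X i \<in> UNIV - {x}" "X \<longlonglongrightarrow> x"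
    show "(\<lambda>n. fourier f (X n)) \<longlonglongrightarrow> fourier f x"
      unfolding fourier_eq_lborel[OF fm]
    proof (rule integral_dominated_convergence[where w = "\<lambda>t. norm (f t)"])
      have "(\<lambda>n. chr (- X n) t) \<longlonglongrightarrow> chr (- x) t" for t
        unfolding chr_def by (intro tendsto_intros X)
      then show "AE t in lborel. (\<lambda>n. chr (- X n) t * f t) \<longlonglongrightarrow> chr (- x) t * f t"
        by (auto intro!: AE_I2 tendsto_mult_right)
    qed (use f fm in \<open>auto simp: norm_mult\<close>)
  qed
  then show "isCont (fourier f) x" by (simp add: continuous_at)
qed

lemma test_functionE:
  assumes "\<phi> \<in> test_functions"
  obtains R where "R > 0" "\<And>x. \<bar>x\<bar> > R \<Longrightarrow> \<phi> x = 0"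
proof -
  from assms obtain R where "\<forall>x. \<bar>x\<bar> > R \<longrightarrow> \<phi> x = 0" by (auto simp: test_functions_def)
  then show ?thesis by (intro that[of "max R 1"]) auto
qed

lemma test_function_smooth: "\<phi> \<in> test_functions \<Longrightarrow> smooth \<phi>"
  by (simp add: test_functions_def)

lemma test_functionI: "smooth \<phi> \<Longrightarrow> (\<And>x. \<bar>x\<bar> > R \<Longrightarrow> \<phi> x = 0) \<Longrightarrow> \<phi> \<in> test_functions"
  by (auto simp: test_functions_def)

lemma test_function_mult:
  assumes "\<phi> \<in> test_functions" "smooth f"
  shows "(\<lambda>x. \<phi> x * f x) \<in> test_functions" "(\<lambda>x. f x * \<phi> x) \<in> test_functions"
  using assms unfolding test_functions_def by (force intro: smooth_mult)+

lemma test_function_add: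
  assumes "\<phi> \<in> test_functions" "\<psi> \<in> test_functions"
  shows "(\<lambda>x. \<phi> x + \<psi> x) \<in> test_functions"
proof -
  obtain R S where "\<And>x. \<bar>x\<bar> > R \<Longrightarrow> \<phi> x = 0" "\<And>x. \<bar>x\<bar> > S \<Longrightarrow> \<psi> x = 0"
    using assms by (metis test_functionE)
  then show ?thesis
    by (intro test_functionI[of _ "max R S"] smooth_add)
       (use assms test_function_smooth in auto)
qed

lemma test_function_zero: "(\<lambda>x. 0) \<in> test_functions"
  by (rule test_functionI[of _ 0]) auto

lemma test_function_sum:
  "(\<And>i. i \<in> I \<Longrightarrow> f i \<in> test_functions) \<Longrightarrow> (\<lambda>x. \<Sum>i\<in>I. f i x) \<in> test_functions"
  by (induction I rule: infinite_finite_induct) (auto intro: test_function_zero test_function_add)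

lemma test_function_deriv:
  assumes "\<phi> \<in> test_functions"
  obtains \<phi>' where "\<phi>' \<in> test_functions" "\<And>x. (\<phi> has_vector_derivative \<phi>' x) (at x)"
proof -
  obtain R where R: "R > 0" "\<And>x. \<bar>x\<bar> > R \<Longrightarrow> \<phi> x = 0" using test_functionE[OF assms] by blast
  obtain \<phi>' where \<phi>': "smooth \<phi>'" "\<And>x. (\<phi> has_vector_derivative \<phi>' x) (at x)"
    using smoothD[OF test_function_smooth[OF assms]] by blast
  have "\<phi>' x = 0" if "\<bar>x\<bar> > R" for x
  proof -
    have "((\<lambda>x. 0) has_vector_derivative \<phi>' x) (at x)"
    proof (rule has_vector_derivative_transform_within_open[OF \<phi>'(2)])
      show "open {x. \<bar>x\<bar> > R}" by (intro open_Collect_less continuous_intros)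
    qed (use that R in auto)
    then show ?thesis
      using vector_derivative_unique_at has_vector_derivative_const by blast
  qed
  with \<phi>' that show ?thesis by (metis test_functionI)
qed

lemma test_function_continuous: "\<phi> \<in> test_functions \<Longrightarrow> continuous_on S \<phi>"
  by (intro smooth_continuous test_function_smooth)

lemma test_function_borel [measurable_dest]: "\<phi> \<in> test_functions \<Longrightarrow> \<phi> \<in> borel_measurable borel"
  by (intro borel_measurable_continuous_onI test_function_continuous)

lemma test_function_indicator:
  assumes "\<And>x. \<bar>x\<bar> > R \<Longrightarrow> \<phi> x = 0"
  shows "(\<phi> :: real \<Rightarrow> complex) = (\<lambda>x. indicator {-R..R} x *\<^sub>R \<phi> x)"
  using assms by (auto simp: indicator_def fun_eq_iff)

lemma test_function_integrable:
  assumes "\<phi> \<in> test_functions"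
  shows "integrable lborel \<phi>"
proof -
  obtain R where R: "R > 0" "\<And>x. \<bar>x\<bar> > R \<Longrightarrow> \<phi> x = 0" using test_functionE[OF assms] by blast
  have "set_integrable lborel {-R..R} \<phi>"
    by (intro borel_integrable_atLeastAtMost' test_function_continuous assms)
  then show ?thesis
    using test_function_indicator[of R \<phi>, OF R(2)] by (simp add: set_integrable_def)
qed

text \<open>This is the source of all decay: applied to \<open>e\<^sub>-\<^sub>x \<phi>\<close> it gives the transform of \<open>\<phi>'\<close>.\<close>

lemma integral_test_function_deriv:
  assumes "\<phi> \<in> test_functions" "\<phi>' \<in> test_functions" "\<And>x. (\<phi> has_vector_derivative \<phi>' x) (at x)"
  shows "(LBINT x. \<phi>' x) = 0"
proof -
  obtain R where R: "R > 0" "\<And>x. \<bar>x\<bar> > R \<Longrightarrow> \<phi> x = 0" using test_functionE[OF assms(1)] by blast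
  obtain S where S: "S > 0" "\<And>x. \<bar>x\<bar> > S \<Longrightarrow> \<phi>' x = 0" using test_functionE[OF assms(2)] by blast
  define T where "T = max R S + 1"
  have "\<phi>' = (\<lambda>x. indicator {-T..T} x *\<^sub>R \<phi>' x)"
    by (rule test_function_indicator) (use S in \<open>auto simp: T_def\<close>)
  then have "(LBINT x. \<phi>' x) = (LBINT x. indicator {-T..T} x *\<^sub>R \<phi>' x)" by simp
  also have "\<dots> = \<phi> T - \<phi> (-T)"
    by (rule integral_FTC_atLeastAtMost)
       (use R S in \<open>auto simp: T_def intro: has_vector_derivative_at_within assms test_function_continuous\<close>)
  also have "\<dots> = 0" using R by (simp add: T_def)
  finally show ?thesis .
qed

lemma fourier_deriv_test_function:
  assumes "\<phi> \<in> test_functions" "\<phi>' \<in> test_functions" "\<And>x. (\<phi> has_vector_derivative \<phi>' x) (at x)"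
  shows "fourier \<phi>' x = (2 * of_real pi * \<i> * of_real x) * fourier \<phi> x"
proof -
  let ?h' = "\<lambda>t. chr (-x) t * \<phi>' t + (2 * of_real pi * \<i> * of_real (-x)) * (chr (-x) t * \<phi> t)"
  have "(LBINT t. ?h' t) = 0"
  proof (rule integral_test_function_deriv)
    show "(\<lambda>t. chr (-x) t * \<phi> t) \<in> test_functions" by (intro test_function_mult assms smooth_chr)
    show "?h' \<in> test_functions"
      by (intro test_function_add test_function_mult(2) assms smooth_chr smooth_const)
    fix t
    have "((\<lambda>t. chr (-x) t * \<phi> t) has_vector_derivative
       (chr (-x) t * \<phi>' t + (2 * of_real pi * \<i> * of_real (-x)) * chr (-x) t * \<phi> t)) (at t)"
      by (rule has_vector_derivative_mult[OF chr_has_vector_derivative_right assms(3)])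
    then show "((\<lambda>t. chr (-x) t * \<phi> t) has_vector_derivative ?h' t) (at t)"
      by (simp only: mult.assoc)
  qed
  moreover have "(LBINT t. ?h' t) = (LBINT t. chr (-x) t * \<phi>' t) +
      (LBINT t. (2 * of_real pi * \<i> * of_real (-x)) * (chr (-x) t * \<phi> t))"
    by (intro Bochner_Integration.integral_add integrable_mult_right integrable_chr_mult
        test_function_integrable assms)
  moreover have "(LBINT t. (2 * of_real pi * \<i> * of_real (-x)) * (chr (-x) t * \<phi> t)) =
      (2 * of_real pi * \<i> * of_real (-x)) * (LBINT t. chr (-x) t * \<phi> t)"
    by (rule integral_mult_right_zero)
  ultimately show ?thesis
    using assms by (simp add: fourier_eq_lborel test_function_borel add_eq_0_iff)
qed

text \<open>Each integration by parts trades a derivative of the test function for a factor \<open>x\<close>.\<close>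

lemma fourier_test_function_decay:
  assumes "\<phi> \<in> test_functions"
  shows "\<exists>C. \<forall>x. \<bar>x\<bar> ^ m * norm (fourier \<phi> x) \<le> C"
  using assms
proof (induction m arbitrary: \<phi>)
  case 0
  show ?case using norm_fourier_le[OF test_function_integrable[OF 0]] by auto
next
  case (Suc m)
  obtain \<phi>' where \<phi>': "\<phi>' \<in> test_functions" "\<And>x. (\<phi> has_vector_derivative \<phi>' x) (at x)"
    using test_function_deriv[OF Suc.prems] by blast
  obtain C where C: "\<And>x. \<bar>x\<bar> ^ m * norm (fourier \<phi>' x) \<le> C" using Suc.IH[OF \<phi>'(1)] by blast
  have "\<bar>x\<bar> ^ Suc m * norm (fourier \<phi> x) \<le> C" for x
  proof -
    have "1 * (\<bar>x\<bar> ^ Suc m * norm (fourier \<phi> x)) \<le> (2 * pi) * (\<bar>x\<bar> ^ Suc m * norm (fourier \<phi> x))"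
      using pi_ge_two by (intro mult_right_mono mult_nonneg_nonneg) auto
    also have "\<dots> = \<bar>x\<bar> ^ m * norm (fourier \<phi>' x)"
      by (simp add: fourier_deriv_test_function[OF Suc.prems \<phi>'] norm_mult)
    finally show ?thesis using C[of x] by simp
  qed
  then show ?case by blast
qed

lemma fourier_test_function_square_decay:
  assumes "\<phi> \<in> test_functions"
  obtains C where "C \<ge> 0" "\<And>x. norm (fourier \<phi> x) \<le> C / (1 + x\<^sup>2)"
proof -
  obtain A B where A: "\<And>x. \<bar>x\<bar> ^ 0 * norm (fourier \<phi> x) \<le> A"
    and B: "\<And>x. \<bar>x\<bar> ^ 2 * norm (fourier \<phi> x) \<le> B"
    using fourier_test_function_decay[OF assms] by metis
  have le: "norm (fourier \<phi> x) * (1 + x\<^sup>2) \<le> A + B" for x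
    using A[of x] B[of x] by (simp add: algebra_simps)
  have "A + B \<ge> 0" using le[of 0] norm_ge_zero[of "fourier \<phi> 0"] by (simp del: norm_ge_zero)
  moreover have "norm (fourier \<phi> x) \<le> (A + B) / (1 + x\<^sup>2)" for x
    using le[of x] by (simp add: pos_le_divide_eq add_pos_nonneg)
  ultimately show ?thesis using that by blast
qed

lemma fourier_test_function_amalgam:
  assumes "\<phi> \<in> test_functions"
  shows "amalgam (fourier \<phi>)"
proof -
  obtain C where "\<And>x. norm (fourier \<phi> x) \<le> C / (1 + x\<^sup>2)"
    using fourier_test_function_square_decay[OF assms] by blast
  then show ?thesis
    by (intro decay_amalgam[where C = C]) (simp add: pos_le_divide_eq add_pos_nonneg)
qed

lemma fourier_test_function_continuous: "\<phi> \<in> test_functions \<Longrightarrow> continuous_on S (fourier \<phi>)"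
  using continuous_fourier[OF test_function_integrable] continuous_on_subset by blast

lemma fourier_test_function_borel: "\<phi> \<in> test_functions \<Longrightarrow> fourier \<phi> \<in> borel_measurable borel"
  by (intro borel_measurable_continuous_onI fourier_test_function_continuous)

lemma fourier_test_function_integrable: "\<phi> \<in> test_functions \<Longrightarrow> integrable lborel (fourier \<phi>)"
  by (intro amalgam_integrable fourier_test_function_amalgam fourier_test_function_borel)

text \<open>On a compact support the integral may be differentiated under the integral sign. The result is again
  the transform of a test function, so that transforms of test functions are Schwartz functions by
  coinduction.\<close>

lemma fourier_test_function_has_derivative:
  assumes "\<phi> \<in> test_functions"
  shows "(fourier \<phi> has_vector_derivative fourier (\<lambda>t. (- 2 * of_real pi * \<i> * of_real t) * \<phi> t) x) (at x)"
proof -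
  obtain R where R: "R > 0" "\<And>x. \<bar>x\<bar> > R \<Longrightarrow> \<phi> x = 0" using test_functionE[OF assms] by blast
  have eq: "fourier \<psi> y = integral (cbox (-R) R) (\<lambda>t. chr (- y) t * \<psi> t)"
    if "\<psi> \<in> test_functions" "\<And>x. \<bar>x\<bar> > R \<Longrightarrow> \<psi> x = 0" for \<psi> y
  proof -
    have "fourier \<psi> y = (LBINT t. indicator {-R..R} t *\<^sub>R (chr (- y) t * \<psi> t))"
      unfolding fourier_eq_lborel[OF test_function_borel[OF that(1)]]
      by (intro Bochner_Integration.integral_cong) (use that(2) in \<open>auto simp: indicator_def\<close>)
    also have "\<dots> = integral {-R..R} (\<lambda>t. chr (- y) t * \<psi> t)"
      unfolding set_lebesgue_integral_def[symmetric]
      by (intro set_borel_integral_eq_integral borel_integrable_atLeastAtMost'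
          test_function_continuous test_function_mult that smooth_chr)
    finally show ?thesis by simp
  qed
  let ?\<psi> = "\<lambda>t. (- 2 * of_real pi * \<i> * of_real t) * \<phi> t"
  have \<psi>: "?\<psi> \<in> test_functions"
    by (intro test_function_mult assms smooth_mult smooth_const smooth_of_real)
  have "((\<lambda>y. integral (cbox (-R) R) (\<lambda>t. chr (- y) t * \<phi> t)) has_vector_derivative
      integral (cbox (-R) R) (\<lambda>t. chr (- x) t * ?\<psi> t)) (at x within UNIV)"
  proof (rule leibniz_rule_vector_derivative)
    fix y t
    have "((\<lambda>y. chr y (- t)) has_vector_derivative (2 * of_real pi * \<i> * of_real (- t)) * chr y (- t)) (at y)"
      by (rule chr_has_vector_derivative_left)
    from has_vector_derivative_mult_left[OF this, of "\<phi> t"]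
    show "((\<lambda>y. chr (- y) t * \<phi> t) has_vector_derivative chr (- y) t * ?\<psi> t) (at y within UNIV)"
      by (simp add: chr_minus mult_ac)
  next
    fix y show "(\<lambda>t. chr (- y) t * \<phi> t) integrable_on cbox (-R) R"
      by (intro integrable_continuous continuous_intros test_function_continuous assms)
  next
    show "continuous_on (UNIV \<times> cbox (-R) R) (\<lambda>(y, t). chr (- y) t * ?\<psi> t)"
      unfolding case_prod_beta'
      by (intro continuous_intros continuous_on_compose2[OF test_function_continuous[OF assms, of UNIV]]) auto
  qed auto
  moreover have "fourier \<phi> = (\<lambda>y. integral (cbox (-R) R) (\<lambda>t. chr (- y) t * \<phi> t))"
    using eq[OF assms R(2)] by blast
  moreover have "fourier ?\<psi> x = integral (cbox (-R) R) (\<lambda>t. chr (- x) t * ?\<psi> t)"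
    by (rule eq[OF \<psi>]) (use R in simp)
  ultimately show ?thesis by simp
qed

lemma fourier_test_function_schwartz:
  assumes "\<phi> \<in> test_functions"
  shows "fourier \<phi> \<in> schwartz"
proof -
  let ?P = "\<lambda>f. \<exists>\<phi>\<in>test_functions. f = fourier \<phi>"
  have step: "\<exists>g'. ?P g' \<and> (\<forall>x. (g has_vector_derivative g' x) (at x))" if "?P g" for g
  proof -
    from that obtain \<phi> where \<phi>: "\<phi> \<in> test_functions" "g = fourier \<phi>" by blast
    have "(\<lambda>t. (- 2 * of_real pi * \<i> * of_real t) * \<phi> t) \<in> test_functions"
      by (intro test_function_mult \<phi> smooth_mult smooth_const smooth_of_real)
    with fourier_test_function_has_derivative[OF \<phi>(1)] \<phi>(2) show ?thesis by blast
  qed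
  have it: "?P (iter_deriv n (fourier \<phi>))" for n
  proof (induction n)
    case 0
    then show ?case using assms by auto
  next
    case (Suc n)
    then obtain g' where g': "?P g'" "\<And>x. (iter_deriv n (fourier \<phi>) has_vector_derivative g' x) (at x)"
      using step by blast
    then have "iter_deriv (Suc n) (fourier \<phi>) = g'"
      unfolding iter_deriv_Suc_left by (auto intro: vector_derivative_at)
    with g' show ?case by blast
  qed
  have "smooth (fourier \<phi>)"
    by (rule smooth_coinduct[where P = ?P]) (use assms step in auto)
  moreover have "bdd_above (range (\<lambda>x. \<bar>x\<bar> ^ m * norm (iter_deriv n (fourier \<phi>) x)))" for m n
  proof -
    obtain \<psi> where "\<psi> \<in> test_functions" "iter_deriv n (fourier \<phi>) = fourier \<psi>" using it by blast
    with fourier_test_function_decay[of \<psi> m] show ?thesis by (auto simp: bdd_above_def)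
  qed
  ultimately show ?thesis by (simp add: schwartz_def)
qed

section \<open>Fourier inversion\<close>

text \<open>A rescaling of the characteristic function of the standard normal distribution.\<close>

lemma integral_gaussian_chr:
  assumes "e > 0"
  shows "(LBINT y. of_real (exp (- (e * y)\<^sup>2 / 2)) * chr y a) =
    of_real (sqrt (2 * pi) / e * exp (- (2 * pi * a / e)\<^sup>2 / 2))"
proof -
  have c: "(LBINT z. of_real (std_normal_density z) * iexp (t * z)) = of_real (exp (- t\<^sup>2 / 2))" for t
  proof -
    have "char std_normal_distribution t = (LBINT z. of_real (std_normal_density z) * iexp (t * z))"
      unfolding char_def by (subst integral_density) (auto simp: scaleR_conv_of_real)
    then show ?thesis by (simp add: char_std_normal_distribution)
  qed
  have "(LBINT y. of_real (exp (- (e * y)\<^sup>2 / 2)) * chr y a) =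
      \<bar>1 / e\<bar> *\<^sub>R (LBINT z. of_real (exp (- (e * (0 + 1 / e * z))\<^sup>2 / 2)) * chr (0 + 1 / e * z) a)"
    by (rule lborel_integral_real_affine) (use assms in simp)
  also have "(LBINT z. of_real (exp (- (e * (0 + 1 / e * z))\<^sup>2 / 2)) * chr (0 + 1 / e * z) a) =
      (LBINT z. of_real (sqrt (2 * pi)) * (of_real (std_normal_density z) * iexp ((2 * pi * a / e) * z)))"
    using assms by (intro Bochner_Integration.integral_cong)
      (auto simp: std_normal_density_def chr_def mult_ac real_sqrt_mult)
  also have "\<dots> = of_real (sqrt (2 * pi)) * of_real (exp (- (2 * pi * a / e)\<^sup>2 / 2))"
    by (subst integral_mult_right_zero) (simp only: c)
  finally show ?thesis
    using assms by (simp add: scaleR_conv_of_real)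
qed

text \<open>The transform is damped by a wide Gaussian. By Fubini the damped inversion integral is the average of
  \<open>\<phi>\<close> against a narrow Gaussian around \<open>t\<close>, which tends to \<open>\<phi>(t)\<close>.\<close>

theorem fourier_inversion_test_function:
  assumes "\<phi> \<in> test_functions"
  shows "(LBINT y. chr y t * fourier \<phi> y) = \<phi> t"
proof -
  define e where "e n = 1 / real (Suc n)" for n
  have e0: "e n > 0" for n by (simp add: e_def)
  have elim: "e \<longlonglongrightarrow> 0"
    unfolding e_def using LIMSEQ_inverse_real_of_nat by (simp add: inverse_eq_divide)
  define g where "g n y = complex_of_real (exp (- (e n * y)\<^sup>2 / 2))" for n y
  have gm: "g n \<in> borel_measurable borel" for n
    unfolding g_def by (intro borel_measurable_continuous_onI continuous_intros) auto
  have g1: "norm (g n y) \<le> 1" for n y by (simp add: g_def)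
  note \<phi>i = test_function_integrable[OF assms] and \<phi>m = test_function_borel[OF assms]
  note fi = fourier_test_function_integrable[OF assms] and fm = fourier_test_function_borel[OF assms]
  have gi: "integrable lborel (g n)" for n
  proof -
    have "integrable lborel (\<lambda>y. std_normal_density (0 + e n * y))"
      using e0[of n] by (intro lborel_integrable_real_affine integrable_normal_density) auto
    then have "integrable lborel (\<lambda>y. sqrt (2 * pi) * std_normal_density (0 + e n * y))"
      by (rule integrable_mult_right)
    then have "integrable lborel (\<lambda>y. exp (- (e n * y)\<^sup>2 / 2))"
      by (simp add: std_normal_density_def)
    then show ?thesis unfolding g_def by (rule integrable_of_real)
  qed
  have J: "(LBINT y. g n y * (chr y t * fourier \<phi> y)) =
      (LBINT s. of_real (std_normal_density s) * \<phi> (t + e n / (2 * pi) * s))" for n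
  proof -
    have "(LBINT y. g n y * (chr y t * fourier \<phi> y)) =
        (LBINT y. LBINT u. \<phi> u * g n y * chr y (t - u))"
    proof (rule Bochner_Integration.integral_cong[OF refl])
      fix y
      have "g n y * (chr y t * fourier \<phi> y) = (LBINT u. (g n y * chr y t) * (chr (- y) u * \<phi> u))"
        unfolding fourier_eq_lborel[OF \<phi>m] by (subst integral_mult_right_zero) (simp add: mult.assoc)
      also have "\<dots> = (LBINT u. \<phi> u * g n y * chr y (t - u))"
        using chr_add_right[of y t] by (intro Bochner_Integration.integral_cong)
          (simp_all add: chr_minus diff_conv_add_uminus del: add_uminus_conv_diff)
      finally show "g n y * (chr y t * fourier \<phi> y) = \<dots>" .
    qed
    also have "\<dots> = (LBINT u. LBINT y. \<phi> u * g n y * chr y (t - u))"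
      by (rule Fubini_bounded_kernel[OF \<phi>i gi])
         (auto simp: case_prod_beta' intro!: continuous_intros)
    also have "\<dots> = (LBINT u. \<phi> u * of_real (sqrt (2 * pi) / e n * exp (- (2 * pi * (t - u) / e n)\<^sup>2 / 2)))"
      unfolding mult.assoc integral_mult_right_zero g_def integral_gaussian_chr[OF e0] ..
    also have "\<dots> = \<bar>e n / (2 * pi)\<bar> *\<^sub>R (LBINT s. \<phi> (t + e n / (2 * pi) * s) *
        of_real (sqrt (2 * pi) / e n * exp (- (2 * pi * (t - (t + e n / (2 * pi) * s)) / e n)\<^sup>2 / 2)))"
      by (rule lborel_integral_real_affine) (use e0[of n] in simp)
    also have "\<dots> = (LBINT s. of_real (e n / (2 * pi)) * (\<phi> (t + e n / (2 * pi) * s) *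
        of_real (sqrt (2 * pi) / e n * exp (- (2 * pi * (t - (t + e n / (2 * pi) * s)) / e n)\<^sup>2 / 2))))"
      using e0[of n] by (subst integral_mult_right_zero) (simp add: scaleR_conv_of_real)
    also have "\<dots> = (LBINT s. of_real (std_normal_density s) * \<phi> (t + e n / (2 * pi) * s))"
    proof (rule Bochner_Integration.integral_cong[OF refl])
      fix s
      have 1: "2 * pi * (t - (t + e n / (2 * pi) * s)) / e n = - s"
        using e0[of n] by (simp add: field_simps)
      have "sqrt (2 * pi) * sqrt (2 * pi) = 2 * pi" by simp
      then have 2: "e n / (2 * pi) * (sqrt (2 * pi) / e n) = 1 / sqrt (2 * pi)"
        using e0[of n] by (simp add: field_simps)
      have "of_real (e n / (2 * pi)) * (\<phi> (t + e n / (2 * pi) * s) *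
          of_real (sqrt (2 * pi) / e n * exp (- (2 * pi * (t - (t + e n / (2 * pi) * s)) / e n)\<^sup>2 / 2)))
        = of_real (e n / (2 * pi) * (sqrt (2 * pi) / e n) * exp (- (- s)\<^sup>2 / 2)) * \<phi> (t + e n / (2 * pi) * s)"
        unfolding 1 of_real_mult by (simp only: mult_ac)
      then show "of_real (e n / (2 * pi)) * (\<phi> (t + e n / (2 * pi) * s) *
          of_real (sqrt (2 * pi) / e n * exp (- (2 * pi * (t - (t + e n / (2 * pi) * s)) / e n)\<^sup>2 / 2)))
        = of_real (std_normal_density s) * \<phi> (t + e n / (2 * pi) * s)"
        unfolding 2 std_normal_density_def by simp
    qed
    finally show ?thesis .
  qed
  have l1: "(\<lambda>n. LBINT y. g n y * (chr y t * fourier \<phi> y)) \<longlonglongrightarrow> (LBINT y. chr y t * fourier \<phi> y)"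
  proof (rule integral_dominated_convergence[where w = "\<lambda>y. norm (fourier \<phi> y)"])
    show "AE y in lborel. (\<lambda>n. g n y * (chr y t * fourier \<phi> y)) \<longlonglongrightarrow> chr y t * fourier \<phi> y"
    proof (rule AE_I2)
      fix y
      have "(\<lambda>n. g n y) \<longlonglongrightarrow> of_real (exp (- (0 * y)\<^sup>2 / 2))"
        unfolding g_def by (intro tendsto_intros elim) auto
      then show "(\<lambda>n. g n y * (chr y t * fourier \<phi> y)) \<longlonglongrightarrow> chr y t * fourier \<phi> y"
        using tendsto_mult_right by fastforce
    qed
    show "AE y in lborel. norm (g n y * (chr y t * fourier \<phi> y)) \<le> norm (fourier \<phi> y)" for n
      using g1 by (auto simp: norm_mult intro!: mult_left_le_one_le)
    have "chr y t = chr t y" for y by (rule chr_commute)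
    then show "(\<lambda>y. chr y t * fourier \<phi> y) \<in> borel_measurable lborel"
      "\<And>n. (\<lambda>y. g n y * (chr y t * fourier \<phi> y)) \<in> borel_measurable lborel"
      using fm gm by auto
    show "integrable lborel (\<lambda>y. norm (fourier \<phi> y))" using fi by auto
  qed
  obtain R where R: "R > 0" "\<And>x. \<bar>x\<bar> > R \<Longrightarrow> \<phi> x = 0" using test_functionE[OF assms] by blast
  have "bounded (\<phi> ` {-R..R})"
    by (intro compact_imp_bounded compact_continuous_image test_function_continuous assms) auto
  then obtain B where B: "B > 0" "\<And>x. x \<in> {-R..R} \<Longrightarrow> norm (\<phi> x) \<le> B"
    by (metis bounded_pos imageI)
  have B': "norm (\<phi> x) \<le> B" for x
    using B R(2)[of x] by (cases "x \<in> {-R..R}") (force+)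
  have ni: "integrable lborel std_normal_density" by (rule integrable_normal_density) simp
  have l2: "(\<lambda>n. LBINT s. of_real (std_normal_density s) * \<phi> (t + e n / (2 * pi) * s)) \<longlonglongrightarrow>
      (LBINT s. of_real (std_normal_density s) * \<phi> t)"
  proof (rule integral_dominated_convergence[where w = "\<lambda>s. std_normal_density s * B"])
    show "AE s in lborel. (\<lambda>n. of_real (std_normal_density s) * \<phi> (t + e n / (2 * pi) * s))
        \<longlonglongrightarrow> of_real (std_normal_density s) * \<phi> t"
    proof (rule AE_I2)
      fix s
      have "(\<lambda>n. t + e n / (2 * pi) * s) \<longlonglongrightarrow> t + 0 / (2 * pi) * s"
        by (intro tendsto_intros elim) auto
      then have "(\<lambda>n. \<phi> (t + e n / (2 * pi) * s)) \<longlonglongrightarrow> \<phi> (t + 0 / (2 * pi) * s)"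
        using test_function_continuous[OF assms, of UNIV]
        by (intro isCont_tendsto_compose[of _ \<phi>]) (simp_all add: continuous_on_eq_continuous_at)
      then show "(\<lambda>n. of_real (std_normal_density s) * \<phi> (t + e n / (2 * pi) * s))
        \<longlonglongrightarrow> of_real (std_normal_density s) * \<phi> t"
        by (intro tendsto_intros) simp
    qed
    show "AE s in lborel. norm (of_real (std_normal_density s) * \<phi> (t + e n / (2 * pi) * s)) \<le> std_normal_density s * B" for n
      using B' by (auto simp: norm_mult intro!: mult_left_mono)
    show "integrable lborel (\<lambda>s. std_normal_density s * B)" using ni by auto
  qed (use \<phi>m in auto)
  have "(LBINT s. of_real (std_normal_density s) * \<phi> t) = \<phi> t"
    by (subst integral_mult_left_zero, subst integral_complex_of_real) (simp add: integral_normal_density)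
  with l1 l2 show ?thesis
    unfolding J using LIMSEQ_unique by force
qed

text \<open>Multiplication on the frequency side becomes convolution: the second factor is replaced by its
  inversion integral.\<close>

lemma fourier_mult_test_functions:
  assumes "\<eta> \<in> test_functions" "v \<in> test_functions"
  shows "fourier (\<lambda>t. \<eta> t * v t) z = (LBINT y. fourier v y * fourier \<eta> (z - y))"
proof -
  have "fourier (\<lambda>t. \<eta> t * v t) z = (LBINT t. chr (- z) t * (\<eta> t * v t))"
    using assms by (intro fourier_eq_lborel) (auto dest: test_function_borel)
  also have "\<dots> = (LBINT t. LBINT y. \<eta> t * fourier v y * chr (y - z) t)"
  proof (rule Bochner_Integration.integral_cong[OF refl])
    fix t
    have "chr (- z) t * (\<eta> t * v t) = (LBINT y. (chr (- z) t * \<eta> t) * (chr y t * fourier v y))"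
      by (subst integral_mult_right_zero)
         (simp only: fourier_inversion_test_function[OF assms(2)] mult.assoc)
    also have "\<dots> = (LBINT y. \<eta> t * fourier v y * chr (y - z) t)"
      using chr_add_left[of _ "-z" t] by (intro Bochner_Integration.integral_cong) simp_all
    finally show "chr (- z) t * (\<eta> t * v t) = \<dots>" .
  qed
  also have "\<dots> = (LBINT y. LBINT t. \<eta> t * fourier v y * chr (y - z) t)"
    by (rule Fubini_bounded_kernel[symmetric])
       (auto simp: case_prod_beta' intro!: continuous_intros test_function_integrable
         fourier_test_function_integrable assms)
  also have "\<dots> = (LBINT y. fourier v y * fourier \<eta> (z - y))"
  proof (rule Bochner_Integration.integral_cong[OF refl])
    fix y
    have "(LBINT t. \<eta> t * fourier v y * chr (y - z) t) = (LBINT t. fourier v y * (chr (- (z - y)) t * \<eta> t))"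
      by (simp add: mult_ac)
    then show "(LBINT t. \<eta> t * fourier v y * chr (y - z) t) = fourier v y * fourier \<eta> (z - y)"
      by (simp only: integral_mult_right_zero fourier_eq_lborel[OF test_function_borel[OF assms(1)]])
  qed
  finally show ?thesis .
qed

lemma fourier_chr_mult:
  assumes "\<eta> \<in> borel_measurable borel"
  shows "fourier (\<lambda>t. \<eta> t * chr x t) z = fourier \<eta> (z - x)"
proof -
  have e: "chr (- z) t * (\<eta> t * chr x t) = chr (- (z - x)) t * \<eta> t" for t
    using chr_add_left[of "-z" x t] by (simp add: mult_ac)
  have "(\<lambda>t. \<eta> t * chr x t) \<in> borel_measurable borel" using assms by simp
  then show ?thesis unfolding fourier_eq_lborel[OF assms] by (simp only: fourier_eq_lborel e)
qed

lemma fourier_dilate: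
  assumes "V \<in> borel_measurable borel" "\<delta> > 0"
  shows "fourier (\<lambda>t. V ((t - s) / \<delta>)) y = of_real \<delta> * (chr (- y) s * fourier V (\<delta> * y))"
proof -
  have "fourier (\<lambda>t. V ((t - s) / \<delta>)) y = (LBINT t. chr (- y) t * V ((t - s) / \<delta>))"
    using assms by (intro fourier_eq_lborel) auto
  also have "\<dots> = \<bar>\<delta>\<bar> *\<^sub>R (LBINT u. chr (- y) (s + \<delta> * u) * V ((s + \<delta> * u - s) / \<delta>))"
    by (rule lborel_integral_real_affine) (use assms in simp)
  also have "(LBINT u. chr (- y) (s + \<delta> * u) * V ((s + \<delta> * u - s) / \<delta>)) =
      (LBINT u. chr (- y) s * (chr (- (\<delta> * y)) u * V u))"
    using assms(2) chr_scale[of \<delta> "-y"] by (intro Bochner_Integration.integral_cong)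
      (simp_all add: chr_add_right mult_ac)
  finally show ?thesis
    using assms by (simp add: fourier_eq_lborel scaleR_conv_of_real)
qed

section \<open>Cutoffs, and density of the test functions\<close>

definition plateau :: "real \<Rightarrow> complex" where
  "plateau t = smooth_step (t + 2) * smooth_step (2 - t)"

lemma plateau_1: "\<bar>t\<bar> \<le> 1 \<Longrightarrow> plateau t = 1"
  by (simp add: plateau_def smooth_step_1)

lemma plateau_0: "\<bar>t\<bar> \<ge> 2 \<Longrightarrow> plateau t = 0"
  by (cases "t \<ge> 0") (auto simp: plateau_def smooth_step_0)

lemma smooth_plateau: "smooth plateau"
proof -
  have "smooth (\<lambda>t. smooth_step (1 * t + 2) * smooth_step (- 1 * t + 2))"
    by (rule smooth_mult; rule smooth_affine, rule smooth_smooth_step)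
  then show ?thesis by (simp add: plateau_def[abs_def] algebra_simps)
qed

lemma plateau_test_function: "plateau \<in> test_functions"
  by (rule test_functionI[OF smooth_plateau, of 2]) (simp add: plateau_0)

lemma plateau_scaled_test_function:
  assumes "\<delta> > 0"
  shows "(\<lambda>t. plateau ((t - s) / \<delta>)) \<in> test_functions"
proof (rule test_functionI)
  have "smooth (\<lambda>t. plateau ((1 / \<delta>) * t + (- s / \<delta>)))"
    by (rule smooth_affine[OF smooth_plateau])
  then show "smooth (\<lambda>t. plateau ((t - s) / \<delta>))" by (simp add: diff_divide_distrib)
  show "plateau ((x - s) / \<delta>) = 0" if "\<bar>x\<bar> > \<bar>s\<bar> + 2 * \<delta>" for x
    using that assms by (intro plateau_0) (simp add: abs_divide le_divide_eq)
qed

lemma iter_deriv_add: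
  assumes "smooth f" "smooth g"
  shows "iter_deriv n (\<lambda>x. f x + g x) = (\<lambda>x. iter_deriv n f x + iter_deriv n g x)"
  using assms
proof (induction n arbitrary: f g)
  case (Suc n)
  obtain f' g' where d: "smooth f'" "\<And>x. (f has_vector_derivative f' x) (at x)"
    "smooth g'" "\<And>x. (g has_vector_derivative g' x) (at x)"
    using smoothD Suc.prems by metis
  have "iter_deriv (Suc n) (\<lambda>x. f x + g x) = iter_deriv n (\<lambda>x. f' x + g' x)"
    by (intro iter_deriv_Suc has_vector_derivative_add d)
  then show ?case
    using Suc.IH[OF d(1,3)] iter_deriv_Suc[OF d(2)] iter_deriv_Suc[OF d(4)] by simp
qed simp

lemma iter_deriv_affine:
  assumes "smooth f"
  shows "iter_deriv n (\<lambda>x. of_real c * f (a * x)) = (\<lambda>x. of_real (c * a ^ n) * iter_deriv n f (a * x))"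
  using assms
proof (induction n arbitrary: f c)
  case (Suc n)
  obtain f' where d: "smooth f'" "\<And>x. (f has_vector_derivative f' x) (at x)"
    using smoothD Suc.prems by metis
  have "((\<lambda>x. of_real c * f (a * x)) has_vector_derivative of_real (c * a) * f' (a * x)) (at x)" for x
  proof -
    have "((\<lambda>x. a * x) has_vector_derivative a) (at x)"
      by (auto intro!: derivative_eq_intros)
    from has_vector_derivative_mult_right[OF vector_diff_chain_at[OF this d(2)], of "of_real c"] show ?thesis
      by (simp add: o_def scaleR_conv_of_real mult.assoc)
  qed
  then have "iter_deriv (Suc n) (\<lambda>x. of_real c * f (a * x)) = iter_deriv n (\<lambda>x. of_real (c * a) * f' (a * x))"
    by (rule iter_deriv_Suc)
  then show ?case
    using Suc.IH[OF d(1), of "c * a"] iter_deriv_Suc[OF d(2)] by (simp add: mult_ac)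
qed simp

text \<open>A crude form of the Leibniz rule: each differentiation doubles the number of terms.\<close>

lemma norm_iter_deriv_mult_le:
  assumes "smooth f" "smooth g"
    and "\<And>i. i \<le> n \<Longrightarrow> norm (iter_deriv i f x) \<le> A" "\<And>i. i \<le> n \<Longrightarrow> norm (iter_deriv i g x) \<le> B"
  shows "norm (iter_deriv n (\<lambda>x. f x * g x) x) \<le> 2 ^ n * (A * B)"
  using assms
proof (induction n arbitrary: f g)
  case 0
  from "0.prems"(3)[of 0] have "0 \<le> A" using norm_ge_zero order_trans by blast
  with "0.prems"(3)[of 0] "0.prems"(4)[of 0] show ?case by (auto simp: norm_mult intro: mult_mono)
next
  case (Suc n)
  obtain f' g' where d: "smooth f'" "\<And>x. (f has_vector_derivative f' x) (at x)"
    "smooth g'" "\<And>x. (g has_vector_derivative g' x) (at x)"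
    using smoothD Suc.prems by metis
  have "iter_deriv (Suc n) (\<lambda>x. f x * g x) = iter_deriv n (\<lambda>x. f x * g' x + f' x * g x)"
    by (intro iter_deriv_Suc has_vector_derivative_mult d)
  also have "\<dots> = (\<lambda>x. iter_deriv n (\<lambda>x. f x * g' x) x + iter_deriv n (\<lambda>x. f' x * g x) x)"
    by (intro iter_deriv_add smooth_mult d Suc.prems)
  finally have e: "iter_deriv (Suc n) (\<lambda>x. f x * g x) x =
      iter_deriv n (\<lambda>x. f x * g' x) x + iter_deriv n (\<lambda>x. f' x * g x) x" by simp
  have f': "norm (iter_deriv i f' x) \<le> A" if "i \<le> n" for i
    using Suc.prems(3)[of "Suc i"] that iter_deriv_Suc[OF d(2)] by simp
  have g': "norm (iter_deriv i g' x) \<le> B" if "i \<le> n" for i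
    using Suc.prems(4)[of "Suc i"] that iter_deriv_Suc[OF d(4)] by simp
  have "norm (iter_deriv n (\<lambda>x. f x * g' x) x) \<le> 2 ^ n * (A * B)"
    by (rule Suc.IH[OF Suc.prems(1) d(3)]) (use Suc.prems(3) g' in auto)
  moreover have "norm (iter_deriv n (\<lambda>x. f' x * g x) x) \<le> 2 ^ n * (A * B)"
    by (rule Suc.IH[OF d(1) Suc.prems(2)]) (use Suc.prems(4) f' in auto)
  ultimately show ?case
    unfolding e using norm_triangle_ineq[of "iter_deriv n (\<lambda>x. f x * g' x) x" "iter_deriv n (\<lambda>x. f' x * g x) x"]
    by simp
qed

lemma iter_deriv_zero_on_open:
  assumes "smooth f" "open S" "\<And>x. x \<in> S \<Longrightarrow> f x = 0" "x \<in> S"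
  shows "iter_deriv n f x = 0"
  using assms
proof (induction n arbitrary: f x)
  case (Suc n)
  obtain f' where d: "smooth f'" "\<And>x. (f has_vector_derivative f' x) (at x)"
    using smoothD Suc.prems by metis
  have "f' x = 0" if "x \<in> S" for x
  proof -
    have "((\<lambda>x. 0) has_vector_derivative f' x) (at x)"
      by (rule has_vector_derivative_transform_within_open[OF d(2)]) (use Suc.prems that in auto)
    then show ?thesis
      using vector_derivative_unique_at has_vector_derivative_const by blast
  qed
  then show ?case
    using Suc.IH[OF d(1) Suc.prems(2)] Suc.prems(4) iter_deriv_Suc[OF d(2)] by simp
qed simp

lemma iter_deriv_test_function:
  assumes "\<phi> \<in> test_functions"
  shows "iter_deriv n \<phi> \<in> test_functions"
  using assms
proof (induction n arbitrary: \<phi>)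
  case (Suc n)
  then show ?case using test_function_deriv iter_deriv_Suc by metis
qed simp

lemma test_function_bounded:
  assumes "\<phi> \<in> test_functions"
  obtains B where "\<And>x. norm (\<phi> x) \<le> B"
proof -
  obtain R where R: "R > 0" "\<And>x. \<bar>x\<bar> > R \<Longrightarrow> \<phi> x = 0" using test_functionE[OF assms] by blast
  have "bounded (\<phi> ` {-R..R})"
    by (intro compact_imp_bounded compact_continuous_image test_function_continuous assms) auto
  then obtain B where B: "B > 0" "\<And>x. x \<in> {-R..R} \<Longrightarrow> norm (\<phi> x) \<le> B"
    by (metis bounded_pos imageI)
  have "norm (\<phi> x) \<le> B" for x
    using B R(2)[of x] by (cases "x \<in> {-R..R}") (force+)
  then show ?thesis by (rule that)
qed

lemma one_minus_plateau_deriv_bounded: "\<exists>B. \<forall>x. norm (iter_deriv n (\<lambda>x. 1 - plateau x) x) \<le> B"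
proof -
  have c: "\<exists>C. iter_deriv n (\<lambda>x. 1 :: complex) = (\<lambda>x. C)" for n
  proof (induction n)
    case (Suc n)
    then show ?case by (auto simp: iter_deriv_Suc_left)
  qed auto
  have t: "(\<lambda>x. -1 * plateau x) \<in> test_functions"
    by (intro test_function_mult(2) plateau_test_function smooth_const)
  obtain B where B: "\<And>x. norm (iter_deriv n (\<lambda>x. -1 * plateau x) x) \<le> B"
    using test_function_bounded[OF iter_deriv_test_function[OF t]] by metis
  obtain C where C: "iter_deriv n (\<lambda>x. 1 :: complex) = (\<lambda>x. C)" using c by blast
  have "iter_deriv n (\<lambda>x. 1 + -1 * plateau x) = (\<lambda>x. C + iter_deriv n (\<lambda>x. -1 * plateau x) x)"
    using iter_deriv_add[OF smooth_const[of 1] test_function_smooth[OF t]] C by simp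
  then have "norm (iter_deriv n (\<lambda>x. 1 - plateau x) x) \<le> norm C + B" for x
    using B[of x] norm_triangle_ineq[of C "iter_deriv n (\<lambda>x. -1 * plateau x) x"] by simp
  then show ?thesis by blast
qed

lemma schwartz_bound:
  assumes "\<psi> \<in> schwartz"
  shows "\<bar>x\<bar> ^ m * norm (iter_deriv n \<psi> x) \<le> schwartz_seminorm m n \<psi>"
  unfolding schwartz_seminorm_def
  by (rule cSUP_upper) (use assms in \<open>auto simp: schwartz_def\<close>)

text \<open>The removed part lives on \<open>|x| \<ge> R\<close>, where one spare power of \<open>|x|\<close> in the Schwartz bounds gains the factor
  \<open>1/R\<close>.\<close>

lemma schwartz_cutoff:
  assumes \<psi>: "\<psi> \<in> schwartz"
  shows "\<exists>K. \<forall>R\<ge>1. \<forall>x. \<bar>x\<bar> ^ m * norm (iter_deriv n (\<lambda>x. (1 - plateau (x / R)) * \<psi> x) x) \<le> K / R"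
proof -
  obtain B where B: "\<And>i x. norm (iter_deriv i (\<lambda>x. 1 - plateau x) x) \<le> B i"
    using one_minus_plateau_deriv_bounded by metis
  define B' where "B' = (\<Sum>i\<le>n. B i)"
  define P where "P = (\<Sum>i\<le>n. schwartz_seminorm (Suc m) i \<psi>)"
  have B0: "B i \<ge> 0" for i using B[of i 0] norm_ge_zero order_trans by blast
  have B'0: "B' \<ge> 0" unfolding B'_def by (intro sum_nonneg B0)
  have P0: "schwartz_seminorm (Suc m) i \<psi> \<ge> 0" for i
    using schwartz_bound[OF \<psi>, of 0 "Suc m" i] by simp
  have sm: "smooth \<psi>" using \<psi> by (simp add: schwartz_def)
  have "\<bar>x\<bar> ^ m * norm (iter_deriv n (\<lambda>x. (1 - plateau (x / R)) * \<psi> x) x) \<le> 2 ^ n * B' * P / R"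
    if R: "R \<ge> 1" for R x
  proof -
    have sp: "smooth (\<lambda>x. 1 - plateau x)" by (intro smooth_diff smooth_const smooth_plateau)
    have e: "(\<lambda>x. of_real 1 * (1 - plateau ((1 / R) * x))) = (\<lambda>x. 1 - plateau (x / R))"
      by simp
    have ap: "iter_deriv i (\<lambda>x. 1 - plateau (x / R)) =
        (\<lambda>x. of_real ((1 / R) ^ i) * iter_deriv i (\<lambda>x. 1 - plateau x) ((1 / R) * x))" for i
      using iter_deriv_affine[OF sp, of i 1 "1 / R"] unfolding e by simp
    have sk: "smooth (\<lambda>x. 1 - plateau (x / R))"
      using smooth_affine[OF sp, of "1 / R" 0] by simp
    show ?thesis
    proof (cases "\<bar>x\<bar> < R")
      case True
      have "iter_deriv n (\<lambda>x. (1 - plateau (x / R)) * \<psi> x) x = 0"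
      proof (rule iter_deriv_zero_on_open[of _ "{x. \<bar>x\<bar> < R}"])
        show "open {x :: real. \<bar>x\<bar> < R}" by (intro open_Collect_less continuous_intros)
        show "(1 - plateau (x / R)) * \<psi> x = 0" if "x \<in> {x. \<bar>x\<bar> < R}" for x
          using that R by (subst plateau_1) (auto simp: abs_divide)
      qed (use True smooth_mult[OF sk sm] in auto)
      moreover have "0 \<le> 2 ^ n * B' * P / R"
        using B'0 P0 R unfolding P_def by (intro divide_nonneg_nonneg mult_nonneg_nonneg sum_nonneg) auto
      ultimately show ?thesis by simp
    next
      case False
      have "norm (iter_deriv n (\<lambda>x. (1 - plateau (x / R)) * \<psi> x) x) \<le> 2 ^ n * (B' * (P / \<bar>x\<bar> ^ Suc m))"
      proof (rule norm_iter_deriv_mult_le[OF sk sm])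
        fix i assume i: "i \<le> n"
        have "norm (iter_deriv i (\<lambda>x. 1 - plateau (x / R)) x) = (1 / R) ^ i * norm (iter_deriv i (\<lambda>x. 1 - plateau x) ((1 / R) * x))"
          unfolding ap norm_mult norm_of_real using R by simp
        also have "\<dots> \<le> 1 * B i"
          using R B B0 by (intro mult_mono power_le_one) auto
        also have "\<dots> \<le> B'" unfolding B'_def using i B0 by (simp add: member_le_sum)
        finally show "norm (iter_deriv i (\<lambda>x. 1 - plateau (x / R)) x) \<le> B'" .
        have "\<bar>x\<bar> ^ Suc m * norm (iter_deriv i \<psi> x) \<le> schwartz_seminorm (Suc m) i \<psi>"
          by (rule schwartz_bound[OF \<psi>])
        also have "\<dots> \<le> P" unfolding P_def using i P0 by (intro member_le_sum) auto
        finally show "norm (iter_deriv i \<psi> x) \<le> P / \<bar>x\<bar> ^ Suc m"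
          using False R by (simp add: pos_le_divide_eq mult_ac)
      qed
      then have "\<bar>x\<bar> ^ m * norm (iter_deriv n (\<lambda>x. (1 - plateau (x / R)) * \<psi> x) x) \<le>
          \<bar>x\<bar> ^ m * (2 ^ n * (B' * (P / \<bar>x\<bar> ^ Suc m)))"
        by (rule mult_left_mono) simp
      also have "\<dots> = 2 ^ n * B' * P / \<bar>x\<bar>" using False R by simp
      also have "\<dots> \<le> 2 ^ n * B' * P / R"
        using False R B'0 P0 unfolding P_def
        by (intro divide_left_mono mult_nonneg_nonneg sum_nonneg mult_pos_pos) auto
      finally show ?thesis .
    qed
  qed
  then show ?thesis by blast
qed

lemma schwartz_mult_plateau:
  assumes "\<psi> \<in> schwartz" "R > 0"
  shows "(\<lambda>x. plateau (x / R) * \<psi> x) \<in> test_functions"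
  using test_function_mult(1)[OF plateau_scaled_test_function[OF assms(2), of 0], of \<psi>] assms
  by (simp add: schwartz_def)

lemma test_function_schwartz:
  assumes "\<phi> \<in> test_functions"
  shows "\<phi> \<in> schwartz"
proof -
  have "bdd_above (range (\<lambda>x. \<bar>x\<bar> ^ m * norm (iter_deriv n \<phi> x)))" for m n
  proof -
    have "(\<lambda>x. of_real x ^ m * iter_deriv n \<phi> x) \<in> test_functions"
    proof (intro test_function_mult(2) iter_deriv_test_function assms)
      show "smooth (\<lambda>x. of_real x ^ m)" by (induction m) (auto intro: smooth_mult)
    qed
    from test_function_bounded[OF this]
    obtain B where "\<And>x. norm (of_real x ^ m * iter_deriv n \<phi> x) \<le> B" by blast
    then show ?thesis by (auto simp: bdd_above_def norm_mult norm_power)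
  qed
  then show ?thesis using assms by (simp add: schwartz_def test_function_smooth)
qed

text \<open>A tempered distribution is therefore determined by its values on test functions. This is needed to
  evaluate it at Fourier transforms, which never have compact support except for the zero function.\<close>

lemma tempered_distribution_cutoff_limit:
  assumes T: "tempered_distribution T" and \<psi>: "\<psi> \<in> schwartz"
  shows "(\<lambda>n. T (\<lambda>x. plateau (x / real (Suc n)) * \<psi> x)) \<longlonglongrightarrow> T \<psi>"
proof -
  obtain C N where CN: "\<And>\<phi>. \<phi> \<in> schwartz \<Longrightarrow> norm (T \<phi>) \<le> C * (\<Sum>m\<le>N. \<Sum>n\<le>N. schwartz_seminorm m n \<phi>)"
    using T unfolding tempered_distribution_def by blast
  obtain K where K: "\<And>m n R x. R \<ge> 1 \<Longrightarrow> \<bar>x\<bar> ^ m * norm (iter_deriv n (\<lambda>x. (1 - plateau (x / R)) * \<psi> x) x) \<le> K m n / R"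
    using schwartz_cutoff[OF \<psi>] by metis
  define r where "r k = (\<lambda>x. (1 - plateau (x / real (Suc k))) * \<psi> x)" for k
  define p where "p k = (\<lambda>x. plateau (x / real (Suc k)) * \<psi> x)" for k
  have ps: "p k \<in> schwartz" for k
    unfolding p_def by (intro test_function_schwartz schwartz_mult_plateau \<psi>) simp
  have rs: "r k \<in> schwartz" for k
  proof -
    have "smooth (\<lambda>x. 1 - plateau ((x - 0) / real (Suc k)))"
      by (intro smooth_diff smooth_const test_function_smooth plateau_scaled_test_function) simp
    then have "smooth (r k)"
      using \<psi> unfolding r_def by (intro smooth_mult) (auto simp: schwartz_def)
    moreover have "bdd_above (range (\<lambda>x. \<bar>x\<bar> ^ m * norm (iter_deriv n (r k) x)))" for m n
      unfolding bdd_above_def r_def using K[of "real (Suc k)" _ m n] by auto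
    ultimately show ?thesis by (simp add: schwartz_def)
  qed
  have sr: "schwartz_seminorm m n (r k) \<le> K m n / real (Suc k)" for m n k
    unfolding schwartz_seminorm_def r_def by (rule cSUP_least) (use K in auto)
  have T\<psi>: "T \<psi> = T (p k) + T (r k)" for k
  proof -
    have "\<psi> = (\<lambda>x. p k x + r k x)" by (simp add: p_def r_def algebra_simps)
    then show ?thesis
      using T ps[of k] rs[of k] unfolding tempered_distribution_def by metis
  qed
  have "(\<lambda>k. T (r k)) \<longlonglongrightarrow> 0"
  proof (rule Lim_null_comparison)
    show "\<forall>\<^sub>F k in sequentially. norm (T (r k)) \<le> (\<bar>C\<bar> * (\<Sum>m\<le>N. \<Sum>n\<le>N. K m n)) * (1 / real (Suc k))"
    proof (intro always_eventually allI)
      fix k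
      have s0: "schwartz_seminorm m n (r k) \<ge> 0" for m n
        using schwartz_bound[OF rs, of 0 m n k] by (meson norm_ge_zero order_trans zero_le_mult_iff zero_le_power_abs)
      have "norm (T (r k)) \<le> C * (\<Sum>m\<le>N. \<Sum>n\<le>N. schwartz_seminorm m n (r k))"
        by (rule CN[OF rs])
      also have "\<dots> \<le> \<bar>C\<bar> * (\<Sum>m\<le>N. \<Sum>n\<le>N. schwartz_seminorm m n (r k))"
        by (intro mult_right_mono sum_nonneg s0) simp
      also have "\<dots> \<le> \<bar>C\<bar> * (\<Sum>m\<le>N. \<Sum>n\<le>N. K m n / real (Suc k))"
        by (intro mult_left_mono sum_mono sr) simp
      also have "\<dots> = (\<bar>C\<bar> * (\<Sum>m\<le>N. \<Sum>n\<le>N. K m n)) * (1 / real (Suc k))"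
        by (simp only: sum_divide_distrib[symmetric] times_divide_eq_right mult_1_right)
      finally show "norm (T (r k)) \<le> \<dots>" .
    qed
    show "(\<lambda>k. (\<bar>C\<bar> * (\<Sum>m\<le>N. \<Sum>n\<le>N. K m n)) * (1 / real (Suc k))) \<longlonglongrightarrow> 0"
      using LIMSEQ_inverse_real_of_nat by (intro tendsto_mult_right_zero) (simp add: inverse_eq_divide)
  qed
  then have "(\<lambda>k. T \<psi> - T (r k)) \<longlonglongrightarrow> T \<psi> - 0" by (intro tendsto_intros)
  moreover have "T \<psi> - T (r k) = T (p k)" for k using T\<psi>[of k] by simp
  ultimately show ?thesis unfolding p_def by simp
qed

section \<open>Separated sets and shift series\<close>

text \<open>Separation with an explicit constant, which can be shared by all translates and limits of a set.\<close>

definition sep :: "real \<Rightarrow> real set \<Rightarrow> bool" where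
  "sep d A \<longleftrightarrow> (\<forall>x\<in>A. \<forall>y\<in>A. x \<noteq> y \<longrightarrow> d \<le> \<bar>x - y\<bar>)"

lemma sepD: "sep d A \<Longrightarrow> x \<in> A \<Longrightarrow> y \<in> A \<Longrightarrow> \<bar>x - y\<bar> < d \<Longrightarrow> x = y"
  by (force simp: sep_def)

lemma separation_ge_iff: "ereal d \<le> separation A \<longleftrightarrow> sep d A"
  unfolding separation_def sep_def by (auto simp: le_INF_iff)

text \<open>The constant may be taken at most 1, which keeps displacements inside the reach of the majorants of
  \<open>amalgam_envelope\<close>.\<close>

lemma separated_set_iff: "separated_set A \<longleftrightarrow> (\<exists>d>0. d \<le> 1 \<and> sep d A)"
proof
  assume "separated_set A"
  then obtain d where "0 < ereal d" "ereal d < separation A"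
    unfolding separated_set_def using ereal_dense2 by blast
  then have "sep d A" "d > 0" by (auto simp: separation_ge_iff[symmetric] less_imp_le)
  then have "sep (min d 1) A" "min d 1 > 0" "min d 1 \<le> 1" unfolding sep_def by fastforce+
  then show "\<exists>d>0. d \<le> 1 \<and> sep d A" by blast
next
  assume "\<exists>d>0. d \<le> 1 \<and> sep d A"
  then obtain d where "d > 0" "ereal d \<le> separation A" by (auto simp: separation_ge_iff)
  then show "separated_set A"
    unfolding separated_set_def by (metis ereal_less(2) order_less_le_trans)
qed

lemma sep_translate: "sep d ((\<lambda>\<gamma>. \<gamma> - x) ` A) \<longleftrightarrow> sep d A"
  by (auto simp: sep_def)

lemma sep_subset: "sep d A \<Longrightarrow> B \<subseteq> A \<Longrightarrow> sep d B"
  by (auto simp: sep_def)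

lemma sep_inj_floor:
  assumes "sep d A" "d > 0"
  shows "inj_on (\<lambda>\<gamma>. \<lfloor>(\<gamma> - a) / d\<rfloor>) A"
proof (rule inj_onI)
  fix x y assume xy: "x \<in> A" "y \<in> A" "\<lfloor>(x - a) / d\<rfloor> = \<lfloor>(y - a) / d\<rfloor>"
  then have "\<bar>(x - a) / d - (y - a) / d\<bar> < 1" by linarith
  then have "\<bar>x - y\<bar> < d"
    using assms(2) by (simp add: diff_divide_distrib[symmetric] abs_divide)
  with xy assms(1) show "x = y" by (blast intro: sepD)
qed

lemma sep_countable: "sep d A \<Longrightarrow> d > 0 \<Longrightarrow> countable A"
  using countable_image_inj_on[OF _ sep_inj_floor[of d A 0]] by auto

text \<open>At most \<open>1/d + 1\<close> points of the set lie in a unit interval, whatever its position; hence a bound that is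
  uniform in \<open>x\<close> and in the set.\<close>

lemma sep_sum_le:
  fixes b :: "int \<Rightarrow> real"
  assumes A: "sep d A" "d > 0" and b: "b summable_on UNIV" "\<And>k. b k \<ge> 0"
  shows "(\<lambda>\<gamma>. b \<lfloor>x - \<gamma>\<rfloor>) summable_on A"
    and "infsum (\<lambda>\<gamma>. b \<lfloor>x - \<gamma>\<rfloor>) A \<le> real (nat (\<lfloor>1 / d\<rfloor> + 1)) * infsum b UNIV"
proof -
  let ?N = "nat (\<lfloor>1 / d\<rfloor> + 1)"
  have card: "card {\<gamma> \<in> F. \<lfloor>x - \<gamma>\<rfloor> = k} \<le> ?N" if "finite F" "F \<subseteq> A" for F k
  proof -
    let ?Fk = "{\<gamma> \<in> F. \<lfloor>x - \<gamma>\<rfloor> = k}"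
    have "inj_on (\<lambda>\<gamma>. \<lfloor>(\<gamma> - (x - of_int k - 1)) / d\<rfloor>) ?Fk"
      by (rule sep_inj_floor[OF sep_subset[OF A(1)] A(2)]) (use that in auto)
    moreover have "(\<lambda>\<gamma>. \<lfloor>(\<gamma> - (x - of_int k - 1)) / d\<rfloor>) ` ?Fk \<subseteq> {0..\<lfloor>1 / d\<rfloor>}"
    proof clarsimp
      fix \<gamma> assume "\<gamma> \<in> F" "k = \<lfloor>x - \<gamma>\<rfloor>"
      then have "0 \<le> \<gamma> - (x - of_int \<lfloor>x - \<gamma>\<rfloor> - 1)" "\<gamma> - (x - of_int \<lfloor>x - \<gamma>\<rfloor> - 1) \<le> 1" by linarith+
      then show "0 \<le> (\<gamma> - (x - of_int \<lfloor>x - \<gamma>\<rfloor> - 1)) / d \<and>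
          \<lfloor>(\<gamma> - (x - of_int \<lfloor>x - \<gamma>\<rfloor> - 1)) / d\<rfloor> \<le> \<lfloor>1 / d\<rfloor>"
        using A(2) by (auto intro!: floor_mono divide_right_mono)
    qed
    ultimately have "card ?Fk \<le> card {0..\<lfloor>1 / d\<rfloor>}" by (intro card_inj_on_le) auto
    then show ?thesis by simp
  qed
  have fin: "(\<Sum>\<gamma>\<in>F. b \<lfloor>x - \<gamma>\<rfloor>) \<le> real ?N * infsum b UNIV" if F: "finite F" "F \<subseteq> A" for F
  proof -
    let ?I = "(\<lambda>\<gamma>. \<lfloor>x - \<gamma>\<rfloor>) ` F"
    have "(\<Sum>\<gamma>\<in>F. b \<lfloor>x - \<gamma>\<rfloor>) = (\<Sum>k\<in>?I. \<Sum>\<gamma>\<in>{\<gamma>\<in>F. \<lfloor>x - \<gamma>\<rfloor> = k}. b \<lfloor>x - \<gamma>\<rfloor>)"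
      by (rule sum.image_gen[OF F(1)])
    also have "\<dots> \<le> (\<Sum>k\<in>?I. real ?N * b k)"
    proof (rule sum_mono)
      fix k
      have "(\<Sum>\<gamma>\<in>{\<gamma>\<in>F. \<lfloor>x - \<gamma>\<rfloor> = k}. b \<lfloor>x - \<gamma>\<rfloor>) = real (card {\<gamma>\<in>F. \<lfloor>x - \<gamma>\<rfloor> = k}) * b k"
        by simp
      also have "\<dots> \<le> real ?N * b k" using card[OF F, of k] b(2) by (intro mult_right_mono) auto
      finally show "(\<Sum>\<gamma>\<in>{\<gamma>\<in>F. \<lfloor>x - \<gamma>\<rfloor> = k}. b \<lfloor>x - \<gamma>\<rfloor>) \<le> real ?N * b k" .
    qed
    also have "\<dots> = real ?N * (\<Sum>k\<in>?I. b k)" by (simp add: sum_distrib_left)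
    also have "\<dots> \<le> real ?N * infsum b UNIV"
      using F b by (intro mult_left_mono finite_sum_le_infsum) auto
    finally show ?thesis .
  qed
  show s: "(\<lambda>\<gamma>. b \<lfloor>x - \<gamma>\<rfloor>) summable_on A"
    by (rule nonneg_bdd_above_summable_on) (use b fin in \<open>auto simp: bdd_above_def\<close>)
  show "infsum (\<lambda>\<gamma>. b \<lfloor>x - \<gamma>\<rfloor>) A \<le> real ?N * infsum b UNIV"
    by (rule infsum_le_finite_sums[OF s]) (use fin in auto)
qed

text \<open>The majorant \<open>E\<close> controls \<open>g\<close> also at all points at distance at most 1. It dominates the series
  when \<open>x\<close> or the points of the set move a little, and so gives continuity of the series and limits
  along weakly convergent sets.\<close>

lemma amalgam_envelope:
  assumes "amalgam g"
  obtains E :: "real \<Rightarrow> real" where "\<And>t. E t \<ge> 0" "\<And>s t. \<bar>s - t\<bar> \<le> 1 \<Longrightarrow> norm (g s) \<le> E t"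
    "\<And>d A x. sep d A \<Longrightarrow> d > 0 \<Longrightarrow> (\<lambda>\<gamma>. E (x - \<gamma>)) summable_on A"
    "\<And>d. d > 0 \<Longrightarrow> \<exists>K\<ge>0. \<forall>A x. sep d A \<longrightarrow> infsum (\<lambda>\<gamma>. E (x - \<gamma>)) A \<le> K"
proof -
  obtain b :: "int \<Rightarrow> real" where b: "b summable_on UNIV" "\<And>k. b k \<ge> 0" "\<And>t. norm (g t) \<le> b \<lfloor>t\<rfloor>"
    using amalgamE[OF assms] by blast
  define b' where "b' k = b (k - 1) + b k + b (k + 1)" for k
  have "bij (\<lambda>k::int. k + c)" for c
    by (rule bijI) (auto simp: inj_def surj_def intro: exI[of _ "_ - c"])
  from this[of "-1"] this[of 1] have "(\<lambda>k. b (k - 1)) summable_on UNIV" "(\<lambda>k. b (k + 1)) summable_on UNIV"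
    using summable_on_reindex_bij_betw[of _ UNIV UNIV b] b(1) by auto
  then have b': "b' summable_on UNIV" unfolding b'_def[abs_def] by (intro summable_on_add b(1))
  have b'0: "b' k \<ge> 0" for k using b(2) by (simp add: b'_def)
  show ?thesis
  proof (rule that[of "\<lambda>t. b' \<lfloor>t\<rfloor>"])
    fix s t :: real assume "\<bar>s - t\<bar> \<le> 1"
    then have "\<lfloor>s\<rfloor> = \<lfloor>t\<rfloor> - 1 \<or> \<lfloor>s\<rfloor> = \<lfloor>t\<rfloor> \<or> \<lfloor>s\<rfloor> = \<lfloor>t\<rfloor> + 1" by linarith
    moreover have "b \<lfloor>s\<rfloor> \<ge> 0" "b (\<lfloor>t\<rfloor> - 1) \<ge> 0" "b \<lfloor>t\<rfloor> \<ge> 0" "b (\<lfloor>t\<rfloor> + 1) \<ge> 0" by (rule b(2))+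
    ultimately have "b \<lfloor>s\<rfloor> \<le> b' \<lfloor>t\<rfloor>" unfolding b'_def by auto
    with b(3)[of s] show "norm (g s) \<le> b' \<lfloor>t\<rfloor>" by linarith
  next
    fix d :: real assume d: "d > 0"
    have "infsum b' UNIV \<ge> 0" by (intro infsum_nonneg b'0)
    then show "\<exists>K\<ge>0. \<forall>A x. sep d A \<longrightarrow> infsum (\<lambda>\<gamma>. b' \<lfloor>x - \<gamma>\<rfloor>) A \<le> K"
      using sep_sum_le(2)[OF _ d b' b'0]
      by (intro exI[of _ "real (nat (\<lfloor>1 / d\<rfloor> + 1)) * infsum b' UNIV"]) auto
  qed (use sep_sum_le(1)[OF _ _ b' b'0] b'0 in auto)
qed

lemma shift_summable:
  assumes "amalgam g" "sep d A" "d > 0" "\<And>\<gamma>. \<gamma> \<in> A \<Longrightarrow> norm (c \<gamma>) \<le> M"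
  shows "(\<lambda>\<gamma>. norm (c \<gamma> * g (x - \<gamma>))) summable_on A"
proof (cases "A = {}")
  case False
  then have M: "M \<ge> 0" using assms(4) norm_ge_zero order_trans by blast
  obtain E :: "real \<Rightarrow> real" where E: "\<And>t. E t \<ge> 0" "\<And>s t. \<bar>s - t\<bar> \<le> 1 \<Longrightarrow> norm (g s) \<le> E t"
    "(\<lambda>\<gamma>. E (x - \<gamma>)) summable_on A"
    using amalgam_envelope[OF assms(1)] assms(2,3) by metis
  show ?thesis
    by (rule norm_infsum_le(2)[OF summable_on_cmult_right[OF E(3), of M]])
       (use E(2) assms(4) M in \<open>auto simp: norm_mult intro!: mult_mono\<close>)
qed simp

text \<open>The constant depends only on \<open>g\<close> and on the separation. This is the upper stability bound.\<close>

lemma shift_bound: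
  assumes "amalgam g" "d > 0"
  obtains K where "K > 0"
    "\<And>A (c :: real \<Rightarrow> complex) M x. sep d A \<Longrightarrow> M \<ge> 0 \<Longrightarrow> (\<And>\<gamma>. \<gamma> \<in> A \<Longrightarrow> norm (c \<gamma>) \<le> M) \<Longrightarrow>
       infsum (\<lambda>\<gamma>. norm (c \<gamma> * g (x - \<gamma>))) A \<le> M * K"
    "\<And>A (c :: real \<Rightarrow> complex) M x. sep d A \<Longrightarrow> M \<ge> 0 \<Longrightarrow> (\<And>\<gamma>. \<gamma> \<in> A \<Longrightarrow> norm (c \<gamma>) \<le> M) \<Longrightarrow>
       norm (shift_series g A c x) \<le> M * K"
proof -
  obtain E :: "real \<Rightarrow> real" where E: "\<And>t. E t \<ge> 0" "\<And>s t. \<bar>s - t\<bar> \<le> 1 \<Longrightarrow> norm (g s) \<le> E t"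
    "\<And>A x. sep d A \<Longrightarrow> (\<lambda>\<gamma>. E (x - \<gamma>)) summable_on A"
    "\<exists>K\<ge>0. \<forall>A x. sep d A \<longrightarrow> infsum (\<lambda>\<gamma>. E (x - \<gamma>)) A \<le> K"
    using amalgam_envelope[OF assms(1)] assms(2) by metis
  then obtain K where K: "K \<ge> 0" "\<And>A x. sep d A \<Longrightarrow> infsum (\<lambda>\<gamma>. E (x - \<gamma>)) A \<le> K" by blast
  have le: "infsum (\<lambda>\<gamma>. norm (c \<gamma> * g (x - \<gamma>))) A \<le> M * (K + 1)"
    if "sep d A" "M \<ge> 0" "\<And>\<gamma>. \<gamma> \<in> A \<Longrightarrow> norm (c \<gamma>) \<le> M" for A M x and c :: "real \<Rightarrow> complex"
  proof -
    have "infsum (\<lambda>\<gamma>. norm (c \<gamma> * g (x - \<gamma>))) A \<le> infsum (\<lambda>\<gamma>. M * E (x - \<gamma>)) A"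
      by (intro infsum_mono shift_summable[OF assms(1) that(1) assms(2) that(3)] summable_on_cmult_right E(3) that(1))
         (use E(2) that in \<open>auto simp: norm_mult intro!: mult_mono\<close>)
    also have "\<dots> = M * infsum (\<lambda>\<gamma>. E (x - \<gamma>)) A" by (rule infsum_cmult_right')
    also have "\<dots> \<le> M * (K + 1)" using K(2)[OF that(1), of x] that(2) by (intro mult_left_mono) auto
    finally show ?thesis .
  qed
  show ?thesis
  proof (rule that[of "K + 1"])
    fix A M x and c :: "real \<Rightarrow> complex" assume a: "sep d A" "M \<ge> 0" "\<And>\<gamma>. \<gamma> \<in> A \<Longrightarrow> norm (c \<gamma>) \<le> M"
    show "norm (shift_series g A c x) \<le> M * (K + 1)"
      unfolding shift_series_def
      using norm_infsum_bound[OF shift_summable[OF assms(1) a(1) assms(2) a(3)]] le[OF a] by (rule order_trans)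
  qed (use K(1) le in auto)
qed

lemma shift_series_continuous:
  assumes g: "amalgam g" "continuous_on UNIV g" and A: "sep d A" "d > 0"
    and c: "\<And>\<gamma>. \<gamma> \<in> A \<Longrightarrow> norm (c \<gamma>) \<le> M"
  shows "continuous_on UNIV (shift_series g A c)"
proof (cases "A = {}")
  case True
  then show ?thesis by (simp add: shift_series_def[abs_def])
next
  case False
  then have M: "M \<ge> 0" using c norm_ge_zero order_trans by blast
  obtain E :: "real \<Rightarrow> real" where E: "\<And>t. E t \<ge> 0" "\<And>s t. \<bar>s - t\<bar> \<le> 1 \<Longrightarrow> norm (g s) \<le> E t"
    "\<And>x. (\<lambda>\<gamma>. E (x - \<gamma>)) summable_on A"
    using amalgam_envelope[OF g(1)] A by metis
  show ?thesis
  proof (rule continuous_at_imp_continuous_on, rule ballI)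
    fix x :: real
    have "shift_series g A c \<midarrow>x\<rightarrow> shift_series g A c x"
      unfolding tendsto_at_iff_sequentially o_def
    proof (intro allI impI)
      fix X assume X: "\<forall>i. X i \<in> UNIV - {x}" "X \<longlonglongrightarrow> x"
      obtain N where N: "\<And>n. n \<ge> N \<Longrightarrow> \<bar>X n - x\<bar> < 1"
        using X(2)[unfolded LIMSEQ_def, rule_format, of 1] by (auto simp: dist_real_def)
      have "(\<lambda>n. shift_series g A c (X (n + N))) \<longlonglongrightarrow> shift_series g A c x"
        unfolding shift_series_def
      proof (rule infsum_dominated_convergence[OF summable_on_cmult_right[OF E(3)]])
        fix n \<gamma> assume "\<gamma> \<in> A"
        then show "norm (c \<gamma> * g (X (n + N) - \<gamma>)) \<le> M * E (x - \<gamma>)"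
          using c M N[of "n + N"] unfolding norm_mult by (intro mult_mono E(2)) auto
      next
        fix \<gamma> assume "\<gamma> \<in> A"
        have "(\<lambda>n. X (n + N) - \<gamma>) \<longlonglongrightarrow> x - \<gamma>"
          by (intro tendsto_intros LIMSEQ_ignore_initial_segment X)
        then have "(\<lambda>n. g (X (n + N) - \<gamma>)) \<longlonglongrightarrow> g (x - \<gamma>)"
          using g(2) by (intro isCont_tendsto_compose[of _ g]) (simp_all add: continuous_on_eq_continuous_at)
        then show "(\<lambda>n. c \<gamma> * g (X (n + N) - \<gamma>)) \<longlonglongrightarrow> c \<gamma> * g (x - \<gamma>)"
          by (rule tendsto_mult_left)
      qed
      then show "(\<lambda>n. shift_series g A c (X n)) \<longlonglongrightarrow> shift_series g A c x"
        by (rule LIMSEQ_offset)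
    qed
    then show "isCont (shift_series g A c) x" by (simp add: continuous_at)
  qed
qed

text \<open>A nonempty open set is not a null set, so essential bounds of a continuous function are bounds.\<close>

lemma AE_norm_le_closure:
  assumes f: "continuous_on UNIV f" and A: "open A"
    and AE: "AE x in lebesgue. x \<in> A \<longrightarrow> norm (f x) \<le> r" and x: "x \<in> closure A"
  shows "norm (f (x :: real)) \<le> r"
proof -
  have cl: "closed {x. norm (f x) \<le> r}"
    by (intro closed_Collect_le continuous_intros f)
  have "A \<subseteq> {x. norm (f x) \<le> r}"
    using mem_closed_if_AE_lebesgue_open[OF A cl] AE by auto
  with x cl show ?thesis using closure_minimal by blast
qed

lemma continuous_lebesgue_measurable:
  fixes f :: "real \<Rightarrow> complex"
  assumes "continuous_on UNIV f"
  shows "(\<lambda>x. ennreal (norm (f x))) \<in> borel_measurable lebesgue"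
proof -
  have [measurable]: "f \<in> borel_measurable borel"
    using assms by (rule borel_measurable_continuous_onI)
  have "(\<lambda>x. ennreal (norm (f x))) \<in> borel_measurable lborel" by measurable
  then show ?thesis by (rule measurable_completion)
qed

lemma Linf_norm_UNIV_le_iff:
  assumes f: "continuous_on UNIV f" and r: "r \<ge> 0"
  shows "Linf_norm UNIV f \<le> ennreal r \<longleftrightarrow> (\<forall>x. norm (f x) \<le> r)"
proof
  assume le: "Linf_norm UNIV f \<le> ennreal r"
  have "AE x in lebesgue. ennreal (norm (f x)) \<le> Linf_norm UNIV f"
    unfolding Linf_norm_def using esssup_AE[of "\<lambda>x. ennreal (norm (f x))" "restrict_space lebesgue UNIV"]
    by (subst (asm) AE_restrict_space_iff) auto
  then have "AE x in lebesgue. x \<in> UNIV \<longrightarrow> norm (f x) \<le> r"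
  proof eventually_elim
    case (elim x)
    from order_trans[OF elim le] show ?case using r by (simp add: ennreal_le_iff)
  qed
  from AE_norm_le_closure[OF f open_UNIV this] show "\<forall>x. norm (f x) \<le> r" by simp
next
  assume "\<forall>x. norm (f x) \<le> r"
  then show "Linf_norm UNIV f \<le> ennreal r"
    unfolding Linf_norm_def using continuous_lebesgue_measurable[OF f]
    by (intro esssup_I) (auto intro: measurable_restrict_space1 ennreal_leI)
qed

lemma wiener_amalgam:
  assumes G: "G \<in> wiener" "continuous_on UNIV G"
  shows "amalgam G"
proof -
  define L where "L k = Linf_norm {of_int k<..<of_int k + 1} G" for k :: int
  have s: "L summable_on UNIV" by (rule nonneg_summable_on_complete) simp
  have fin: "infsum L UNIV < \<infinity>"
    using G(1) unfolding wiener_def wiener_norm_def L_def[abs_def] by blast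
  have Lk: "L k < \<infinity>" for k
  proof -
    have "L k = infsum L {k}" by simp
    also have "\<dots> \<le> infsum L UNIV" by (intro infsum_mono_neutral s) auto
    finally show ?thesis using fin by (rule order_le_less_trans)
  qed
  have en: "ennreal (enn2real (L k)) = L k" for k
    using Lk[of k] by simp
  have "(\<lambda>k. enn2real (L k)) summable_on UNIV"
  proof (rule nonneg_bdd_above_summable_on)
    have "(\<Sum>k\<in>F. enn2real (L k)) \<le> enn2real (infsum L UNIV)" if "finite F" for F
    proof -
      have "ennreal (\<Sum>k\<in>F. enn2real (L k)) = sum L F"
        by (subst sum_ennreal[symmetric]) (simp_all only: en enn2real_nonneg)
      also have "\<dots> = infsum L F" using that by simp
      also have "\<dots> \<le> infsum L UNIV" by (rule infsum_mono_neutral) (use s that in auto)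
      finally show ?thesis using fin
        by (metis enn2real_nonneg ennreal_enn2real ennreal_le_iff infinity_ennreal_def)
    qed
    then show "bdd_above (sum (\<lambda>k. enn2real (L k)) ` {F. F \<subseteq> UNIV \<and> finite F})"
      by (auto simp: bdd_above_def)
  qed simp
  moreover have "norm (G t) \<le> enn2real (L \<lfloor>t\<rfloor>)" for t
  proof (rule AE_norm_le_closure[OF G(2)])
    let ?A = "{of_int \<lfloor>t\<rfloor><..<of_int \<lfloor>t\<rfloor> + 1} :: real set"
    show "open ?A" by simp
    have "AE x in restrict_space lebesgue ?A. ennreal (norm (G x)) \<le> L \<lfloor>t\<rfloor>"
      unfolding L_def Linf_norm_def by (rule esssup_AE)
    then have "AE x in lebesgue. x \<in> ?A \<longrightarrow> ennreal (norm (G x)) \<le> L \<lfloor>t\<rfloor>"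
      by (subst (asm) AE_restrict_space_iff) auto
    then show "AE x in lebesgue. x \<in> ?A \<longrightarrow> norm (G x) \<le> enn2real (L \<lfloor>t\<rfloor>)"
    proof eventually_elim
      case (elim x)
      then show ?case
        using enn2real_mono[of "ennreal (norm (G x))" "L \<lfloor>t\<rfloor>"] Lk[of "\<lfloor>t\<rfloor>"] by auto
    qed
    show "t \<in> closure ?A" by (subst closure_greaterThanLessThan) auto
  qed
  ultimately show ?thesis unfolding amalgam_def by blast
qed

section \<open>Stability as a pointwise estimate\<close>

lemma linf_seqs_bound:
  assumes "c \<in> linf_seqs A"
  obtains M where "M > 0" "\<And>\<gamma>. \<gamma> \<in> A \<Longrightarrow> norm (c \<gamma>) \<le> M"
  using assms by (auto simp: linf_seqs_def bounded_pos)

lemma c0_subset_linf: "c0_seqs A \<subseteq> linf_seqs A"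
proof
  fix c assume "c \<in> c0_seqs A"
  then have fin: "finite {\<gamma> \<in> A. norm (c \<gamma>) \<ge> 1}" by (auto simp: c0_seqs_def)
  then have "bounded (c ` {\<gamma> \<in> A. norm (c \<gamma>) \<ge> 1} \<union> ball 0 1)" by (simp add: finite_imp_bounded)
  moreover have "c ` A \<subseteq> c ` {\<gamma> \<in> A. norm (c \<gamma>) \<ge> 1} \<union> ball 0 1" by (force simp: not_le)
  ultimately show "c \<in> linf_seqs A" unfolding linf_seqs_def using bounded_subset by blast
qed

lemma c00_subset_c0: "c00_seqs A \<subseteq> c0_seqs A"
  unfolding c00_seqs_def c0_seqs_def
  by (auto elim!: rev_finite_subset)

text \<open>The upper bound is automatic, and essential bounds of a continuous function are pointwise bounds, so
  that stability reduces to an estimate between real numbers.\<close>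

lemma stable_shifts_iff:
  assumes g: "amalgam g" "continuous_on UNIV g" and A: "sep d A" "d > 0"
    and X: "X \<subseteq> linf_seqs A"
  shows "stable_shifts X A g \<longleftrightarrow>
    (\<exists>C>0. \<forall>c\<in>X. \<forall>\<gamma>\<in>A. \<forall>r\<ge>0. (\<forall>x. norm (shift_series g A c x) \<le> r) \<longrightarrow> C * norm (c \<gamma>) \<le> r)"
    (is "_ \<longleftrightarrow> ?R")
proof
  assume "stable_shifts X A g"
  then obtain C where C: "C > 0" "\<And>c. c \<in> X \<Longrightarrow> ennreal C * sup_norm A c \<le> Linf_norm UNIV (shift_series g A c)"
    unfolding stable_shifts_def by blast
  have "C * norm (c \<gamma>) \<le> r" if c: "c \<in> X" "\<gamma> \<in> A" "r \<ge> 0" "\<forall>x. norm (shift_series g A c x) \<le> r" for c \<gamma> r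
  proof -
    obtain M where M: "\<And>\<gamma>. \<gamma> \<in> A \<Longrightarrow> norm (c \<gamma>) \<le> M" using linf_seqs_bound c(1) X by blast
    have "ennreal (C * norm (c \<gamma>)) = ennreal C * ennreal (norm (c \<gamma>))"
      using C(1) by (simp add: ennreal_mult)
    also have "\<dots> \<le> ennreal C * sup_norm A c"
      unfolding sup_norm_def by (intro mult_left_mono SUP_upper c) simp
    also have "\<dots> \<le> Linf_norm UNIV (shift_series g A c)" by (rule C(2)[OF c(1)])
    also have "\<dots> \<le> ennreal r"
      using c(4) Linf_norm_UNIV_le_iff[OF shift_series_continuous[OF g A, of c M] c(3)] M by blast
    finally show ?thesis using c(3) by (simp add: ennreal_le_iff)
  qed
  with C(1) show ?R by blast
next
  assume ?R
  then obtain C where C: "C > 0" "\<And>c \<gamma> r. c \<in> X \<Longrightarrow> \<gamma> \<in> A \<Longrightarrow> r \<ge> 0 \<Longrightarrow>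
      (\<forall>x. norm (shift_series g A c x) \<le> r) \<Longrightarrow> C * norm (c \<gamma>) \<le> r" by blast
  obtain K where K: "K > 0" "\<And>c M x. M \<ge> 0 \<Longrightarrow> (\<And>\<gamma>. \<gamma> \<in> A \<Longrightarrow> norm (c \<gamma>) \<le> M) \<Longrightarrow>
       norm (shift_series g A c x) \<le> M * K"
    using shift_bound[OF g(1) A(2)] A(1) by metis
  show "stable_shifts X A g"
    unfolding stable_shifts_def
  proof (intro exI conjI ballI)
    fix c assume c: "c \<in> X"
    obtain M where M: "M > 0" "\<And>\<gamma>. \<gamma> \<in> A \<Longrightarrow> norm (c \<gamma>) \<le> M" using linf_seqs_bound c X by blast
    note le_iff = Linf_norm_UNIV_le_iff[OF shift_series_continuous[OF g A M(2)]]
    let ?s = "sup_norm A c"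
    have "?s \<le> ennreal M" unfolding sup_norm_def using M by (intro SUP_least ennreal_leI) auto
    then have s: "?s = ennreal (enn2real ?s)"
      by (metis ennreal_enn2real ennreal_less_top order_le_less_trans)
    have cs: "norm (c \<gamma>) \<le> enn2real ?s" if "\<gamma> \<in> A" for \<gamma>
    proof -
      have "ennreal (norm (c \<gamma>)) \<le> ?s" unfolding sup_norm_def using that by (rule SUP_upper)
      then show ?thesis by (subst (asm) s) (simp add: ennreal_le_iff)
    qed
    have "Linf_norm UNIV (shift_series g A c) \<le> ennreal (enn2real ?s * K)"
      using K(2)[OF _ cs] K(1) by (subst le_iff) auto
    also have "\<dots> = ennreal K * ?s" using K(1) by (subst (2) s) (simp add: ennreal_mult mult.commute)
    finally show up: "Linf_norm UNIV (shift_series g A c) \<le> ennreal K * ?s" .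
    let ?r = "enn2real (Linf_norm UNIV (shift_series g A c))"
    have "Linf_norm UNIV (shift_series g A c) < \<infinity>"
      using \<open>_ \<le> ennreal (enn2real ?s * K)\<close> by (rule order_le_less_trans) simp
    then have r: "Linf_norm UNIV (shift_series g A c) = ennreal ?r" by simp
    then have "\<forall>x. norm (shift_series g A c x) \<le> ?r" by (subst le_iff[symmetric]) auto
    then have "C * norm (c \<gamma>) \<le> ?r" if "\<gamma> \<in> A" for \<gamma> using C(2)[OF c that] by simp
    then have "ennreal C * ennreal (norm (c \<gamma>)) \<le> ennreal ?r" if "\<gamma> \<in> A" for \<gamma>
      using that C(1) by (simp add: ennreal_mult[symmetric] ennreal_leI)
    then show "ennreal C * ?s \<le> Linf_norm UNIV (shift_series g A c)"
      unfolding sup_norm_def SUP_mult_left_ennreal by (subst r) (rule SUP_least)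
  qed (use C K in auto)
qed

section \<open>From instability to a dependent weak limit\<close>

lemma diagonal_convergent_subsequence:
  fixes z :: "nat \<Rightarrow> 'i :: countable \<Rightarrow> 'a :: heine_borel"
  assumes "\<And>j. bounded (range (\<lambda>n. z n j))"
  obtains r where "strict_mono r" "\<And>j. convergent (\<lambda>n. z (r n) j)"
proof -
  let ?P = "\<lambda>n s. convergent (\<lambda>k. z (s k) (from_nat n))"
  interpret subseqs ?P
  proof
    fix n and s :: "nat \<Rightarrow> nat"
    have "bounded (range (\<lambda>k. z (s k) (from_nat n)))"
      by (rule bounded_subset[OF assms[of "from_nat n"]]) auto
    then obtain l r where "strict_mono r" "((\<lambda>k. z (s k) (from_nat n)) \<circ> r) \<longlonglongrightarrow> l"
      using bounded_imp_convergent_subsequence by blast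
    then show "\<exists>r'. strict_mono r' \<and> convergent (\<lambda>k. z ((s \<circ> r') k) (from_nat n))"
      by (auto simp: o_def convergent_def)
  qed
  have "convergent (\<lambda>n. z (diagseq n) j)" for j
  proof -
    have "?P (to_nat j) (diagseq \<circ> ((+) (Suc (to_nat j))))"
    proof (rule diagseq_holds)
      fix r s :: "nat \<Rightarrow> nat" and n
      assume "strict_mono r" "convergent (\<lambda>k. z (s k) (from_nat n))"
      then show "convergent (\<lambda>k. z ((s \<circ> r) k) (from_nat n))"
        using convergent_subseq_convergent[of "\<lambda>k. z (s k) (from_nat n)" r] by (simp add: o_def)
    qed
    then obtain l where "(\<lambda>n. z (diagseq (n + Suc (to_nat j))) j) \<longlonglongrightarrow> l"
      by (auto simp: convergent_def o_def add.commute)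
    then have "(\<lambda>n. z (diagseq n) j) \<longlonglongrightarrow> l" by (rule LIMSEQ_offset)
    then show ?thesis by (auto simp: convergent_def)
  qed
  with subseq_diagseq that show ?thesis by blast
qed

text \<open>The line is cut into cells shorter than the separation, so that each cell holds at most one point of
  each set. A set with its coefficients is then a sequence of triples, indexed by the cells:
  occupied or not, position of the point, coefficient. The entries range over compact sets, and a
  diagonal subsequence converges in every cell. The occupied cells of the limit form the limit set; the
  series converges by domination with the envelope of \<open>g\<close>. The coefficient at the origin stays away
  from 0.\<close>

lemma weak_compactness:
  fixes \<Gamma> :: "nat \<Rightarrow> real set" and c :: "nat \<Rightarrow> real \<Rightarrow> complex"
  assumes g: "amalgam g" "continuous_on UNIV g"
    and d: "0 < d" "d \<le> 1" and sep\<Gamma>: "\<And>n. sep d (\<Gamma> n)"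
    and c: "\<And>n \<gamma>. \<gamma> \<in> \<Gamma> n \<Longrightarrow> norm (c n \<gamma>) \<le> 1"
    and zero: "\<And>n. 0 \<in> \<Gamma> n" "\<And>n. norm (c n 0) \<ge> 1 / 2"
    and small: "\<And>n x. norm (shift_series g (\<Gamma> n) (c n) x) \<le> \<epsilon> n" and \<epsilon>: "\<epsilon> \<longlonglongrightarrow> 0"
  obtains r \<Gamma>' c' where "strict_mono r" "weakly_converges (\<lambda>n. \<Gamma> (r n)) \<Gamma>'"
    "c' \<in> linf_seqs \<Gamma>'" "0 \<in> \<Gamma>'" "c' 0 \<noteq> 0" "\<And>x. shift_series g \<Gamma>' c' x = 0"
proof -
  define h where "h = d / 2"
  have h: "h > 0" "h < d" "h \<le> 1" using d by (auto simp: h_def)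
  define cell where "cell n = (\<lambda>\<gamma>. \<lfloor>\<gamma> / h\<rfloor>) ` \<Gamma> n" for n
  define pt where "pt n = inv_into (\<Gamma> n) (\<lambda>\<gamma>. \<lfloor>\<gamma> / h\<rfloor>)" for n
  define e :: "nat \<Rightarrow> int \<Rightarrow> real" where "e n j = (if j \<in> cell n then 1 else 0)" for n j
  define p where "p n j = (if j \<in> cell n then pt n j else of_int j * h)" for n j
  define q where "q n j = (if j \<in> cell n then c n (pt n j) else 0)" for n j
  have seph: "sep h (\<Gamma> n)" for n using sep\<Gamma>[of n] h by (force simp: sep_def)
  have inj: "inj_on (\<lambda>\<gamma>. \<lfloor>\<gamma> / h\<rfloor>) (\<Gamma> n)" for n
    using sep_inj_floor[OF seph h(1), where a = 0] by simp
  have bij: "bij_betw (pt n) (cell n) (\<Gamma> n)" for n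
    unfolding pt_def cell_def by (rule bij_betw_inv_into) (simp add: bij_betw_def inj)
  have pt\<Gamma>: "pt n j \<in> \<Gamma> n" if "j \<in> cell n" for n j
    using bij that by (auto simp: bij_betw_def)
  have ptfloor: "\<lfloor>pt n j / h\<rfloor> = j" if "j \<in> cell n" for n j
    using that unfolding pt_def cell_def by (rule f_inv_into_f)
  have prange: "of_int j * h \<le> p n j" "p n j \<le> (of_int j + 1) * h" for n j
  proof -
    have "of_int j * h \<le> p n j \<and> p n j \<le> (of_int j + 1) * h"
    proof (cases "j \<in> cell n")
      case True
      then have "of_int j \<le> pt n j / h" "pt n j / h < of_int j + 1" using ptfloor[OF True] by linarith+
      then show ?thesis using h True by (simp add: p_def field_simps)
    qed (use h in \<open>simp add: p_def algebra_simps\<close>)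
    then show "of_int j * h \<le> p n j" "p n j \<le> (of_int j + 1) * h" by auto
  qed
  have q1: "norm (q n j) \<le> 1" for n j using c pt\<Gamma> by (simp add: q_def)
  \<comment> \<open>Unoccupied cells carry their left end point and coefficient 0, so that all three entries stay bounded.\<close>
  obtain r where r: "strict_mono r" and conv: "\<And>j. convergent (\<lambda>n. (e (r n) j, p (r n) j, q (r n) j))"
  proof (rule diagonal_convergent_subsequence[of "\<lambda>n j. (e n j, p n j, q n j)"])
    fix j
    have "range (\<lambda>n. (e n j, p n j, q n j)) \<subseteq> {0..1} \<times> {of_int j * h..(of_int j + 1) * h} \<times> cball 0 1"
      using prange q1 by (auto simp: e_def)
    then show "bounded (range (\<lambda>n. (e n j, p n j, q n j)))"
      by (rule bounded_subset[rotated]) (intro bounded_Times bounded_closed_interval bounded_cball)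
  qed blast
  define e' p' q' where "e' j = lim (\<lambda>n. e (r n) j)" and "p' j = lim (\<lambda>n. p (r n) j)"
    and "q' j = lim (\<lambda>n. q (r n) j)" for j
  have lim: "(\<lambda>n. e (r n) j) \<longlonglongrightarrow> e' j" "(\<lambda>n. p (r n) j) \<longlonglongrightarrow> p' j" "(\<lambda>n. q (r n) j) \<longlonglongrightarrow> q' j" for j
  proof -
    obtain l where "(\<lambda>n. (e (r n) j, p (r n) j, q (r n) j)) \<longlonglongrightarrow> l"
      using conv[of j] by (auto simp: convergent_def)
    from tendsto_fst[OF this] tendsto_fst[OF tendsto_snd[OF this]] tendsto_snd[OF tendsto_snd[OF this]]
    show "(\<lambda>n. e (r n) j) \<longlonglongrightarrow> e' j" "(\<lambda>n. p (r n) j) \<longlonglongrightarrow> p' j" "(\<lambda>n. q (r n) j) \<longlonglongrightarrow> q' j"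
      unfolding e'_def p'_def q'_def by (auto simp: convergent_LIMSEQ_iff[symmetric] intro: convergentI)
  qed
  \<comment> \<open>The indicators take the values 0 and 1 only, so they are eventually constant in each cell.\<close>
  define J where "J = {j. e' j > 1 / 2}"
  have evJ: "\<forall>\<^sub>F n in sequentially. j \<in> cell (r n) \<longleftrightarrow> j \<in> J" for j
  proof (cases "j \<in> J")
    case True
    then have "e' j > 1 / 2" by (simp add: J_def)
    from order_tendstoD(1)[OF lim(1) this] have "\<forall>\<^sub>F n in sequentially. e (r n) j > 1 / 2" .
    then show ?thesis by eventually_elim (use True in \<open>auto simp: e_def split: if_splits\<close>)
  next
    case False
    then have "e' j < 1" by (simp add: J_def)
    from order_tendstoD(2)[OF lim(1) this] have "\<forall>\<^sub>F n in sequentially. e (r n) j < 1" .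
    then show ?thesis by eventually_elim (use False in \<open>auto simp: e_def split: if_splits\<close>)
  qed
  have p'range: "of_int j * h \<le> p' j" "p' j \<le> (of_int j + 1) * h" for j
    using prange by (auto intro: tendsto_lowerbound[OF lim(2)] tendsto_upperbound[OF lim(2)])
  have q'1: "norm (q' j) \<le> 1" for j
    using q1 by (intro tendsto_upperbound[OF tendsto_norm[OF lim(3)]]) auto
  have q'0: "q' j = 0" if "j \<notin> J" for j
  proof (rule LIMSEQ_unique[OF lim(3)])
    have "\<forall>\<^sub>F n in sequentially. 0 = q (r n) j"
      using evJ[of j] by eventually_elim (use that in \<open>simp add: q_def\<close>)
    then show "(\<lambda>n. q (r n) j) \<longlonglongrightarrow> 0" by (rule Lim_transform_eventually[OF tendsto_const])
  qed
  \<comment> \<open>Points in different cells are distinct and hence far apart, also in the limit; so limit points do not collide.\<close>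
  have far: "d \<le> \<bar>p' i - p' j\<bar>" if "i \<in> J" "j \<in> J" "i \<noteq> j" for i j
  proof (rule tendsto_lowerbound)
    show "(\<lambda>n. \<bar>p (r n) i - p (r n) j\<bar>) \<longlonglongrightarrow> \<bar>p' i - p' j\<bar>" by (intro tendsto_intros lim)
    show "\<forall>\<^sub>F n in sequentially. d \<le> \<bar>p (r n) i - p (r n) j\<bar>"
      using evJ[of i] evJ[of j]
    proof eventually_elim
      case (elim n)
      with that have "i \<in> cell (r n)" "j \<in> cell (r n)" by auto
      moreover from this have "pt (r n) i \<noteq> pt (r n) j" using ptfloor that(3) by metis
      ultimately show ?case using sep\<Gamma>[of "r n"] pt\<Gamma> by (auto simp: p_def sep_def)
    qed
  qed simp
  have injp: "inj_on p' J" using far d by (force simp: inj_on_def)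
  define \<Gamma>' where "\<Gamma>' = p' ` J"
  define c' where "c' = q' \<circ> inv_into J p'"
  have c'p: "c' (p' j) = q' j" if "j \<in> J" for j
    using injp that by (simp add: c'_def)
  have sep\<Gamma>': "sep d \<Gamma>'" unfolding sep_def \<Gamma>'_def using far by auto
  have c'lin: "c' \<in> linf_seqs \<Gamma>'"
    unfolding linf_seqs_def bounded_iff using q'1 c'p by (auto simp: \<Gamma>'_def intro!: exI[of _ 1])

  have weak: "weakly_converges (\<lambda>n. \<Gamma> (r n)) \<Gamma>'"
    unfolding weakly_converges_def
  proof (intro conjI allI impI)
    show "separated_set (\<Gamma> (r k))" for k using separated_set_iff sep\<Gamma> d by blast
    show "separated_set \<Gamma>'" using separated_set_iff sep\<Gamma>' d by blast
    have "ereal d \<le> (INF k. separation (\<Gamma> (r k)))"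
      by (intro INF_greatest) (simp add: separation_ge_iff sep\<Gamma>)
    moreover have "0 < ereal d" using d by simp
    ultimately show "0 < (INF k. separation (\<Gamma> (r k)))" by (rule order_less_le_trans[rotated])
    fix \<delta> R :: real assume \<delta>R: "\<delta> > 0" "R > 0"
    \<comment> \<open>Only finitely many cells meet the window; one cell more on either side allows for limit points on a cell boundary.\<close>
    let ?F = "{\<lfloor>- R / h\<rfloor> - 1..\<lfloor>R / h\<rfloor> + 1}"
    have "\<forall>\<^sub>F n in sequentially. \<forall>j\<in>?F. (j \<in> cell (r n) \<longleftrightarrow> j \<in> J) \<and> \<bar>p (r n) j - p' j\<bar> < \<delta>"
    proof (rule eventually_ball_finite)
      show "\<forall>j\<in>?F. \<forall>\<^sub>F n in sequentially. (j \<in> cell (r n) \<longleftrightarrow> j \<in> J) \<and> \<bar>p (r n) j - p' j\<bar> < \<delta>"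
        using evJ tendstoD[OF lim(2) \<delta>R(1)] by (auto simp: dist_real_def intro: eventually_conj)
    qed simp
    then obtain l where l: "\<And>n j. n \<ge> l \<Longrightarrow> j \<in> ?F \<Longrightarrow> (j \<in> cell (r n) \<longleftrightarrow> j \<in> J) \<and> \<bar>p (r n) j - p' j\<bar> < \<delta>"
      unfolding eventually_sequentially by blast
    have inF: "j \<in> ?F" if "of_int j * h \<le> t" "t \<le> (of_int j + 1) * h" "- R < t" "t < R" for j t
    proof -
      have "of_int j \<le> R / h" using that h by (simp add: pos_le_divide_eq)
      moreover have "- R / h \<le> of_int j + 1" using that(2,3) by (intro pos_divide_le_eq[OF h(1), THEN iffD2]) linarith
      ultimately show ?thesis by (simp add: le_floor_iff) linarith
    qed
    show "\<exists>l. \<forall>k\<ge>l. \<Gamma> (r k) \<inter> {-R<..<R} \<subseteq> (\<Union>\<gamma>\<in>\<Gamma>'. ball \<gamma> \<delta>) \<and>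
        \<Gamma>' \<inter> {-R<..<R} \<subseteq> (\<Union>\<gamma>\<in>\<Gamma> (r k). ball \<gamma> \<delta>)"
    proof (intro exI[of _ l] allI impI conjI subsetI)
      fix k \<gamma> assume k: "k \<ge> l" and \<gamma>: "\<gamma> \<in> \<Gamma> (r k) \<inter> {-R<..<R}"
      then obtain j where j: "j \<in> cell (r k)" "\<gamma> = pt (r k) j"
        using bij[of "r k"] by (auto simp: bij_betw_def)
      then have pj: "p (r k) j = \<gamma>" by (simp add: p_def)
      then have "j \<in> ?F" using \<gamma> prange[where n = "r k" and j = j] by (intro inF[of _ \<gamma>]) auto
      with l[OF k this] j pj show "\<gamma> \<in> (\<Union>\<gamma>\<in>\<Gamma>'. ball \<gamma> \<delta>)"
        by (auto simp: \<Gamma>'_def dist_real_def abs_minus_commute)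
    next
      fix k \<gamma> assume k: "k \<ge> l" and \<gamma>: "\<gamma> \<in> \<Gamma>' \<inter> {-R<..<R}"
      then obtain j where j: "j \<in> J" "\<gamma> = p' j" by (auto simp: \<Gamma>'_def)
      then have "j \<in> ?F" using \<gamma> p'range[of j] by (intro inF[of _ \<gamma>]) auto
      with l[OF k this] j have jc: "j \<in> cell (r k)" "\<bar>p (r k) j - \<gamma>\<bar> < \<delta>" by auto
      then have "pt (r k) j \<in> \<Gamma> (r k)" "\<gamma> \<in> ball (pt (r k) j) \<delta>"
        using pt\<Gamma> by (auto simp: p_def dist_real_def)
      then show "\<gamma> \<in> (\<Union>\<gamma>\<in>\<Gamma> (r k). ball \<gamma> \<delta>)" by blast
    qed
  qed

  have series_n: "shift_series g (\<Gamma> n) (c n) x = infsum (\<lambda>j. q n j * g (x - p n j)) UNIV" for n x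
  proof -
    have "shift_series g (\<Gamma> n) (c n) x = infsum (\<lambda>j. c n (pt n j) * g (x - pt n j)) (cell n)"
      unfolding shift_series_def
      by (rule infsum_reindex_bij_betw[OF bij, symmetric])
    also have "\<dots> = infsum (\<lambda>j. q n j * g (x - p n j)) UNIV"
      by (rule infsum_cong_neutral) (auto simp: q_def p_def)
    finally show ?thesis .
  qed
  have series_lim: "shift_series g \<Gamma>' c' x = infsum (\<lambda>j. q' j * g (x - p' j)) UNIV" for x
  proof -
    have "shift_series g \<Gamma>' c' x = infsum ((\<lambda>\<gamma>. c' \<gamma> * g (x - \<gamma>)) \<circ> p') J"
      unfolding shift_series_def \<Gamma>'_def by (rule infsum_reindex[OF injp])
    also have "\<dots> = infsum (\<lambda>j. q' j * g (x - p' j)) UNIV"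
      by (rule infsum_cong_neutral) (auto simp: c'p q'0)
    finally show ?thesis .
  qed
  obtain E :: "real \<Rightarrow> real" where E: "\<And>t. E t \<ge> 0" "\<And>s t. \<bar>s - t\<bar> \<le> 1 \<Longrightarrow> norm (g s) \<le> E t"
    "\<And>d A x. sep d A \<Longrightarrow> d > 0 \<Longrightarrow> (\<lambda>\<gamma>. E (x - \<gamma>)) summable_on A"
    using amalgam_envelope[OF g(1)] by metis
  have Esum: "(\<lambda>j::int. E (x - of_int j * h)) summable_on UNIV" for x
  proof -
    have "sep h (range (\<lambda>j::int. of_int j * h))"
      unfolding sep_def
    proof (intro ballI impI)
      fix x y assume "x \<in> range (\<lambda>j::int. of_int j * h)" "y \<in> range (\<lambda>j::int. of_int j * h)" "x \<noteq> y"
      then obtain i j :: int where ij: "x = of_int i * h" "y = of_int j * h" "i \<noteq> j" by auto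
      from ij(3) have "1 * h \<le> \<bar>real_of_int (i - j)\<bar> * h" using h by (intro mult_right_mono) linarith+
      also have "\<dots> = \<bar>(real_of_int i - real_of_int j) * h\<bar>" using h by (simp add: abs_mult)
      finally show "h \<le> \<bar>x - y\<bar>" by (simp add: ij algebra_simps)
    qed
    from E(3)[OF this h(1), of x] have "((\<lambda>\<gamma>. E (x - \<gamma>)) \<circ> (\<lambda>j::int. of_int j * h)) summable_on UNIV"
      by (subst (asm) summable_on_reindex) (use h in \<open>auto simp: inj_def\<close>)
    then show ?thesis by (simp add: o_def)
  qed
  have series0: "shift_series g \<Gamma>' c' x = 0" for x
  proof (rule LIMSEQ_unique)
    show "(\<lambda>n. shift_series g (\<Gamma> (r n)) (c (r n)) x) \<longlonglongrightarrow> shift_series g \<Gamma>' c' x"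
      unfolding series_n series_lim
    proof (rule infsum_dominated_convergence[OF Esum[of x]])
      fix n and j :: int
      have "\<bar>p (r n) j - of_int j * h\<bar> \<le> 1"
        using prange[where n = "r n" and j = j] h by (simp add: algebra_simps abs_le_iff)
      then have "norm (g (x - p (r n) j)) \<le> E (x - of_int j * h)" by (intro E(2)) linarith
      with q1 show "norm (q (r n) j * g (x - p (r n) j)) \<le> E (x - of_int j * h)"
        unfolding norm_mult by (meson mult_left_le_one_le norm_ge_zero order_trans)
    next
      fix j :: int
      have "(\<lambda>n. g (x - p (r n) j)) \<longlonglongrightarrow> g (x - p' j)"
        using g(2) by (intro isCont_tendsto_compose[of _ g] tendsto_intros lim)
          (simp add: continuous_on_eq_continuous_at)
      then show "(\<lambda>n. q (r n) j * g (x - p (r n) j)) \<longlonglongrightarrow> q' j * g (x - p' j)"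
        by (intro tendsto_mult lim)
    qed
    have "(\<lambda>n. \<epsilon> (r n)) \<longlonglongrightarrow> 0" using LIMSEQ_subseq_LIMSEQ[OF \<epsilon> r] by (simp add: o_def)
    then show "(\<lambda>n. shift_series g (\<Gamma> (r n)) (c (r n)) x) \<longlonglongrightarrow> 0"
      by (rule Lim_null_comparison[rotated]) (use small in auto)
  qed
  have cell0: "0 \<in> cell n" for n unfolding cell_def using zero(1)[of n] by force
  have pt0: "pt n 0 = 0" for n
    using inj[of n] zero(1)[of n] pt\<Gamma>[OF cell0] ptfloor[OF cell0, of n] by (force simp: inj_on_def)
  have J0: "0 \<in> J" using eventually_happens'[OF _ evJ[of 0]] cell0 by auto
  have "(\<lambda>n. p (r n) 0) = (\<lambda>n. 0)" using cell0 pt0 by (simp add: p_def)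
  then have p0: "p' 0 = 0" using lim(2)[of 0] LIMSEQ_unique tendsto_const by metis
  have "norm (q' 0) \<ge> 1 / 2"
    by (rule tendsto_lowerbound[OF tendsto_norm[OF lim(3)]]) (use zero cell0 pt0 in \<open>auto simp: q_def\<close>)
  then have "c' 0 \<noteq> 0" using c'p[OF J0] p0 by auto
  moreover have "0 \<in> \<Gamma>'" unfolding \<Gamma>'_def using J0 p0 by force
  ultimately show ?thesis using that r weak c'lin series0 by blast
qed

text \<open>The sequences that violate the lower bound are divided by their sup norms and translated so that a
  coefficient of more than half the supremum sits at the origin.\<close>

lemma not_linf_stable_imp_dependent_limit:
  assumes g: "amalgam g" "continuous_on UNIV g" and A: "separated_set A"
    and ns: "\<not> linf_stable A g"
  shows "\<exists>A'\<in>weak_limits A. \<not> linf_independent A' g"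
proof -
  obtain d where d: "d > 0" "d \<le> 1" "sep d A" using A separated_set_iff by blast
  have "\<exists>c\<in>linf_seqs A. \<exists>\<gamma>\<in>A. \<exists>r\<ge>0. (\<forall>x. norm (shift_series g A c x) \<le> r) \<and> r < C * norm (c \<gamma>)" if "C > 0" for C
    using ns that unfolding linf_stable_def stable_shifts_iff[OF g d(3,1) order_refl] by (force simp: not_le)
  then have "\<forall>n. \<exists>c \<gamma> r. c \<in> linf_seqs A \<and> \<gamma> \<in> A \<and> r \<ge> 0 \<and> (\<forall>x. norm (shift_series g A c x) \<le> r)
      \<and> r < 1 / real (Suc n) * norm (c \<gamma>)"
    by (metis of_nat_0_less_iff zero_less_Suc zero_less_divide_1_iff)
  then obtain c \<gamma>0 r where c: "\<And>n. c n \<in> linf_seqs A" and \<gamma>0: "\<And>n. \<gamma>0 n \<in> A"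
    and r: "\<And>n. r n \<ge> 0" "\<And>n x. norm (shift_series g A (c n) x) \<le> r n"
      "\<And>n. r n < 1 / real (Suc n) * norm (c n (\<gamma>0 n))" by metis
  define S where "S n = (SUP \<gamma>\<in>A. norm (c n \<gamma>))" for n
  have bdd: "bdd_above ((\<lambda>\<gamma>. norm (c n \<gamma>)) ` A)" for n
    using linf_seqs_bound[OF c[of n]] by (metis bdd_aboveI2)
  have leS: "norm (c n \<gamma>) \<le> S n" if "\<gamma> \<in> A" for n \<gamma>
    unfolding S_def using that bdd by (rule cSUP_upper)
  have Spos: "S n > 0" for n
  proof -
    have "0 < 1 / real (Suc n) * norm (c n (\<gamma>0 n))" using r(1,3) by (rule order_le_less_trans)
    then have "0 < norm (c n (\<gamma>0 n))" by auto
    with leS[OF \<gamma>0[of n], of n] show ?thesis by linarith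
  qed
  have "\<exists>\<gamma>\<in>A. S n / 2 < norm (c n \<gamma>)" for n
    using less_cSUP_iff[OF _ bdd[of n], of "S n / 2"] \<gamma>0 Spos[of n] unfolding S_def by auto
  then obtain t where t: "\<And>n. t n \<in> A" "\<And>n. S n / 2 < norm (c n (t n))" by metis
  define \<Gamma> where "\<Gamma> n = (\<lambda>\<gamma>. \<gamma> - t n) ` A" for n
  define c1 where "c1 n \<gamma> = c n (\<gamma> + t n) / of_real (S n)" for n \<gamma>
  have ser: "shift_series g (\<Gamma> n) (c1 n) x = shift_series g A (c n) (x + t n) / of_real (S n)" for n x
  proof -
    have "shift_series g (\<Gamma> n) (c1 n) x = infsum ((\<lambda>\<gamma>. c1 n \<gamma> * g (x - \<gamma>)) \<circ> (\<lambda>\<gamma>. \<gamma> - t n)) A"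
      unfolding shift_series_def \<Gamma>_def by (rule infsum_reindex) (auto simp: inj_on_def)
    also have "\<dots> = infsum (\<lambda>\<gamma>. c n \<gamma> * g (x + t n - \<gamma>) / of_real (S n)) A"
      by (intro infsum_cong) (simp add: c1_def algebra_simps)
    also have "\<dots> = shift_series g A (c n) (x + t n) / of_real (S n)"
      unfolding shift_series_def divide_inverse by (rule infsum_cmult_left')
    finally show ?thesis .
  qed
  obtain \<rho> A' c' where lim: "strict_mono \<rho>" "weakly_converges (\<lambda>n. \<Gamma> (\<rho> n)) A'"
    "c' \<in> linf_seqs A'" "0 \<in> A'" "c' 0 \<noteq> 0" "\<And>x. shift_series g A' c' x = 0"
  proof (rule weak_compactness[OF g d(1,2), of \<Gamma> c1 "\<lambda>n. 1 / real (Suc n)"])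
    show "sep d (\<Gamma> n)" for n using d(3) by (simp add: \<Gamma>_def sep_translate)
    show "norm (c1 n \<gamma>) \<le> 1" if "\<gamma> \<in> \<Gamma> n" for n \<gamma>
      using that leS Spos[of n] by (auto simp: \<Gamma>_def c1_def norm_divide)
    show "0 \<in> \<Gamma> n" for n using t(1) by (force simp: \<Gamma>_def)
    show "1 / 2 \<le> norm (c1 n 0)" for n
      using t(2)[of n] Spos[of n] by (simp add: c1_def norm_divide field_simps)
    show "norm (shift_series g (\<Gamma> n) (c1 n) x) \<le> 1 / real (Suc n)" for n x
    proof -
      have "norm (shift_series g A (c n) (x + t n)) \<le> 1 / real (Suc n) * norm (c n (\<gamma>0 n))"
        using r(2,3) less_imp_le order_trans by blast
      also have "\<dots> \<le> 1 / real (Suc n) * S n" by (intro mult_left_mono leS \<gamma>0) simp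
      finally show ?thesis using Spos[of n] unfolding ser by (simp add: norm_divide pos_divide_le_eq)
    qed
    show "(\<lambda>n. 1 / real (Suc n)) \<longlonglongrightarrow> 0"
      using LIMSEQ_inverse_real_of_nat by (simp add: inverse_eq_divide)
  qed blast
  have "A' \<in> weak_limits A"
    using lim(2) unfolding weak_limits_def \<Gamma>_def by (auto intro!: exI[of _ "\<lambda>k. t (\<rho> k)"])
  moreover have "\<not> linf_independent A' g"
    unfolding linf_independent_def using lim by blast
  ultimately show ?thesis by blast
qed

section \<open>From a dependent weak limit to instability on finite sequences\<close>

lemma summable_tail:
  fixes b :: "int \<Rightarrow> real"
  assumes b: "b summable_on UNIV" "\<And>k. b k \<ge> 0" and "\<epsilon> > 0"
  obtains R :: real where "R \<ge> 0" "infsum b {k. \<bar>of_int k\<bar> > R} \<le> \<epsilon>"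
proof -
  obtain F where F: "finite F" "dist (sum b F) (infsum b UNIV) \<le> \<epsilon>"
    using has_sum_finite_approximation[OF has_sum_infsum[OF b(1)] \<open>\<epsilon> > 0\<close>] by blast
  have "finite ((\<lambda>k. \<bar>real_of_int k\<bar>) ` F)" using F by simp
  then obtain R0 where R0: "\<And>k. k \<in> F \<Longrightarrow> \<bar>real_of_int k\<bar> \<le> R0"
    by (meson bdd_above_finite bdd_above.E imageI)
  define R where "R = max R0 0"
  let ?T = "{k. \<bar>real_of_int k\<bar> > R}"
  have "infsum b ?T \<le> infsum b (UNIV - F)"
  proof (rule infsum_mono_neutral)
    show "b summable_on ?T" "b summable_on UNIV - F"
      by (rule summable_on_subset_banach[OF b(1)]; simp)+
  qed (use R0 b in \<open>force simp: R_def\<close>)+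
  also have "\<dots> = infsum b UNIV - infsum b F" by (rule infsum_Diff) (use b F in auto)
  also have "\<dots> \<le> \<epsilon>" using F by (simp add: dist_real_def)
  finally show ?thesis by (intro that[of R]) (auto simp: R_def)
qed

lemma amalgam_uniformly_continuous:
  assumes g: "amalgam g" "continuous_on UNIV g" and "\<epsilon> > 0"
  obtains \<delta> where "\<delta> > 0" "\<And>s t. \<bar>s - t\<bar> < \<delta> \<Longrightarrow> norm (g s - g t) \<le> \<epsilon>"
proof -
  obtain b :: "int \<Rightarrow> real" where b: "b summable_on UNIV" "\<And>k. b k \<ge> 0" "\<And>t. norm (g t) \<le> b \<lfloor>t\<rfloor>"
    using amalgamE[OF g(1)] by blast
  obtain R :: real where R: "R \<ge> 0" "infsum b {k. \<bar>of_int k\<bar> > R} \<le> \<epsilon> / 2"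
    using summable_tail[OF b(1,2) half_gt_zero[OF \<open>\<epsilon> > 0\<close>]] by blast
  have small: "norm (g t) \<le> \<epsilon> / 2" if "\<bar>t\<bar> > R + 1" for t
  proof -
    have k: "\<bar>real_of_int \<lfloor>t\<rfloor>\<bar> > R" using that R(1) by linarith
    have "b \<lfloor>t\<rfloor> = infsum b {\<lfloor>t\<rfloor>}" by simp
    also have "\<dots> \<le> infsum b {k. \<bar>of_int k\<bar> > R}"
      by (rule infsum_mono_neutral) (use k b in \<open>auto intro: summable_on_subset_banach[OF b(1)]\<close>)
    finally show ?thesis using R b(3)[of t] by linarith
  qed
  let ?K = "{- (R + 2)..R + 2}"
  have "uniformly_continuous_on ?K g"
    by (intro compact_uniformly_continuous continuous_on_subset[OF g(2)]) auto
  then obtain \<delta> where \<delta>: "\<delta> > 0" "\<And>s t. s \<in> ?K \<Longrightarrow> t \<in> ?K \<Longrightarrow> \<bar>s - t\<bar> < \<delta> \<Longrightarrow> norm (g s - g t) < \<epsilon>"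
    using \<open>\<epsilon> > 0\<close> unfolding uniformly_continuous_on_def dist_norm real_norm_def by metis
  show ?thesis
  proof (rule that[of "min \<delta> 1"])
    fix s t :: real assume st: "\<bar>s - t\<bar> < min \<delta> 1"
    show "norm (g s - g t) \<le> \<epsilon>"
    proof (cases "s \<in> ?K \<and> t \<in> ?K")
      case True
      then show ?thesis using \<delta>(2)[of s t] st by simp
    next
      case False
      then have "\<bar>s\<bar> > R + 1" "\<bar>t\<bar> > R + 1" using st by auto
      then show ?thesis using small[of s] small[of t] norm_triangle_ineq4[of "g s" "g t"] by linarith
    qed
  qed (use \<delta> in auto)
qed

text \<open>For small \<open>\<eta>\<close> the factor \<open>min 1 (\<eta> |t|)\<close> is small where the mass of \<open>g\<close> sits, and at most 1 on its tail.\<close>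

lemma amalgam_slow_modulation_small:
  assumes g: "amalgam g" and d: "d > 0" and \<epsilon>: "\<epsilon> > 0"
  obtains \<eta> where "\<eta> > 0" "\<And>A x. sep d A \<Longrightarrow>
     infsum (\<lambda>\<gamma>. min 1 (\<eta> * \<bar>x - \<gamma>\<bar>) * norm (g (x - \<gamma>))) A \<le> \<epsilon>"
     "\<And>A x. sep d A \<Longrightarrow> (\<lambda>\<gamma>. min 1 (\<eta> * \<bar>x - \<gamma>\<bar>) * norm (g (x - \<gamma>))) summable_on A"
proof -
  obtain b :: "int \<Rightarrow> real" where b: "b summable_on UNIV" "\<And>k. b k \<ge> 0" "\<And>t. norm (g t) \<le> b \<lfloor>t\<rfloor>"
    using amalgamE[OF g(1)] by blast
  define N where "N = real (nat (\<lfloor>1 / d\<rfloor> + 1))"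
  define e where "e = \<epsilon> / (2 * (N + 1))"
  have N0: "N \<ge> 0" by (simp add: N_def)
  have e: "e > 0" using \<epsilon> N0 by (simp add: e_def)
  obtain R :: real where R: "R \<ge> 0" "infsum b {k. \<bar>of_int k\<bar> > R} \<le> e"
    using summable_tail[OF b(1,2) e] by blast
  define B where "B = infsum b UNIV"
  have B0: "B \<ge> 0" unfolding B_def by (intro infsum_nonneg b)
  define \<eta> where "\<eta> = e / ((R + 1) * (B + 1))"
  have \<eta>: "\<eta> > 0" using e R B0 by (simp add: \<eta>_def)
  define b' where "b' k = min 1 (\<eta> * (\<bar>of_int k\<bar> + 1)) * b k" for k :: int
  have b'0: "b' k \<ge> 0" for k using \<eta> b by (simp add: b'_def)
  have b'b: "b' k \<le> b k" for k unfolding b'_def using b by (intro mult_left_le_one_le) (use \<eta> in auto)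
  have b's: "b' summable_on UNIV"
    by (rule summable_on_comparison_test[OF b(1)]) (use b'0 b'b in auto)
  have le: "b' k \<le> \<eta> * (R + 1) * b k + (if \<bar>of_int k\<bar> > R then b k else 0)" for k
  proof (cases "\<bar>of_int k\<bar> > R")
    case True
    then show ?thesis using b'b[of k] b(2)[of k] \<eta> R by (simp add: add_increasing)
  next
    case False
    then have "b' k \<le> \<eta> * (R + 1) * b k" unfolding b'_def
      using \<eta> b(2)[of k] by (intro mult_right_mono) (auto intro!: min.coboundedI2 mult_left_mono)
    with False show ?thesis by simp
  qed
  have s2: "(\<lambda>k. if \<bar>of_int k\<bar> > R then b k else 0) summable_on UNIV"
    by (rule summable_on_comparison_test[OF b(1)]) (use b in auto)
  have "infsum b' UNIV \<le> infsum (\<lambda>k. \<eta> * (R + 1) * b k + (if \<bar>of_int k\<bar> > R then b k else 0)) UNIV"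
    by (intro infsum_mono b's summable_on_add summable_on_cmult_right b s2 le)
  also have "\<dots> = infsum (\<lambda>k. \<eta> * (R + 1) * b k) UNIV + infsum (\<lambda>k. if \<bar>of_int k\<bar> > R then b k else 0) UNIV"
    by (intro infsum_add summable_on_cmult_right b s2)
  also have "infsum (\<lambda>k. \<eta> * (R + 1) * b k) UNIV = \<eta> * (R + 1) * B"
    unfolding B_def by (rule infsum_cmult_right')
  also have "infsum (\<lambda>k. if \<bar>of_int k\<bar> > R then b k else 0) UNIV = infsum b {k. \<bar>of_int k\<bar> > R}"
    by (rule infsum_cong_neutral) auto
  also have "\<eta> * (R + 1) * B + infsum b {k. \<bar>of_int k\<bar> > R} \<le> e + e"
  proof (rule add_mono[OF _ R(2)])
    have "\<eta> * (R + 1) * B = e * (B / (B + 1))" using R by (simp add: \<eta>_def)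
    also have "\<dots> \<le> e * 1" using e B0 by (intro mult_left_mono) auto
    finally show "\<eta> * (R + 1) * B \<le> e" by simp
  qed
  finally have ib': "infsum b' UNIV \<le> 2 * e" by simp
  have pw: "min 1 (\<eta> * \<bar>t\<bar>) * norm (g t) \<le> b' \<lfloor>t\<rfloor>" for t
    unfolding b'_def
  proof (rule mult_mono)
    have "\<bar>t\<bar> \<le> \<bar>of_int \<lfloor>t\<rfloor>\<bar> + 1" by linarith
    then have "\<eta> * \<bar>t\<bar> \<le> \<eta> * (\<bar>of_int \<lfloor>t\<rfloor>\<bar> + 1)" using \<eta> by (intro mult_left_mono) auto
    then show "min 1 (\<eta> * \<bar>t\<bar>) \<le> min 1 (\<eta> * (\<bar>of_int \<lfloor>t\<rfloor>\<bar> + 1))" by linarith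
  qed (use b \<eta> in auto)
  have sm: "(\<lambda>\<gamma>. min 1 (\<eta> * \<bar>x - \<gamma>\<bar>) * norm (g (x - \<gamma>))) summable_on A" if "sep d A" for A x
    by (rule summable_on_comparison_test[OF sep_sum_le(1)[OF that d b's b'0, of x]])
       (use pw \<eta> in auto)
  show ?thesis
  proof (rule that[OF \<eta> _ sm])
    fix A x assume A: "sep d A"
    have "infsum (\<lambda>\<gamma>. min 1 (\<eta> * \<bar>x - \<gamma>\<bar>) * norm (g (x - \<gamma>))) A \<le> infsum (\<lambda>\<gamma>. b' \<lfloor>x - \<gamma>\<rfloor>) A"
      by (intro infsum_mono sm[OF A] sep_sum_le(1)[OF A d b's b'0] pw)
    also have "\<dots> \<le> N * infsum b' UNIV" unfolding N_def by (rule sep_sum_le(2)[OF A d b's b'0])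
    also have "\<dots> \<le> N * (2 * e)" using ib' N0 by (intro mult_left_mono)
    also have "\<dots> = \<epsilon> * (N / (N + 1))" using N0 by (simp add: e_def field_simps)
    also have "\<dots> \<le> \<epsilon> * 1" using \<epsilon> N0 by (intro mult_left_mono) auto
    finally show "infsum (\<lambda>\<gamma>. min 1 (\<eta> * \<bar>x - \<gamma>\<bar>) * norm (g (x - \<gamma>))) A \<le> \<epsilon>" by simp
  qed
qed

lemma sep_finite:
  assumes "sep d A" "d > 0"
  shows "finite (A \<inter> {a..b})"
proof (rule finite_imageD)
  have "(\<lambda>\<gamma>. \<lfloor>(\<gamma> - 0) / d\<rfloor>) ` (A \<inter> {a..b}) \<subseteq> {\<lfloor>a / d\<rfloor>..\<lfloor>b / d\<rfloor>}"
    using assms(2) by (auto intro!: floor_mono divide_right_mono)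
  then show "finite ((\<lambda>\<gamma>. \<lfloor>(\<gamma> - 0) / d\<rfloor>) ` (A \<inter> {a..b}))" by (rule finite_subset) simp
  show "inj_on (\<lambda>\<gamma>. \<lfloor>(\<gamma> - 0) / d\<rfloor>) (A \<inter> {a..b})"
    by (rule sep_inj_floor[OF sep_subset[OF assms(1)] assms(2)]) auto
qed

text \<open>Let \<open>\<tau>\<close> be a tent of height 1 and slope \<open>\<eta>\<close> around a point \<open>\<gamma>\<^sub>0\<close> with nonzero coefficient. As the series
  with coefficients \<open>c \<gamma>\<close> vanishes, the one with coefficients \<open>\<tau>(\<gamma>) c \<gamma>\<close> equals
  \<open>\<Sum> (\<tau>(\<gamma>) - \<tau>(x)) c \<gamma> G(x - \<gamma>)\<close>, which is uniformly small. It has finitely many terms, and uniform continuity of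
  \<open>G\<close> allows their points to be moved into a translate of \<open>A\<close>. The coefficient at \<open>\<gamma>\<^sub>0\<close> is unchanged.\<close>

lemma dependent_limit_imp_not_c00_stable:
  assumes g: "amalgam g" "continuous_on UNIV g" and A: "separated_set A"
    and A': "A' \<in> weak_limits A" and dep: "\<not> linf_independent A' g"
  shows "\<not> c00_stable A g"
proof
  assume "c00_stable A g"
  obtain x where wc: "weakly_converges (\<lambda>k. (\<lambda>\<gamma>. \<gamma> - x k) ` A) A'"
    using A' by (auto simp: weak_limits_def)
  obtain c \<gamma>0 where c: "c \<in> linf_seqs A'" "\<gamma>0 \<in> A'" "c \<gamma>0 \<noteq> 0" "\<And>x. shift_series g A' c x = 0"
    using dep by (auto simp: linf_independent_def)
  obtain M where M: "M > 0" "\<And>\<gamma>. \<gamma> \<in> A' \<Longrightarrow> norm (c \<gamma>) \<le> M" using linf_seqs_bound[OF c(1)] by blast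
  obtain d where d: "d > 0" "sep d A'"
    using wc separated_set_iff by (auto simp: weakly_converges_def)
  obtain dA where dA: "dA > 0" "sep dA A" using A separated_set_iff by blast
  have "c00_seqs A \<subseteq> linf_seqs A" using c00_subset_c0 c0_subset_linf by blast
  from stable_shifts_iff[OF g dA(2,1) this] \<open>c00_stable A g\<close>
  have "\<exists>C>0. \<forall>c\<in>c00_seqs A. \<forall>\<gamma>\<in>A. \<forall>r\<ge>0. (\<forall>x. norm (shift_series g A c x) \<le> r) \<longrightarrow> C * norm (c \<gamma>) \<le> r"
    unfolding c00_stable_def by (rule iffD1)
  then obtain C where C: "C > 0" "\<And>c \<gamma> r. c \<in> c00_seqs A \<Longrightarrow> \<gamma> \<in> A \<Longrightarrow> r \<ge> 0 \<Longrightarrow>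
      (\<forall>x. norm (shift_series g A c x) \<le> r) \<Longrightarrow> C * norm (c \<gamma>) \<le> r" by blast
  define \<kappa> where "\<kappa> = norm (c \<gamma>0)"
  have \<kappa>: "\<kappa> > 0" using c by (simp add: \<kappa>_def)
  have "C * \<kappa> / (4 * M) > 0" using C \<kappa> M by simp
  from amalgam_slow_modulation_small[OF g(1) d(1) this]
  obtain \<eta> where \<eta>0: "\<eta> > 0"
    and \<eta>1: "\<And>A x. sep d A \<Longrightarrow>
      infsum (\<lambda>\<gamma>. min 1 (\<eta> * \<bar>x - \<gamma>\<bar>) * norm (g (x - \<gamma>))) A \<le> C * \<kappa> / (4 * M)"
    and \<eta>2: "\<And>A x. sep d A \<Longrightarrow>
      (\<lambda>\<gamma>. min 1 (\<eta> * \<bar>x - \<gamma>\<bar>) * norm (g (x - \<gamma>))) summable_on A" by blast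
  note \<eta> = \<eta>0 \<eta>1[OF d(2)] \<eta>2[OF d(2)]
  define \<tau> where "\<tau> t = max 0 (1 - \<eta> * \<bar>t - \<gamma>0\<bar>)" for t
  have \<tau>01: "0 \<le> \<tau> t" "\<tau> t \<le> 1" for t using \<eta>(1) by (auto simp: \<tau>_def)
  have \<tau>lip: "\<bar>\<tau> t - \<tau> s\<bar> \<le> min 1 (\<eta> * \<bar>s - t\<bar>)" for s t
  proof -
    have "\<bar>\<bar>t - \<gamma>0\<bar> - \<bar>s - \<gamma>0\<bar>\<bar> \<le> \<bar>s - t\<bar>" by linarith
    then have "\<eta> * \<bar>\<bar>t - \<gamma>0\<bar> - \<bar>s - \<gamma>0\<bar>\<bar> \<le> \<eta> * \<bar>s - t\<bar>" using \<eta>(1) by (intro mult_left_mono) auto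
    moreover have "\<eta> * \<bar>\<bar>t - \<gamma>0\<bar> - \<bar>s - \<gamma>0\<bar>\<bar> = \<bar>\<eta> * \<bar>t - \<gamma>0\<bar> - \<eta> * \<bar>s - \<gamma>0\<bar>\<bar>"
      using \<eta>(1) by (simp add: abs_mult right_diff_distrib[symmetric])
    moreover have "\<bar>max 0 (1 - a) - max 0 (1 - b)\<bar> \<le> \<bar>a - b\<bar>" for a b :: real
      by (simp add: max_def abs_if)
    ultimately have "\<bar>\<tau> t - \<tau> s\<bar> \<le> \<eta> * \<bar>s - t\<bar>" unfolding \<tau>_def by (metis order_trans)
    moreover have "\<bar>\<tau> t - \<tau> s\<bar> \<le> 1" using \<tau>01(1)[of t] \<tau>01(2)[of t] \<tau>01(1)[of s] \<tau>01(2)[of s] by linarith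
    ultimately show ?thesis by simp
  qed
  define P where "P = {\<gamma> \<in> A'. \<tau> \<gamma> \<noteq> 0}"
  have Psub: "P \<subseteq> A' \<inter> {\<gamma>0 - 1 / \<eta>..\<gamma>0 + 1 / \<eta>}"
  proof
    fix \<gamma> assume "\<gamma> \<in> P"
    then have "\<gamma> \<in> A'" "\<eta> * \<bar>\<gamma> - \<gamma>0\<bar> < 1" by (auto simp: P_def \<tau>_def max_def split: if_splits)
    then have "\<gamma> \<in> A'" "\<bar>\<gamma> - \<gamma>0\<bar> \<le> 1 / \<eta>" using \<eta>(1) by (auto simp: field_simps)
    then show "\<gamma> \<in> A' \<inter> {\<gamma>0 - 1 / \<eta>..\<gamma>0 + 1 / \<eta>}" by auto
  qed
  have finP: "finite P" using Psub sep_finite[OF d(2,1)] by (rule finite_subset)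
  have \<gamma>0P: "\<gamma>0 \<in> P" using c by (simp add: P_def \<tau>_def)
  define u where "u \<gamma> = of_real (\<tau> \<gamma>) * c \<gamma>" for \<gamma>
  have uM: "norm (u \<gamma>) \<le> M" if "\<gamma> \<in> A'" for \<gamma>
  proof -
    have "\<tau> \<gamma> * norm (c \<gamma>) \<le> 1 * M" using \<tau>01[of \<gamma>] M(2)[OF that] by (intro mult_mono) auto
    then show ?thesis using \<tau>01[of \<gamma>] by (simp add: u_def norm_mult)
  qed
  have b1: "norm (\<Sum>\<gamma>\<in>P. u \<gamma> * g (y - \<gamma>)) \<le> C * \<kappa> / 4" for y
  proof -
    have s1: "(\<lambda>\<gamma>. u \<gamma> * g (y - \<gamma>)) summable_on A'"
      by (rule abs_summable_summable[OF shift_summable[OF g(1) d(2,1) uM]])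
    have s2: "(\<lambda>\<gamma>. c \<gamma> * g (y - \<gamma>)) summable_on A'"
      by (rule abs_summable_summable[OF shift_summable[OF g(1) d(2,1) M(2)]])
    have "infsum (\<lambda>\<gamma>. of_real (\<tau> y) * (c \<gamma> * g (y - \<gamma>))) A' = of_real (\<tau> y) * shift_series g A' c y"
      unfolding shift_series_def by (rule infsum_cmult_right')
    then have z: "infsum (\<lambda>\<gamma>. of_real (\<tau> y) * (c \<gamma> * g (y - \<gamma>))) A' = 0" using c(4) by simp
    have "(\<Sum>\<gamma>\<in>P. u \<gamma> * g (y - \<gamma>)) = infsum (\<lambda>\<gamma>. u \<gamma> * g (y - \<gamma>)) P"
      using finP by simp
    also have "\<dots> = infsum (\<lambda>\<gamma>. u \<gamma> * g (y - \<gamma>)) A'"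
      by (rule infsum_cong_neutral) (auto simp: P_def u_def)
    also have "\<dots> = infsum (\<lambda>\<gamma>. u \<gamma> * g (y - \<gamma>)) A' - infsum (\<lambda>\<gamma>. of_real (\<tau> y) * (c \<gamma> * g (y - \<gamma>))) A'"
      using z by simp
    also have "\<dots> = infsum (\<lambda>\<gamma>. u \<gamma> * g (y - \<gamma>) - of_real (\<tau> y) * (c \<gamma> * g (y - \<gamma>))) A'"
      using infsum_add[OF s1 summable_on_uminus[THEN iffD2, OF summable_on_cmult_right[OF s2, of "of_real (\<tau> y)"]]]
      by (simp add: infsum_uminus)
    also have "norm \<dots> \<le> infsum (\<lambda>\<gamma>. M * (min 1 (\<eta> * \<bar>y - \<gamma>\<bar>) * norm (g (y - \<gamma>)))) A'"
    proof (rule norm_infsum_le(3)[OF summable_on_cmult_right[OF \<eta>(3)]])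
      fix \<gamma> assume \<gamma>: "\<gamma> \<in> A'"
      have "u \<gamma> * g (y - \<gamma>) - of_real (\<tau> y) * (c \<gamma> * g (y - \<gamma>)) = c \<gamma> * (of_real (\<tau> \<gamma> - \<tau> y) * g (y - \<gamma>))"
        by (simp add: u_def algebra_simps)
      also have "norm \<dots> = norm (c \<gamma>) * (\<bar>\<tau> \<gamma> - \<tau> y\<bar> * norm (g (y - \<gamma>)))"
        by (simp add: norm_mult del: of_real_diff)
      also have "\<dots> \<le> M * (min 1 (\<eta> * \<bar>y - \<gamma>\<bar>) * norm (g (y - \<gamma>)))"
        using M \<gamma> \<tau>lip[of \<gamma> y] by (intro mult_mono) auto
      finally show "norm (u \<gamma> * g (y - \<gamma>) - of_real (\<tau> y) * (c \<gamma> * g (y - \<gamma>))) \<le> \<dots>" .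
    qed
    also have "\<dots> = M * infsum (\<lambda>\<gamma>. min 1 (\<eta> * \<bar>y - \<gamma>\<bar>) * norm (g (y - \<gamma>))) A'"
      by (rule infsum_cmult_right')
    also have "\<dots> \<le> M * (C * \<kappa> / (4 * M))" using M \<eta>(2) by (intro mult_left_mono) auto
    finally show ?thesis using M by simp
  qed
  \<comment> \<open>The budget: a quarter of \<open>C \<kappa>\<close> for the cutoff and a quarter for moving the points, against the lower bound \<open>C \<kappa>\<close>.\<close>
  define e2 where "e2 = C * \<kappa> / (4 * M * real (card P))"
  have cP: "card P > 0" using finP \<gamma>0P by (auto simp: card_gt_0_iff)
  have "e2 > 0" using C \<kappa> M cP by (simp add: e2_def)
  then obtain \<delta> where \<delta>: "\<delta> > 0" "\<And>s t. \<bar>s - t\<bar> < \<delta> \<Longrightarrow> norm (g s - g t) \<le> e2"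
    using amalgam_uniformly_continuous[OF g] by metis
  \<comment> \<open>The tent vanishes at distance \<open>1/\<eta>\<close> from \<open>\<gamma>\<^sub>0\<close>.\<close>
  define R where "R = \<bar>\<gamma>0\<bar> + 1 / \<eta> + 1"
  have R: "R > 0" using \<eta>(1) by (simp add: R_def add_nonneg_pos)
  have "min \<delta> (d / 2) > 0" using \<delta> d by simp
  from wc[unfolded weakly_converges_def, THEN conjunct2, THEN conjunct2, THEN conjunct2,
      rule_format, OF this R]
  obtain l where "A' \<inter> {-R<..<R} \<subseteq> (\<Union>\<gamma>\<in>(\<lambda>\<gamma>. \<gamma> - x l) ` A. ball \<gamma> (min \<delta> (d / 2)))"
    by (elim exE) (blast dest: spec)
  moreover have "P \<subseteq> A' \<inter> {-R<..<R}" using Psub unfolding R_def by force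
  ultimately have "\<forall>\<gamma>\<in>P. \<exists>a\<in>A. \<bar>a - x l - \<gamma>\<bar> < min \<delta> (d / 2)"
    by (fastforce simp: dist_real_def)
  then obtain m where m: "\<And>\<gamma>. \<gamma> \<in> P \<Longrightarrow> m \<gamma> \<in> A" "\<And>\<gamma>. \<gamma> \<in> P \<Longrightarrow> \<bar>m \<gamma> - x l - \<gamma>\<bar> < min \<delta> (d / 2)"
    by metis
  \<comment> \<open>Points are moved by less than half the separation, so no two of them end up at the same place.\<close>
  have injm: "inj_on m P"
  proof (rule inj_onI)
    fix s t assume st: "s \<in> P" "t \<in> P" "m s = m t"
    then have "\<bar>s - t\<bar> < d" using m(2)[of s] m(2)[of t] by linarith
    then show "s = t" using d(2) st by (intro sepD[of d A']) (auto simp: P_def)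
  qed
  define c2 where "c2 t = (if t \<in> m ` P then u (inv_into P m t) else 0)" for t
  have c2m: "c2 (m \<gamma>) = u \<gamma>" if "\<gamma> \<in> P" for \<gamma> using that injm by (simp add: c2_def)
  have c200: "c2 \<in> c00_seqs A"
    unfolding c00_seqs_def using finite_subset[of "{\<gamma> \<in> A. c2 \<gamma> \<noteq> 0}" "m ` P"] finP by (auto simp: c2_def)
  have ser: "shift_series g A c2 y = (\<Sum>\<gamma>\<in>P. u \<gamma> * g (y - m \<gamma>))" for y
  proof -
    have "shift_series g A c2 y = infsum (\<lambda>\<gamma>. c2 \<gamma> * g (y - \<gamma>)) (m ` P)"
      unfolding shift_series_def by (rule infsum_cong_neutral) (use m in \<open>auto simp: c2_def\<close>)
    also have "\<dots> = (\<Sum>\<gamma>\<in>P. c2 (m \<gamma>) * g (y - m \<gamma>))"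
      using finP injm by (simp add: sum.reindex)
    also have "\<dots> = (\<Sum>\<gamma>\<in>P. u \<gamma> * g (y - m \<gamma>))" by (intro sum.cong) (auto simp: c2m)
    finally show ?thesis .
  qed
  have "norm (shift_series g A c2 y) \<le> C * \<kappa> / 2" for y
  proof -
    have "shift_series g A c2 y = (\<Sum>\<gamma>\<in>P. u \<gamma> * g ((y - x l) - \<gamma>)) + (\<Sum>\<gamma>\<in>P. u \<gamma> * (g (y - m \<gamma>) - g ((y - x l) - \<gamma>)))"
      unfolding ser by (simp add: sum.distrib[symmetric] algebra_simps)
    also have "norm \<dots> \<le> C * \<kappa> / 4 + (\<Sum>\<gamma>\<in>P. M * e2)"
    proof (rule norm_triangle_le, rule add_mono[OF b1], rule order_trans[OF norm_sum], rule sum_mono)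
      fix \<gamma> assume \<gamma>: "\<gamma> \<in> P"
      have "norm (g (y - m \<gamma>) - g ((y - x l) - \<gamma>)) \<le> e2" using m(2)[OF \<gamma>] by (intro \<delta>(2)) linarith
      then show "norm (u \<gamma> * (g (y - m \<gamma>) - g ((y - x l) - \<gamma>))) \<le> M * e2"
        using uM \<gamma> M unfolding norm_mult by (intro mult_mono) (auto simp: P_def)
    qed
    also have "(\<Sum>\<gamma>\<in>P. M * e2) = C * \<kappa> / 4" using cP M by (simp add: e2_def)
    finally show ?thesis by simp
  qed
  then have "C * norm (c2 (m \<gamma>0)) \<le> C * \<kappa> / 2"
    using C \<kappa> by (intro C(2)[OF c200 m(1)[OF \<gamma>0P]]) auto
  moreover have "norm (c2 (m \<gamma>0)) = \<kappa>" by (simp add: c2m[OF \<gamma>0P] u_def \<tau>_def \<kappa>_def)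
  ultimately show False using C \<kappa> by simp
qed

section \<open>Spectral parts of a measure with bounded masses\<close>

text \<open>The measure with masses \<open>c\<close>, paired with the transform of \<open>\<eta> e\<^sub>x\<close>. At \<open>x = 0\<close> this is the Fourier transform
  of the measure, evaluated at \<open>\<eta>\<close>; as a function of \<open>x\<close> it is the convolution of the measure with the
  reflected transform of \<open>\<eta>\<close>, that is, its part with frequencies in the support of \<open>\<eta>\<close>.\<close>

definition spectral_part :: "real set \<Rightarrow> (real \<Rightarrow> complex) \<Rightarrow> (real \<Rightarrow> complex) \<Rightarrow> real \<Rightarrow> complex" where
  "spectral_part \<Gamma> c \<eta> x = (\<Sum>\<^sub>\<infinity>\<gamma>\<in>\<Gamma>. c \<gamma> * fourier \<eta> (\<gamma> - x))"

locale bounded_masses =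
  fixes \<Gamma> :: "real set" and c :: "real \<Rightarrow> complex" and d M :: real
  assumes sep\<Gamma>: "sep d \<Gamma>" and d: "d > 0" and M: "M > 0"
    and cM: "\<And>\<gamma>. \<gamma> \<in> \<Gamma> \<Longrightarrow> norm (c \<gamma>) \<le> M"
begin

abbreviation sp :: "(real \<Rightarrow> complex) \<Rightarrow> real \<Rightarrow> complex" where
  "sp \<equiv> spectral_part \<Gamma> c"

lemma reflected_amalgam:
  assumes "\<eta> \<in> test_functions"
  shows "amalgam (\<lambda>t. fourier \<eta> (- t))"
proof -
  obtain C where "\<And>x. norm (fourier \<eta> x) \<le> C / (1 + x\<^sup>2)"
    using fourier_test_function_square_decay[OF assms] by blast
  then have "norm (fourier \<eta> (- t)) * (1 + t\<^sup>2) \<le> C" for t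
    using pos_le_divide_eq[of "1 + t\<^sup>2" "norm (fourier \<eta> (- t))" C] by (metis add_pos_nonneg power2_minus zero_le_power2 zero_less_one)
  then show ?thesis by (rule decay_amalgam)
qed

lemma sp_eq_shift_series: "sp \<eta> = shift_series (\<lambda>t. fourier \<eta> (- t)) \<Gamma> c"
  by (simp add: fun_eq_iff spectral_part_def shift_series_def)

lemma sp_summable:
  assumes "\<eta> \<in> test_functions"
  shows "(\<lambda>\<gamma>. norm (c \<gamma> * fourier \<eta> (\<gamma> - x))) summable_on \<Gamma>"
  using shift_summable[OF reflected_amalgam[OF assms] sep\<Gamma> d, of c M x] cM by simp

lemma sp_abs_bounded:
  assumes "\<eta> \<in> test_functions"
  shows "\<exists>B. \<forall>x. infsum (\<lambda>\<gamma>. norm (c \<gamma> * fourier \<eta> (\<gamma> - x))) \<Gamma> \<le> B"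
proof (rule shift_bound[OF reflected_amalgam[OF assms] d])
  fix K assume K:
    "\<And>A (c :: real \<Rightarrow> complex) M x. sep d A \<Longrightarrow> M \<ge> 0 \<Longrightarrow> (\<And>\<gamma>. \<gamma> \<in> A \<Longrightarrow> norm (c \<gamma>) \<le> M) \<Longrightarrow>
     infsum (\<lambda>\<gamma>. norm (c \<gamma> * fourier \<eta> (- (x - \<gamma>)))) A \<le> M * K"
  have "infsum (\<lambda>\<gamma>. norm (c \<gamma> * fourier \<eta> (\<gamma> - x))) \<Gamma> \<le> M * K" for x
    using K[of \<Gamma> M c x, OF sep\<Gamma> less_imp_le[OF M] cM] by simp
  then show ?thesis by (intro exI[of _ "M * K"] allI)
qed

lemma sp_bounded:
  assumes "\<eta> \<in> test_functions"
  shows "\<exists>B. \<forall>x. norm (sp \<eta> x) \<le> B"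
proof -
  obtain B where B: "\<forall>x. infsum (\<lambda>\<gamma>. norm (c \<gamma> * fourier \<eta> (\<gamma> - x))) \<Gamma> \<le> B"
    using sp_abs_bounded[OF assms] by (elim exE)
  have "norm (sp \<eta> x) \<le> B" for x
    using norm_infsum_bound[OF sp_summable[OF assms, of x]] B[THEN spec, of x]
    unfolding spectral_part_def by (rule order_trans)
  then show ?thesis by blast
qed

lemma sp_continuous:
  assumes "\<eta> \<in> test_functions"
  shows "continuous_on UNIV (sp \<eta>)"
  unfolding sp_eq_shift_series
proof (rule shift_series_continuous[OF reflected_amalgam[OF assms] _ sep\<Gamma> d cM])
  show "continuous_on UNIV (\<lambda>t. fourier \<eta> (- t))"
    by (intro continuous_on_compose2[OF fourier_test_function_continuous[OF assms, of UNIV]] continuous_intros) auto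
qed

lemma sp_chr_mult:
  assumes "\<eta> \<in> test_functions"
  shows "sp (\<lambda>t. \<eta> t * chr x t) y = sp \<eta> (x + y)"
  unfolding spectral_part_def fourier_chr_mult[OF test_function_borel[OF assms]]
  by (simp add: algebra_simps)

lemma sp_add:
  assumes "\<eta> \<in> test_functions" "\<zeta> \<in> test_functions"
  shows "sp (\<lambda>t. \<eta> t + \<zeta> t) x = sp \<eta> x + sp \<zeta> x"
proof -
  have "fourier (\<lambda>t. \<eta> t + \<zeta> t) y = fourier \<eta> y + fourier \<zeta> y" for y
  proof -
    have "(\<lambda>t. \<eta> t + \<zeta> t) \<in> test_functions" by (intro test_function_add assms)
    then have "fourier (\<lambda>t. \<eta> t + \<zeta> t) y = (LBINT t. chr (- y) t * \<eta> t + chr (- y) t * \<zeta> t)"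
      by (simp add: fourier_eq_lborel test_function_borel algebra_simps)
    also have "\<dots> = (LBINT t. chr (- y) t * \<eta> t) + (LBINT t. chr (- y) t * \<zeta> t)"
      by (intro Bochner_Integration.integral_add integrable_chr_mult test_function_integrable assms)
    finally show ?thesis using assms by (simp add: fourier_eq_lborel test_function_borel)
  qed
  then have "sp (\<lambda>t. \<eta> t + \<zeta> t) x = (\<Sum>\<^sub>\<infinity>\<gamma>\<in>\<Gamma>. c \<gamma> * fourier \<eta> (\<gamma> - x) + c \<gamma> * fourier \<zeta> (\<gamma> - x))"
    unfolding spectral_part_def by (simp add: distrib_left)
  also have "\<dots> = sp \<eta> x + sp \<zeta> x"
    unfolding spectral_part_def
    by (intro infsum_add abs_summable_summable[OF sp_summable] assms)
  finally show ?thesis .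
qed

lemma sp_zero: "sp (\<lambda>t. 0) x = 0"
proof -
  have "fourier (\<lambda>t. 0) y = 0" for y by (simp add: fourier_eq_lborel)
  then show ?thesis by (simp add: spectral_part_def)
qed

lemma sp_sum:
  "finite I \<Longrightarrow> (\<And>i. i \<in> I \<Longrightarrow> f i \<in> test_functions) \<Longrightarrow> sp (\<lambda>t. \<Sum>i\<in>I. f i t) x = (\<Sum>i\<in>I. sp (f i) x)"
proof (induction I rule: finite_induct)
  case (insert i I)
  then show ?case using sp_add[of "f i" "\<lambda>t. \<Sum>i\<in>I. f i t"] test_function_sum[of I f] by simp
qed (simp add: sp_zero)

text \<open>Filtering by the product \<open>\<eta> v\<close> amounts to averaging the part filtered by \<open>\<eta>\<close> against the transform of
  \<open>v\<close>. With \<open>v = 1\<close> on the support of \<open>\<eta>\<close> this is a reproducing formula.\<close>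

lemma sp_mult:
  assumes \<eta>: "\<eta> \<in> test_functions" and v: "v \<in> test_functions"
  shows "sp (\<lambda>t. \<eta> t * v t) x = (LBINT y. fourier v y * sp \<eta> (x + y))"
proof -
  obtain B where "\<forall>x. infsum (\<lambda>\<gamma>. norm (c \<gamma> * fourier \<eta> (\<gamma> - x))) \<Gamma> \<le> B"
    using sp_abs_bounded[OF \<eta>] by (elim exE)
  note B = this[rule_format]
  have [measurable]: "fourier v \<in> borel_measurable borel" "fourier \<eta> \<in> borel_measurable borel"
    by (intro fourier_test_function_borel \<eta> v)+
  have "(LBINT y. fourier v y * sp \<eta> (x + y)) =
      (\<Sum>\<^sub>\<infinity>\<gamma>\<in>\<Gamma>. LBINT y. fourier v y * (c \<gamma> * fourier \<eta> (\<gamma> - (x + y))))"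
    unfolding spectral_part_def
    by (rule integral_mult_infsum_swap[OF sep_countable[OF sep\<Gamma> d]
          fourier_test_function_integrable[OF v] _ sp_summable[OF \<eta>] B]) measurable
  moreover have "(LBINT y. fourier v y * (c \<gamma> * fourier \<eta> (\<gamma> - (x + y)))) = c \<gamma> * fourier (\<lambda>t. \<eta> t * v t) (\<gamma> - x)" for \<gamma>
  proof -
    have "(LBINT y. fourier v y * (c \<gamma> * fourier \<eta> (\<gamma> - (x + y)))) =
        (LBINT y. c \<gamma> * (fourier v y * fourier \<eta> ((\<gamma> - x) - y)))"
      by (simp add: algebra_simps)
    then show ?thesis
      unfolding fourier_mult_test_functions[OF \<eta> v] by simp
  qed
  ultimately show ?thesis unfolding spectral_part_def[of \<Gamma> c "\<lambda>t. \<eta> t * v t"] by simp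
qed

text \<open>Both sides are \<open>\<mu>\<close> convolved with \<open>G\<close> and with the reflected transform of \<open>\<eta>\<close>, in different orders.\<close>

lemma convolution_identity:
  assumes G: "amalgam G" "continuous_on UNIV G" and \<eta>: "\<eta> \<in> test_functions"
  shows "(LBINT y. fourier \<eta> (y - x) * shift_series G \<Gamma> c y) = (LBINT u. G u * sp \<eta> (x - u))"
proof -
  obtain B where "\<forall>x. infsum (\<lambda>\<gamma>. norm (c \<gamma> * fourier \<eta> (\<gamma> - x))) \<Gamma> \<le> B"
    using sp_abs_bounded[OF \<eta>] by (elim exE)
  note B = this[rule_format]
  obtain K where K: "K > 0" "\<And>y. infsum (\<lambda>\<gamma>. norm (c \<gamma> * G (y - \<gamma>))) \<Gamma> \<le> M * K"
    using shift_bound[OF G(1) d] sep\<Gamma> cM less_imp_le[OF M] by metis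
  have Gm [measurable]: "G \<in> borel_measurable borel" by (intro borel_measurable_continuous_onI G)
  have Gi: "integrable lborel G" by (rule amalgam_integrable[OF G(1) Gm])
  have \<eta>m [measurable]: "fourier \<eta> \<in> borel_measurable borel" by (intro fourier_test_function_borel \<eta>)
  have \<eta>i: "integrable lborel (\<lambda>y. fourier \<eta> (y - x))"
    using lborel_integrable_real_affine[OF fourier_test_function_integrable[OF \<eta>], of 1 "-x"] by simp
  have cnt: "countable \<Gamma>" by (rule sep_countable[OF sep\<Gamma> d])
  have Gs: "(\<lambda>\<gamma>. norm (c \<gamma> * G (y - \<gamma>))) summable_on \<Gamma>" for y
    by (rule shift_summable[OF G(1) sep\<Gamma> d cM])
  have "(LBINT y. fourier \<eta> (y - x) * shift_series G \<Gamma> c y) =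
      (\<Sum>\<^sub>\<infinity>\<gamma>\<in>\<Gamma>. LBINT y. fourier \<eta> (y - x) * (c \<gamma> * G (y - \<gamma>)))"
    unfolding shift_series_def
    by (rule integral_mult_infsum_swap[OF cnt \<eta>i _ Gs K(2)]) measurable
  also have "\<dots> = (\<Sum>\<^sub>\<infinity>\<gamma>\<in>\<Gamma>. LBINT u. G u * (c \<gamma> * fourier \<eta> (\<gamma> - (x - u))))"
  proof (rule infsum_cong)
    fix \<gamma>
    have "(LBINT y. fourier \<eta> (y - x) * (c \<gamma> * G (y - \<gamma>))) =
        \<bar>1\<bar> *\<^sub>R (LBINT u. fourier \<eta> ((\<gamma> + 1 * u) - x) * (c \<gamma> * G ((\<gamma> + 1 * u) - \<gamma>)))"
      by (rule lborel_integral_real_affine) simp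
    also have "\<dots> = (LBINT u. G u * (c \<gamma> * fourier \<eta> (\<gamma> - (x - u))))"
      by (simp add: algebra_simps)
    finally show "(LBINT y. fourier \<eta> (y - x) * (c \<gamma> * G (y - \<gamma>))) = \<dots>" .
  qed
  also have "\<dots> = (LBINT u. G u * sp \<eta> (x - u))"
    unfolding spectral_part_def
    by (rule integral_mult_infsum_swap[OF cnt Gi _ sp_summable[OF \<eta>] B, symmetric]) measurable
  finally show ?thesis .
qed

end

section \<open>Bernstein's inequality\<close>

text \<open>Its integral is 1 and its transform is 1 near the origin: dilates of it reproduce band-limited
  functions.\<close>

definition kernel :: "real \<Rightarrow> complex" where "kernel = fourier plateau"

definition kernel_modulus :: "real \<Rightarrow> real" where
  "kernel_modulus h = (LBINT z. norm (kernel (z - h) - kernel z))"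

lemma kernel_borel [measurable]: "kernel \<in> borel_measurable borel"
  unfolding kernel_def by (intro fourier_test_function_borel plateau_test_function)

lemma kernel_integrable: "integrable lborel kernel"
  unfolding kernel_def by (intro fourier_test_function_integrable plateau_test_function)

lemma kernel_shift_integrable: "integrable lborel (\<lambda>z. kernel (z - h))"
  using lborel_integrable_real_affine[OF kernel_integrable, of 1 "-h"] by simp

lemma kernel_modulus_borel [measurable]: "kernel_modulus \<in> borel_measurable borel"
  unfolding kernel_modulus_def by measurable

lemma kernel_modulus_bounds: "0 \<le> kernel_modulus h" "kernel_modulus h \<le> 2 * (LBINT z. norm (kernel z))"
proof -
  show "0 \<le> kernel_modulus h" unfolding kernel_modulus_def by simp
  have "kernel_modulus h \<le> (LBINT z. norm (kernel (z - h)) + norm (kernel z))"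
    unfolding kernel_modulus_def
    by (intro integral_mono integrable_norm Bochner_Integration.integrable_diff Bochner_Integration.integrable_add
        kernel_integrable kernel_shift_integrable norm_triangle_ineq4)
  also have "\<dots> = (LBINT z. norm (kernel (z - h))) + (LBINT z. norm (kernel z))"
    by (intro Bochner_Integration.integral_add integrable_norm kernel_integrable kernel_shift_integrable)
  also have "(LBINT z. norm (kernel (z - h))) = (LBINT z. norm (kernel z))"
    using lborel_integral_real_affine[of 1 "\<lambda>z. norm (kernel z)" "-h"] by simp
  finally show "kernel_modulus h \<le> 2 * (LBINT z. norm (kernel z))" by simp
qed

lemma kernel_modulus_tendsto_0:
  assumes "X \<longlonglongrightarrow> 0"
  shows "(\<lambda>n. kernel_modulus (X n)) \<longlonglongrightarrow> 0"
proof -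
  obtain C where C: "C \<ge> 0" "\<And>x. norm (kernel x) \<le> C / (1 + x\<^sup>2)"
    unfolding kernel_def using fourier_test_function_square_decay[OF plateau_test_function] by blast
  obtain N where N: "\<And>n. n \<ge> N \<Longrightarrow> \<bar>X n\<bar> < 1"
    using assms[unfolded LIMSEQ_def, rule_format, of 1] by (auto simp: dist_real_def)
  have shifted: "norm (kernel (z - h)) \<le> 3 * C / (1 + z\<^sup>2)" if "\<bar>h\<bar> < 1" for z h
  proof -
    have "h\<^sup>2 \<le> 1" using that by (simp add: abs_square_le_1)
    moreover have "0 \<le> 2 * (z - 3 / 2 * h)\<^sup>2" by simp
    ultimately have "1 + z\<^sup>2 \<le> 3 * (1 + (z - h)\<^sup>2)"
      by (simp add: power2_eq_square algebra_simps)
    then have "C * (1 + z\<^sup>2) \<le> C * (3 * (1 + (z - h)\<^sup>2))" using C(1) by (rule mult_left_mono)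
    then have "C / (1 + (z - h)\<^sup>2) \<le> 3 * C / (1 + z\<^sup>2)"
      by (subst divide_le_eq) (simp_all add: add_pos_nonneg pos_le_divide_eq mult_ac)
    with C(2)[of "z - h"] show ?thesis by linarith
  qed
  have "(\<lambda>n. LBINT z. norm (kernel (z - X (n + N)) - kernel z)) \<longlonglongrightarrow> (LBINT z :: real. 0 :: real)"
  proof (rule integral_dominated_convergence[where w = "\<lambda>z. 4 * C / (1 + z\<^sup>2)"])
    show "AE z in lborel. (\<lambda>n. norm (kernel (z - X (n + N)) - kernel z)) \<longlonglongrightarrow> 0"
    proof (rule AE_I2)
      fix z
      have "(\<lambda>n. z - X (n + N)) \<longlonglongrightarrow> z - 0"
        by (intro tendsto_intros LIMSEQ_ignore_initial_segment assms)
      then have "(\<lambda>n. kernel (z - X (n + N))) \<longlonglongrightarrow> kernel (z - 0)"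
        using fourier_test_function_continuous[OF plateau_test_function, of UNIV] unfolding kernel_def
        by (intro isCont_tendsto_compose[of _ "fourier plateau"]) (simp_all add: continuous_on_eq_continuous_at)
      then have "(\<lambda>n. norm (kernel (z - X (n + N)) - kernel z)) \<longlonglongrightarrow> norm (kernel (z - 0) - kernel z)"
        by (intro tendsto_intros)
      then show "(\<lambda>n. norm (kernel (z - X (n + N)) - kernel z)) \<longlonglongrightarrow> 0" by simp
    qed
    show "AE z in lborel. norm (norm (kernel (z - X (n + N)) - kernel z)) \<le> 4 * C / (1 + z\<^sup>2)" for n
    proof (rule AE_I2)
      fix z
      have "norm (kernel (z - X (n + N)) - kernel z) \<le> norm (kernel (z - X (n + N))) + norm (kernel z)"
        by (rule norm_triangle_ineq4)
      also have "\<dots> \<le> 3 * C / (1 + z\<^sup>2) + C / (1 + z\<^sup>2)"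
        by (intro add_mono shifted C N) simp
      finally show "norm (norm (kernel (z - X (n + N)) - kernel z)) \<le> 4 * C / (1 + z\<^sup>2)"
        by (simp add: add_divide_distrib[symmetric])
    qed
    show "integrable lborel (\<lambda>z. 4 * C / (1 + z\<^sup>2))" by (rule integrable_inverse_square)
  qed measurable
  then have "(\<lambda>n. kernel_modulus (X (n + N))) \<longlonglongrightarrow> 0" by (simp add: kernel_modulus_def)
  then show ?thesis by (rule LIMSEQ_offset)
qed

context bounded_masses begin

text \<open>The demodulated function \<open>H(x) = exp(-2\<pi>it\<^sub>0x) F(x)\<close> has frequencies in \<open>[-\<delta>, \<delta>]\<close>, where the dilated plateau
  is 1, and is therefore reproduced by the kernel at scale \<open>1/\<delta>\<close>. Its variation over a distance \<open>u\<close> is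
  at most \<open>B\<close> times the \<open>L\<^sup>1\<close> modulus of continuity of the kernel at \<open>\<delta>u\<close>.\<close>

lemma bernstein:
  assumes \<eta>: "\<eta> \<in> test_functions" and \<delta>: "\<delta> > 0"
    and supp: "\<And>t. \<bar>t - t0\<bar> > \<delta> \<Longrightarrow> \<eta> t = 0" and B: "\<And>x. norm (sp \<eta> x) \<le> B"
  shows "norm (chr (- x) t0 * sp \<eta> x - chr (- x') t0 * sp \<eta> x') \<le> B * kernel_modulus (\<delta> * (x - x'))"
proof -
  define H where "H x = chr (- x) t0 * sp \<eta> x" for x
  have HB: "norm (H x) \<le> B" for x using B by (simp add: H_def norm_mult)
  have B0: "B \<ge> 0" using B[of 0] norm_ge_zero order_trans by blast
  have [measurable]: "H \<in> borel_measurable borel"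
    unfolding H_def by (intro borel_measurable_continuous_onI continuous_intros sp_continuous \<eta>)
  have rep: "H x = (LBINT z. kernel (z - \<delta> * x) * H (z / \<delta>))" for x
  proof -
    let ?v = "\<lambda>t. plateau ((t - t0) / \<delta>)"
    have v: "?v \<in> test_functions" by (rule plateau_scaled_test_function[OF \<delta>])
    have "\<eta> = (\<lambda>t. \<eta> t * ?v t)"
    proof
      fix t show "\<eta> t = \<eta> t * ?v t"
        using supp[of t] \<delta> by (cases "\<bar>t - t0\<bar> > \<delta>") (auto simp: plateau_1 abs_divide)
    qed
    then have "sp \<eta> x = (LBINT y. fourier ?v y * sp \<eta> (x + y))"
      using sp_mult[OF \<eta> v, of x] by simp
    then have "H x = (LBINT y. chr (- x) t0 * (fourier ?v y * sp \<eta> (x + y)))"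
      by (simp add: H_def)
    also have "\<dots> = (LBINT y. of_real \<delta> * (kernel (\<delta> * y) * H (x + y)))"
    proof (rule Bochner_Integration.integral_cong[OF refl])
      fix y
      have "chr (- (x + y)) t0 = chr (- x) t0 * chr (- y) t0"
        using chr_add_left[of "-x" "-y" t0] by simp
      then show "chr (- x) t0 * (fourier ?v y * sp \<eta> (x + y)) = of_real \<delta> * (kernel (\<delta> * y) * H (x + y))"
        unfolding fourier_dilate[OF test_function_borel[OF plateau_test_function] \<delta>] H_def kernel_def
        by (simp only: mult_ac)
    qed
    also have "\<dots> = of_real \<delta> * (LBINT y. kernel (\<delta> * y) * H (x + y))" by simp
    also have "(LBINT y. kernel (\<delta> * y) * H (x + y)) =
        \<bar>1 / \<delta>\<bar> *\<^sub>R (LBINT z. kernel (\<delta> * (- x + 1 / \<delta> * z)) * H (x + (- x + 1 / \<delta> * z)))"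
      by (rule lborel_integral_real_affine) (use \<delta> in simp)
    also have "(LBINT z. kernel (\<delta> * (- x + 1 / \<delta> * z)) * H (x + (- x + 1 / \<delta> * z))) =
        (LBINT z. kernel (z - \<delta> * x) * H (z / \<delta>))"
      using \<delta> by (intro Bochner_Integration.integral_cong) (simp_all add: algebra_simps)
    finally show ?thesis using \<delta> by (simp add: scaleR_conv_of_real)
  qed
  have int: "integrable lborel (\<lambda>z. kernel (z - \<delta> * x) * H (z / \<delta>))" for x
  proof (rule Bochner_Integration.integrable_bound)
    show "integrable lborel (\<lambda>z. B *\<^sub>R kernel (z - \<delta> * x))" using kernel_shift_integrable by auto
    show "AE z in lborel. norm (kernel (z - \<delta> * x) * H (z / \<delta>)) \<le> norm (B *\<^sub>R kernel (z - \<delta> * x))"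
      using HB B0 by (auto simp: norm_mult mult.commute[of "norm (kernel _)"] intro!: AE_I2 mult_right_mono)
  qed measurable
  have "norm (H x - H x') = norm (LBINT z. kernel (z - \<delta> * x) * H (z / \<delta>) - kernel (z - \<delta> * x') * H (z / \<delta>))"
    unfolding rep[of x] rep[of x'] by (subst Bochner_Integration.integral_diff[OF int int]) simp
  also have "\<dots> \<le> (LBINT z. norm (kernel (z - \<delta> * x) * H (z / \<delta>) - kernel (z - \<delta> * x') * H (z / \<delta>)))"
    by (rule integral_norm_bound)
  also have "\<dots> \<le> (LBINT z. B * norm (kernel (z - \<delta> * x) - kernel (z - \<delta> * x')))"
  proof (rule integral_mono)
    show "integrable lborel (\<lambda>z. norm (kernel (z - \<delta> * x) * H (z / \<delta>) - kernel (z - \<delta> * x') * H (z / \<delta>)))"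
      by (intro integrable_norm Bochner_Integration.integrable_diff int)
    show "integrable lborel (\<lambda>z. B * norm (kernel (z - \<delta> * x) - kernel (z - \<delta> * x')))"
      by (intro integrable_mult_right integrable_norm Bochner_Integration.integrable_diff kernel_shift_integrable)
    show "norm (kernel (z - \<delta> * x) * H (z / \<delta>) - kernel (z - \<delta> * x') * H (z / \<delta>)) \<le>
        B * norm (kernel (z - \<delta> * x) - kernel (z - \<delta> * x'))" for z
      unfolding left_diff_distrib[symmetric] norm_mult mult.commute[of _ "norm (H _)"]
      by (intro mult_right_mono HB) simp
  qed
  also have "\<dots> = B * (LBINT z. norm (kernel (z - \<delta> * x) - kernel (z - \<delta> * x')))" by simp
  also have "(LBINT z. norm (kernel (z - \<delta> * x) - kernel (z - \<delta> * x'))) =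
      \<bar>1\<bar> *\<^sub>R (LBINT z. norm (kernel ((\<delta> * x' + 1 * z) - \<delta> * x) - kernel ((\<delta> * x' + 1 * z) - \<delta> * x')))"
    by (rule lborel_integral_real_affine) simp
  also have "\<dots> = kernel_modulus (\<delta> * (x - x'))"
    unfolding kernel_modulus_def by (simp add: algebra_simps)
  finally show ?thesis unfolding H_def .
qed

end

section \<open>The spectrum of a measure with vanishing series\<close>

lemma compact_lower_bound:
  assumes "compact K" "continuous_on UNIV f" "\<And>t. t \<in> K \<Longrightarrow> f t \<noteq> 0"
  shows "\<exists>m>0. \<forall>t\<in>K. m \<le> norm (f t :: complex)"
proof (cases "K = {}")
  case False
  have "continuous_on K (\<lambda>t. norm (f t))" by (intro continuous_intros continuous_on_subset[OF assms(2)]) auto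
  from continuous_attains_inf[OF assms(1) False this]
  obtain t where "t \<in> K" "\<And>s. s \<in> K \<Longrightarrow> norm (f t) \<le> norm (f s)" by blast
  then show ?thesis using assms(3) by (intro exI[of _ "norm (f t)"]) auto
qed (auto intro: exI[of _ 1])

context bounded_masses begin

text \<open>With \<open>H(x) = exp(-2\<pi>it\<^sub>0x) F(x)\<close>, the identity \<open>F * G = 0\<close> says that the transform of \<open>G\<close> at \<open>t\<^sub>0\<close> times
  \<open>H(x)\<close> equals the integral of \<open>G(u) exp(-2\<pi>it\<^sub>0u) (H(x) - H(x - u))\<close>. By Bernstein's inequality this is at most
  \<open>I(\<delta>)\<close> times the supremum of \<open>|H|\<close>, where \<open>I(\<delta>)\<close> tends to 0 with \<open>\<delta>\<close>. Once \<open>I(\<delta>) < m/2\<close>, the supremum is at most half of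
  itself. The scale \<open>\<delta>\<close> depends on \<open>m\<close> only, which makes a partition of unity possible.\<close>

lemma spectral_part_vanishes_locally:
  assumes G: "amalgam G" "continuous_on UNIV G"
    and zero: "\<And>x. shift_series G \<Gamma> c x = 0" and m: "m > 0"
  obtains \<delta> where "\<delta> > 0"
    "\<And>t0 \<eta> x. \<eta> \<in> test_functions \<Longrightarrow> m \<le> norm (fourier G t0) \<Longrightarrow>
       (\<And>t. \<bar>t - t0\<bar> > \<delta> \<Longrightarrow> \<eta> t = 0) \<Longrightarrow> sp \<eta> x = 0"
proof -
  have Gm [measurable]: "G \<in> borel_measurable borel" by (intro borel_measurable_continuous_onI G)
  have Gi: "integrable lborel G" by (rule amalgam_integrable[OF G(1) Gm])
  define I where "I \<delta> = (LBINT u. norm (G u) * kernel_modulus (\<delta> * u))" for \<delta>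
  let ?N = "2 * (LBINT z. norm (kernel z))"
  have Ii: "integrable lborel (\<lambda>u. norm (G u) * kernel_modulus (\<delta> * u))" for \<delta>
  proof (rule Bochner_Integration.integrable_bound)
    show "integrable lborel (\<lambda>u. norm (G u) * ?N)" using Gi by auto
    show "AE u in lborel. norm (norm (G u) * kernel_modulus (\<delta> * u)) \<le> norm (norm (G u) * ?N)"
      using kernel_modulus_bounds by (auto simp: abs_mult intro!: AE_I2 mult_left_mono)
  qed measurable
  have "(\<lambda>n. I (1 / real (Suc n))) \<longlonglongrightarrow> (LBINT u :: real. 0 :: real)"
    unfolding I_def
  proof (rule integral_dominated_convergence[where w = "\<lambda>u. norm (G u) * ?N"])
    show "AE u in lborel. (\<lambda>n. norm (G u) * kernel_modulus (1 / real (Suc n) * u)) \<longlonglongrightarrow> 0"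
    proof (intro AE_I2 tendsto_mult_right_zero kernel_modulus_tendsto_0 tendsto_mult_left_zero)
      show "(\<lambda>n. 1 / real (Suc n)) \<longlonglongrightarrow> 0"
        using LIMSEQ_inverse_real_of_nat by (simp add: inverse_eq_divide)
    qed
    show "AE u in lborel. norm (norm (G u) * kernel_modulus (1 / real (Suc n) * u)) \<le> norm (G u) * ?N" for n
      using kernel_modulus_bounds by (auto simp: abs_mult intro!: AE_I2 mult_left_mono)
    show "integrable lborel (\<lambda>u. norm (G u) * ?N)" using Gi by auto
  qed measurable
  then have "\<forall>\<^sub>F n in sequentially. I (1 / real (Suc n)) < m / 2"
    by (rule order_tendstoD) (use m in simp)
  then obtain n where n: "I (1 / real (Suc n)) < m / 2"
    by (auto simp: eventually_sequentially)
  define \<delta> where "\<delta> = 1 / real (Suc n)"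
  have \<delta>: "\<delta> > 0" "I \<delta> < m / 2" using n by (auto simp: \<delta>_def)
  show ?thesis
  proof (rule that[OF \<delta>(1)])
    fix t0 \<eta> x
    assume \<eta>: "\<eta> \<in> test_functions" and mt0: "m \<le> norm (fourier G t0)"
      and supp: "\<And>t. \<bar>t - t0\<bar> > \<delta> \<Longrightarrow> \<eta> t = 0"
    define H where "H x = chr (- x) t0 * sp \<eta> x" for x
    have normH: "norm (H x) = norm (sp \<eta> x)" for x by (simp add: H_def norm_mult)
    have [measurable]: "H \<in> borel_measurable borel"
      unfolding H_def by (intro borel_measurable_continuous_onI continuous_intros sp_continuous \<eta>)
    have chrm [measurable]: "(\<lambda>u. chr (- u) t0) \<in> borel_measurable borel"
      by (intro borel_measurable_continuous_onI continuous_intros)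
    obtain B0 where B0: "\<And>x. norm (sp \<eta> x) \<le> B0" using sp_bounded[OF \<eta>] by metis
    define B where "B = (SUP x. norm (sp \<eta> x))"
    have bdd: "bdd_above (range (\<lambda>x. norm (sp \<eta> x)))" using B0 by (auto simp: bdd_above_def)
    have B: "norm (sp \<eta> x) \<le> B" for x unfolding B_def by (rule cSUP_upper[OF _ bdd]) simp
    have B0': "B \<ge> 0" using B[of 0] norm_ge_zero order_trans by blast
    have GH: "integrable lborel (\<lambda>u. G u * chr (- u) t0 * H (x - u))" for x
    proof (rule Bochner_Integration.integrable_bound)
      show "integrable lborel (\<lambda>u. B *\<^sub>R G u)" using Gi by auto
      show "AE u in lborel. norm (G u * chr (- u) t0 * H (x - u)) \<le> norm (B *\<^sub>R G u)"
        using B B0' by (auto simp: norm_mult normH mult.commute[of "norm (G _)"] intro!: AE_I2 mult_right_mono)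
    qed measurable
    have GH0: "integrable lborel (\<lambda>u. G u * chr (- u) t0 * z)" for z
      using integrable_chr_mult[OF Gi, of "- t0"] by (auto simp: mult.commute[of "G _"] chr_minus chr_commute[of t0])
    \<comment> \<open>The transform of \<open>G\<close> at \<open>t\<^sub>0\<close> has modulus at least \<open>m\<close>, while the right-hand side of the identity below is at most \<open>B m / 2\<close>.\<close>
    have half: "norm (sp \<eta> x) \<le> B / 2" for x
    proof -
      have "(LBINT u. G u * sp \<eta> (x - u)) = 0"
        using convolution_identity[OF G \<eta>, of x] zero by simp
      moreover have "G u * chr (- u) t0 * H (x - u) = chr (- x) t0 * (G u * sp \<eta> (x - u))" for u
        using chr_add_left[of "- u" "- (x - u)" t0] unfolding H_def by simp
      then have "(LBINT u. G u * chr (- u) t0 * H (x - u)) = (LBINT u. chr (- x) t0 * (G u * sp \<eta> (x - u)))"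
        by (simp only:)
      ultimately have z: "(LBINT u. G u * chr (- u) t0 * H (x - u)) = 0" by simp
      have "fourier G t0 * H x = (LBINT u. G u * chr (- u) t0 * H x)"
        unfolding fourier_eq_lborel[OF Gm]
        by (subst integral_mult_left_zero[symmetric])
           (intro Bochner_Integration.integral_cong, auto simp: chr_minus chr_commute[of t0] mult_ac)
      also have "\<dots> = (LBINT u. G u * chr (- u) t0 * H x - G u * chr (- u) t0 * H (x - u))"
        using z by (subst Bochner_Integration.integral_diff[OF GH0 GH]) simp
      finally have diff: "fourier G t0 * H x =
          (LBINT u. G u * chr (- u) t0 * H x - G u * chr (- u) t0 * H (x - u))" .
      have "norm (fourier G t0 * H x) \<le>
          (LBINT u. norm (G u * chr (- u) t0 * H x - G u * chr (- u) t0 * H (x - u)))"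
        unfolding diff by (rule integral_norm_bound)
      also have "\<dots> \<le> (LBINT u. B * (norm (G u) * kernel_modulus (\<delta> * u)))"
      proof (rule integral_mono)
        show "integrable lborel (\<lambda>u. norm (G u * chr (- u) t0 * H x - G u * chr (- u) t0 * H (x - u)))"
          by (intro integrable_norm Bochner_Integration.integrable_diff GH GH0)
        show "integrable lborel (\<lambda>u. B * (norm (G u) * kernel_modulus (\<delta> * u)))" using Ii by auto
        fix u
        have "norm (H x - H (x - u)) \<le> B * kernel_modulus (\<delta> * u)"
          using bernstein[where ?t0.0 = t0 and x = x and x' = "x - u", OF \<eta> \<delta>(1) supp B] by (simp add: H_def)
        then have "norm (G u) * norm (H x - H (x - u)) \<le> norm (G u) * (B * kernel_modulus (\<delta> * u))"
          by (rule mult_left_mono) simp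
        then show "norm (G u * chr (- u) t0 * H x - G u * chr (- u) t0 * H (x - u)) \<le>
            B * (norm (G u) * kernel_modulus (\<delta> * u))"
          unfolding right_diff_distrib[symmetric] norm_mult by (simp add: mult_ac)
      qed
      also have "\<dots> = B * I \<delta>" by (simp add: I_def)
      also have "\<dots> \<le> B * (m / 2)" using \<delta>(2) B0' by (intro mult_left_mono) auto
      finally have "m * norm (sp \<eta> x) \<le> B * (m / 2)"
        using mult_right_mono[OF mt0, of "norm (sp \<eta> x)"] by (simp add: norm_mult normH)
      then show ?thesis using m by (simp add: field_simps)
    qed
    have "B \<le> B / 2" unfolding B_def by (rule cSUP_least) (use half B_def in auto)
    then have "B = 0" using B0' by simp
    then show "sp \<eta> x = 0" using B[of x] by simp
  qed
qed

text \<open>The test function is cut into pieces by a partition of unity at the scale of the previous lemma. The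
  partition consists of differences of consecutive translates of the smooth step, whose sum telescopes.\<close>

lemma spectral_part_vanishes_off_zeros:
  assumes G: "amalgam G" "continuous_on UNIV G"
    and zero: "\<And>x. shift_series G \<Gamma> c x = 0"
    and \<eta>: "\<eta> \<in> test_functions" and m: "m > 0"
    and low: "\<And>t. \<eta> t \<noteq> 0 \<Longrightarrow> m \<le> norm (fourier G t)"
  shows "sp \<eta> x = 0"
proof -
  obtain \<delta> where \<delta>: "\<delta> > 0" "\<And>t0 \<eta> x. \<eta> \<in> test_functions \<Longrightarrow> m \<le> norm (fourier G t0) \<Longrightarrow>
       (\<And>t. \<bar>t - t0\<bar> > \<delta> \<Longrightarrow> \<eta> t = 0) \<Longrightarrow> sp \<eta> x = 0"
    using spectral_part_vanishes_locally[OF G zero m] by blast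
  obtain R where R: "R > 0" "\<And>t. \<bar>t\<bar> > R \<Longrightarrow> \<eta> t = 0" using test_functionE[OF \<eta>] by blast
  \<comment> \<open>Cells have width \<open>\<delta>\<close>, so that any point of a piece can serve as its centre.\<close>
  define N where "N = nat \<lceil>2 * R / \<delta>\<rceil>"
  define a where "a j t = smooth_step (2 / \<delta> * t + (real N + 1 - real j))" for j t
  define cell where "cell j t = a j t - a (Suc j) t" for j t
  have cell_smooth: "smooth (cell j)" for j
    unfolding cell_def a_def by (intro smooth_diff smooth_affine smooth_smooth_step)
  have cell_supp: "\<bar>2 / \<delta> * t + (real N - real j)\<bar> < 1" if "cell j t \<noteq> 0" for j t
  proof (rule ccontr)
    assume "\<not> ?thesis"
    then consider "2 / \<delta> * t + (real N - real j) \<ge> 1" | "2 / \<delta> * t + (real N - real j) \<le> -1" by linarith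
    then have "cell j t = 0"
      by cases (simp_all add: cell_def a_def smooth_step_0 smooth_step_1)
    with that show False by simp
  qed
  have part: "\<eta> t = (\<Sum>j<2 * N + 1. \<eta> t * cell j t)" for t
  proof (cases "\<bar>t\<bar> > R")
    case False
    have "2 / \<delta> * \<bar>t\<bar> \<le> 2 * R / \<delta>" using False \<delta>(1) by (simp add: field_simps)
    also have "\<dots> \<le> real N" unfolding N_def using R \<delta> by (simp add: le_nat_iff real_nat_ceiling_ge)
    finally have "\<bar>2 / \<delta> * t\<bar> \<le> real N" using \<delta>(1) by (simp add: abs_mult)
    moreover have "real (2 * N + 1) = 2 * real N + 1" "real 0 = 0" by simp_all
    ultimately have "1 \<le> 2 / \<delta> * t + (real N + 1 - real 0)" "2 / \<delta> * t + (real N + 1 - real (2 * N + 1)) \<le> 0"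
      by linarith+
    then have "a 0 t = 1" "a (2 * N + 1) t = 0"
      unfolding a_def by (blast intro: smooth_step_1 smooth_step_0)+
    moreover have "(\<Sum>j<2 * N + 1. cell j t) = a 0 t - a (2 * N + 1) t"
      unfolding cell_def by (rule sum_lessThan_telescope')
    ultimately show ?thesis by (simp add: sum_distrib_left[symmetric])
  qed (use R in simp)
  have tf: "(\<lambda>t. \<eta> t * cell j t) \<in> test_functions" for j
    by (intro test_function_mult \<eta> cell_smooth)
  have "sp (\<lambda>t. \<eta> t * cell j t) x = 0" for j
  proof (cases "\<exists>t0. \<eta> t0 * cell j t0 \<noteq> 0")
    case True
    then obtain t0 where t0: "\<eta> t0 \<noteq> 0" "cell j t0 \<noteq> 0" by auto
    show ?thesis
    proof (rule \<delta>(2)[OF tf low[OF t0(1)]])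
      fix t assume far: "\<bar>t - t0\<bar> > \<delta>"
      have "\<not> cell j t \<noteq> 0"
      proof
        assume "cell j t \<noteq> 0"
        then have "\<bar>2 / \<delta> * t - 2 / \<delta> * t0\<bar> < 2" using cell_supp[of j t] cell_supp[OF t0(2)] by linarith
        then have "\<bar>2 / \<delta> * (t - t0)\<bar> < 2" by (simp only: right_diff_distrib)
        then have "\<bar>t - t0\<bar> < \<delta>" using \<delta>(1) by (simp add: abs_mult field_simps)
        with far show False by simp
      qed
      then show "\<eta> t * cell j t = 0" by simp
    qed
  next
    case False
    then have "(\<lambda>t. \<eta> t * cell j t) = (\<lambda>t. 0)" by auto
    then show ?thesis by (simp add: sp_zero)
  qed
  then have "sp (\<lambda>t. \<Sum>j<2 * N + 1. \<eta> t * cell j t) x = 0"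
    by (subst sp_sum) (use tf in auto)
  moreover have "\<eta> = (\<lambda>t. \<Sum>j<2 * N + 1. \<eta> t * cell j t)" using part by blast
  ultimately show ?thesis by simp
qed

text \<open>Restricting \<open>\<theta>\<close> to a tiny neighbourhood of \<open>s\<close> removes only frequencies away from the zeros, so it does
  not change the spectral part. Bernstein's inequality then holds with arbitrarily small \<open>\<delta>\<close>, so that
  the demodulated function is constant. Boundedness of the masses enters here, and it excludes
  derivatives of point masses in the Fourier transform.\<close>

lemma spectral_part_at_isolated_zero:
  assumes G: "amalgam G" "continuous_on UNIV G"
    and zero: "\<And>x. shift_series G \<Gamma> c x = 0"
    and \<theta>: "\<theta> \<in> test_functions" and supp: "\<And>t. \<bar>t - s\<bar> > r \<Longrightarrow> \<theta> t = 0"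
    and isolated: "\<And>t. \<bar>t - s\<bar> \<le> r \<Longrightarrow> fourier G t = 0 \<Longrightarrow> t = s"
  shows "sp \<theta> x = chr x s * sp \<theta> 0"
proof -
  have Gm: "G \<in> borel_measurable borel" by (intro borel_measurable_continuous_onI G)
  have Gi: "integrable lborel G" by (rule amalgam_integrable[OF G(1) Gm])
  obtain B where B: "\<And>x. norm (sp \<theta> x) \<le> B" using sp_bounded[OF \<theta>] by metis
  define e where "e n = 1 / real (Suc n)" for n
  have e0: "e n > 0" for n by (simp add: e_def)
  have elim: "e \<longlonglongrightarrow> 0"
    unfolding e_def using LIMSEQ_inverse_real_of_nat by (simp add: inverse_eq_divide)
  have step: "norm (chr (- x) s * sp \<theta> x - chr (- 0) s * sp \<theta> 0) \<le> B * kernel_modulus (2 * e n * (x - 0))" for n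
  proof -
    let ?V = "\<lambda>t. plateau ((t - s) / e n)"
    have V: "?V \<in> test_functions" by (rule plateau_scaled_test_function[OF e0])
    have \<theta>V: "(\<lambda>t. \<theta> t * ?V t) \<in> test_functions"
      by (intro test_function_mult \<theta> test_function_smooth[OF V])
    have rest: "(\<lambda>t. \<theta> t * (1 - ?V t)) \<in> test_functions"
      by (intro test_function_mult \<theta> smooth_diff smooth_const test_function_smooth[OF V])
    \<comment> \<open>The annulus that carries the removed part contains no zero, so the transform of \<open>G\<close> is bounded below on it.\<close>
    let ?K = "{t. \<bar>t - s\<bar> \<le> r} \<inter> {t. e n \<le> \<bar>t - s\<bar>}"
    have "{t. \<bar>t - s\<bar> \<le> r} = cball s r" by (auto simp: dist_real_def abs_minus_commute)
    then have "compact ?K"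
      by (intro compact_Int_closed closed_Collect_le continuous_intros) auto
    from compact_lower_bound[OF this continuous_fourier[OF Gi]]
    obtain m where m: "m > 0" "\<And>t. t \<in> ?K \<Longrightarrow> m \<le> norm (fourier G t)"
      using isolated e0[of n] by fastforce
    have "sp (\<lambda>t. \<theta> t * (1 - ?V t)) y = 0" for y
    proof (rule spectral_part_vanishes_off_zeros[OF G zero rest m(1)])
      fix t assume nz: "\<theta> t * (1 - ?V t) \<noteq> 0"
      have "\<bar>t - s\<bar> \<le> r" using supp[of t] nz by force
      moreover have "e n \<le> \<bar>t - s\<bar>"
      proof (rule ccontr)
        assume "\<not> ?thesis"
        then have "?V t = 1" using e0[of n] by (intro plateau_1) (simp add: abs_divide)
        with nz show False by simp
      qed
      ultimately show "m \<le> norm (fourier G t)" by (intro m(2)) simp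
    qed
    moreover have "\<theta> = (\<lambda>t. \<theta> t * ?V t + \<theta> t * (1 - ?V t))" by (simp add: algebra_simps)
    ultimately have eq: "sp \<theta> y = sp (\<lambda>t. \<theta> t * ?V t) y" for y
      using sp_add[OF \<theta>V rest, of y] by simp
    have "norm (chr (- x) s * sp (\<lambda>t. \<theta> t * ?V t) x - chr (- 0) s * sp (\<lambda>t. \<theta> t * ?V t) 0) \<le>
        B * kernel_modulus (2 * e n * (x - 0))"
    proof (rule bernstein[OF \<theta>V])
      fix t assume "\<bar>t - s\<bar> > 2 * e n"
      then have "?V t = 0" using e0[of n] by (intro plateau_0) (simp add: abs_divide pos_le_divide_eq)
      then show "\<theta> t * ?V t = 0" by simp
    qed (use e0 B eq in auto)
    then show ?thesis unfolding eq .
  qed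
  have "(\<lambda>n. 2 * e n * (x - 0)) \<longlonglongrightarrow> 2 * 0 * (x - 0)" by (intro tendsto_intros elim)
  then have "(\<lambda>n. B * kernel_modulus (2 * e n * (x - 0))) \<longlonglongrightarrow> 0"
    by (intro tendsto_mult_right_zero kernel_modulus_tendsto_0) simp
  then have "norm (chr (- x) s * sp \<theta> x - chr (- 0) s * sp \<theta> 0) \<le> 0"
    by (rule tendsto_lowerbound) (use step in auto)
  then have "chr (- x) s * sp \<theta> x = sp \<theta> 0" by simp
  then have "chr x s * (chr (- x) s * sp \<theta> x) = chr x s * sp \<theta> 0" by simp
  then show ?thesis by (simp add: mult.assoc[symmetric])
qed

text \<open>Averaging a pure exponential of frequency \<open>s\<close> against the transform of \<open>\<eta>\<close> is Fourier inversion at \<open>s\<close>.\<close>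

lemma sp_mult_pure_frequency:
  assumes \<theta>: "\<theta> \<in> test_functions" and \<eta>: "\<eta> \<in> test_functions"
    and pure: "\<And>x. sp \<theta> x = chr x s * sp \<theta> 0"
  shows "sp (\<lambda>t. \<eta> t * \<theta> t) 0 = \<eta> s * sp \<theta> 0"
proof -
  have "sp (\<lambda>t. \<theta> t * \<eta> t) 0 = (LBINT y. fourier \<eta> y * sp \<theta> (0 + y))"
    by (rule sp_mult[OF \<theta> \<eta>])
  also have "\<dots> = (LBINT y. (chr y s * fourier \<eta> y) * sp \<theta> 0)"
    by (subst pure) (simp add: mult_ac)
  also have "\<dots> = \<eta> s * sp \<theta> 0"
    by (subst integral_mult_left_zero) (simp only: fourier_inversion_test_function[OF \<eta>])
  finally show ?thesis by (simp add: mult.commute)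
qed

text \<open>Each zero \<open>s\<close> gets a plateau \<open>\<theta>\<^sub>s\<close> around it that avoids the other zeros. Multiplying \<open>\<eta>\<close> by
  \<open>1 - \<theta>\<^sub>s\<close> for the zeros in its support peels off the terms \<open>a s * \<eta> s\<close> one by one, and what is left lives
  away from the zeros. A product is used rather than a sum since the plateaus may overlap.\<close>

lemma dirac_decomposition:
  assumes G: "amalgam G" "continuous_on UNIV G"
    and zero: "\<And>x. shift_series G \<Gamma> c x = 0"
    and fin: "\<And>R. finite (zeros (fourier G) \<inter> {-R..R})"
  obtains a where "\<And>s. a s \<noteq> 0 \<Longrightarrow> fourier G s = 0"
    "\<And>\<eta>. \<eta> \<in> test_functions \<Longrightarrow> sp \<eta> 0 = (\<Sum>\<^sub>\<infinity>s. a s * \<eta> s)"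
proof -
  have Gm: "G \<in> borel_measurable borel" by (intro borel_measurable_continuous_onI G)
  have Gi: "integrable lborel G" by (rule amalgam_integrable[OF G(1) Gm])
  define Z where "Z = zeros (fourier G)"
  have ZI: "s \<in> Z \<longleftrightarrow> fourier G s = 0" for s by (simp add: Z_def zeros_def)
  have "\<exists>r>0. \<forall>t\<in>Z. \<bar>t - s\<bar> \<le> r \<longrightarrow> t = s" for s
  proof -
    have "finite (Z \<inter> {-(\<bar>s\<bar> + 1)..\<bar>s\<bar> + 1})" using fin[of "\<bar>s\<bar> + 1"] by (simp add: Z_def)
    from finite_set_avoid[OF this, of s] obtain d
      where d: "d > 0" "\<And>t. t \<in> Z \<inter> {-(\<bar>s\<bar> + 1)..\<bar>s\<bar> + 1} \<Longrightarrow> t \<noteq> s \<Longrightarrow> d \<le> dist s t" by blast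
    show ?thesis
    proof (intro exI[of _ "min (d / 2) 1"] conjI ballI impI)
      fix t assume t: "t \<in> Z" "\<bar>t - s\<bar> \<le> min (d / 2) 1"
      then have "t \<in> Z \<inter> {-(\<bar>s\<bar> + 1)..\<bar>s\<bar> + 1}" by auto
      with d t show "t = s" by (force simp: dist_real_def abs_minus_commute)
    qed (use d in auto)
  qed
  then obtain r where r: "\<And>s. r s > 0" "\<And>s t. t \<in> Z \<Longrightarrow> \<bar>t - s\<bar> \<le> r s \<Longrightarrow> t = s" by metis
  define \<theta> where "\<theta> s = (\<lambda>t. plateau ((t - s) / (r s / 2)))" for s
  have \<theta>: "\<theta> s \<in> test_functions" for s
    unfolding \<theta>_def by (rule plateau_scaled_test_function) (use r in simp)
  have \<theta>0: "\<theta> s t = 0" if "\<bar>t - s\<bar> \<ge> r s" for s t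
    unfolding \<theta>_def using that r(1)[of s] by (intro plateau_0) (simp add: abs_divide pos_le_divide_eq)
  have \<theta>1: "\<theta> s t = 1" if "\<bar>t - s\<bar> \<le> r s / 2" for s t
  proof -
    have "\<bar>t - s\<bar> / \<bar>r s / 2\<bar> \<le> 1" using that r(1)[of s] by (subst divide_le_eq_1_pos) auto
    then show ?thesis unfolding \<theta>_def by (intro plateau_1) (simp only: abs_divide)
  qed
  have pure: "sp (\<theta> s) x = chr x s * sp (\<theta> s) 0" for s x
    by (rule spectral_part_at_isolated_zero[where s = s and r = "r s", OF G zero \<theta>]) (use r \<theta>0 ZI in auto)
  define a where "a s = (if s \<in> Z then sp (\<theta> s) 0 else 0)" for s
  have peel: "(\<lambda>t. \<eta> t * (\<Prod>s\<in>A. 1 - \<theta> s t)) \<in> test_functions \<and>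
      sp (\<lambda>t. \<eta> t * (\<Prod>s\<in>A. 1 - \<theta> s t)) 0 = sp \<eta> 0 - (\<Sum>s\<in>A. a s * \<eta> s)"
    if "finite A" "A \<subseteq> Z" and \<eta>: "\<eta> \<in> test_functions" for A \<eta>
    using that(1,2)
  proof (induction A rule: finite_induct)
    case empty
    then show ?case using \<eta> by simp
  next
    case (insert s A)
    let ?\<zeta> = "\<lambda>t. \<eta> t * (\<Prod>s\<in>A. 1 - \<theta> s t)"
    have \<zeta>: "?\<zeta> \<in> test_functions" and IH: "sp ?\<zeta> 0 = sp \<eta> 0 - (\<Sum>s\<in>A. a s * \<eta> s)" using insert by auto
    have sZ: "s \<in> Z" using insert by simp
    \<comment> \<open>The plateaus of the other zeros vanish at \<open>s\<close>.\<close>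
    have \<zeta>s: "?\<zeta> s = \<eta> s"
    proof -
      have "\<theta> s' s = 0" if "s' \<in> A" for s'
      proof (rule \<theta>0, rule ccontr)
        assume "\<not> r s' \<le> \<bar>s - s'\<bar>"
        then have "s = s'" using r(2)[OF sZ, of s'] by simp
        with that insert.hyps show False by simp
      qed
      then show ?thesis by simp
    qed
    have t1: "(\<lambda>t. ?\<zeta> t * (1 - \<theta> s t)) \<in> test_functions" and t2: "(\<lambda>t. ?\<zeta> t * \<theta> s t) \<in> test_functions"
      by (intro test_function_mult \<zeta> smooth_diff smooth_const test_function_smooth[OF \<theta>])+
    have "?\<zeta> = (\<lambda>t. ?\<zeta> t * (1 - \<theta> s t) + ?\<zeta> t * \<theta> s t)" by (simp add: algebra_simps)
    then have "sp ?\<zeta> 0 = sp (\<lambda>t. ?\<zeta> t * (1 - \<theta> s t)) 0 + sp (\<lambda>t. ?\<zeta> t * \<theta> s t) 0"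
      using sp_add[OF t1 t2, of 0] by metis
    also have "sp (\<lambda>t. ?\<zeta> t * \<theta> s t) 0 = ?\<zeta> s * sp (\<theta> s) 0"
      by (rule sp_mult_pure_frequency[OF \<theta> \<zeta> pure])
    also have "\<dots> = a s * \<eta> s" using \<zeta>s sZ by (simp add: a_def mult.commute)
    finally have "sp ?\<zeta> 0 = sp (\<lambda>t. ?\<zeta> t * (1 - \<theta> s t)) 0 + a s * \<eta> s" .
    then have "sp (\<lambda>t. ?\<zeta> t * (1 - \<theta> s t)) 0 = sp ?\<zeta> 0 - a s * \<eta> s"
      by (rule eq_diff_eq[THEN iffD2, OF sym])
    also have "\<dots> = sp \<eta> 0 - (\<Sum>s\<in>insert s A. a s * \<eta> s)"
      unfolding IH sum.insert[OF insert.hyps] by (rule diff_diff_eq[THEN trans]) (simp only: add.commute)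
    finally have "sp (\<lambda>t. ?\<zeta> t * (1 - \<theta> s t)) 0 = sp \<eta> 0 - (\<Sum>s\<in>insert s A. a s * \<eta> s)" .
    moreover have "(\<lambda>t. ?\<zeta> t * (1 - \<theta> s t)) = (\<lambda>t. \<eta> t * (\<Prod>s\<in>insert s A. 1 - \<theta> s t))"
      using insert.hyps by (simp add: mult_ac)
    ultimately show ?case using t1 by simp
  qed
  show ?thesis
  proof (rule that[of a])
    show "fourier G s = 0" if "a s \<noteq> 0" for s using that ZI by (auto simp: a_def split: if_splits)
    fix \<eta> assume \<eta>: "\<eta> \<in> test_functions"
    obtain R where R: "R > 0" "\<And>t. \<bar>t\<bar> > R \<Longrightarrow> \<eta> t = 0" using test_functionE[OF \<eta>] by blast
    let ?A = "Z \<inter> {-R..R}"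
    let ?\<zeta> = "\<lambda>t. \<eta> t * (\<Prod>s\<in>?A. 1 - \<theta> s t)"
    have finA: "finite ?A" using fin by (simp add: Z_def)
    note peelA = peel[OF finA _ \<eta>]
    \<comment> \<open>Where the remainder is nonzero, no plateau has the value 1.\<close>
    let ?K = "{-R..R} - (\<Union>s\<in>?A. ball s (r s / 2))"
    have "compact ?K" by (intro compact_diff open_UN) auto
    moreover have "fourier G t \<noteq> 0" if "t \<in> ?K" for t
    proof
      assume "fourier G t = 0"
      then have "t \<in> ?A" using that ZI by auto
      moreover have "t \<in> ball t (r t / 2)" using r(1)[of t] by simp
      ultimately show False using that by blast
    qed
    ultimately obtain m where m: "m > 0" "\<And>t. t \<in> ?K \<Longrightarrow> m \<le> norm (fourier G t)"
      using compact_lower_bound[OF _ continuous_fourier[OF Gi], of ?K] by blast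
    have "sp ?\<zeta> 0 = 0"
    proof (rule spectral_part_vanishes_off_zeros[OF G zero _ m(1)])
      show "?\<zeta> \<in> test_functions" using peelA by blast
      fix t assume nz: "?\<zeta> t \<noteq> 0"
      then have "\<eta> t \<noteq> 0" and nz1: "\<And>s. s \<in> ?A \<Longrightarrow> \<theta> s t \<noteq> 1"
        using finA by auto
      then have "t \<in> {-R..R}" using R(2)[of t] by (cases "\<bar>t\<bar> > R") auto
      moreover have "t \<notin> ball s (r s / 2)" if "s \<in> ?A" for s
        using \<theta>1[of t s] nz1[OF that] by (auto simp: dist_real_def abs_minus_commute)
      ultimately show "m \<le> norm (fourier G t)" by (intro m(2)) blast
    qed
    then have "sp \<eta> 0 = (\<Sum>s\<in>?A. a s * \<eta> s)" using peelA by simp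
    also have "\<dots> = (\<Sum>\<^sub>\<infinity>s\<in>?A. a s * \<eta> s)" using finA by simp
    also have "\<dots> = (\<Sum>\<^sub>\<infinity>s. a s * \<eta> s)"
    proof (rule infsum_cong_neutral)
      fix s assume "s \<in> UNIV - ?A"
      then have "s \<notin> Z \<or> \<bar>s\<bar> > R" by (cases "\<bar>s\<bar> > R") (auto simp: abs_le_iff not_less)
      then show "a s * \<eta> s = 0" using R(2)[of s] by (auto simp: a_def)
    qed auto
    finally show "sp \<eta> 0 = (\<Sum>\<^sub>\<infinity>s. a s * \<eta> s)" .
  qed
qed

end

section \<open>Vanishing series and crystalline measures\<close>

lemma finite_zeros_bounded:
  assumes "\<And>x :: real. finite (Z \<inter> {x<..<x + 1})"
  shows "finite (Z \<inter> {-R..R})"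
proof -
  have "Z \<inter> {-R..R} \<subseteq> (\<Union>k\<in>{\<lfloor>2 * (- R)\<rfloor>..\<lfloor>2 * R\<rfloor>}. Z \<inter> {(of_int k - 1) / 2<..<(of_int k - 1) / 2 + 1})"
  proof
    fix t assume t: "t \<in> Z \<inter> {-R..R}"
    then have "\<lfloor>2 * t\<rfloor> \<in> {\<lfloor>2 * (- R)\<rfloor>..\<lfloor>2 * R\<rfloor>}" by (auto intro!: floor_mono)
    moreover have "t \<in> {(of_int \<lfloor>2 * t\<rfloor> - 1) / 2<..<(of_int \<lfloor>2 * t\<rfloor> - 1) / 2 + 1}"
    proof -
      have "(k - 1) / 2 < t \<and> t < (k - 1) / 2 + 1" if "k \<le> 2 * t" "2 * t < k + 1" for k :: real
        using that by (simp add: field_simps)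
      from this[of "of_int \<lfloor>2 * t\<rfloor>"] show ?thesis unfolding greaterThanLessThan_iff by linarith
    qed
    ultimately show "t \<in> (\<Union>k\<in>{\<lfloor>2 * (- R)\<rfloor>..\<lfloor>2 * R\<rfloor>}. Z \<inter> {(of_int k - 1) / 2<..<(of_int k - 1) / 2 + 1})"
      using t by blast
  qed
  then show ?thesis by (rule finite_subset) (intro finite_UN_I assms finite_atLeastAtMost_int)
qed

context bounded_masses begin

definition masses :: "real \<Rightarrow> complex" where
  "masses x = (if x \<in> \<Gamma> then c x else 0)"

lemma masses_pairing: "(\<Sum>\<^sub>\<infinity>x. masses x * \<phi> x) = (\<Sum>\<^sub>\<infinity>\<gamma>\<in>\<Gamma>. c \<gamma> * \<phi> \<gamma>)"
  by (rule infsum_cong_neutral) (auto simp: masses_def)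

lemma masses_finite: "finite (atoms masses \<inter> {-R..R})"
  by (rule finite_subset[OF _ sep_finite[OF sep\<Gamma> d, of "-R" R]]) (auto simp: atoms_def masses_def)

lemma atomic_measure_masses: "atomic_measure masses"
  unfolding atomic_measure_def
proof
  fix R
  have "(\<lambda>x. norm (masses x)) summable_on (atoms masses \<inter> {-R..R})"
    using masses_finite by (rule summable_on_finite)
  then show "(\<lambda>x. norm (masses x)) summable_on {-R..R}"
    by (rule summable_on_cong_neutral[THEN iffD1, rotated -1]) (auto simp: atoms_def)
qed

lemma inverse_square_summable: "(\<lambda>\<gamma>. 1 / (1 + \<gamma>\<^sup>2)) summable_on \<Gamma>"
proof -
  have norm: "norm (complex_of_real (1 / (1 + t\<^sup>2))) = 1 / (1 + t\<^sup>2)" for t :: real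
    unfolding norm_of_real by (rule abs_of_nonneg) simp
  have "norm (complex_of_real (1 / (1 + t\<^sup>2))) * (1 + t\<^sup>2) \<le> 1" for t :: real
    unfolding norm by (simp add: add_nonneg_eq_0_iff)
  then have "amalgam (\<lambda>t. complex_of_real (1 / (1 + t\<^sup>2)))" by (rule decay_amalgam)
  from shift_summable[OF this sep\<Gamma> d, of "\<lambda>_. 1" 1 0] show ?thesis
    unfolding mult_1_left norm by simp
qed

lemma schwartz_majorant:
  assumes "\<psi> \<in> schwartz" "\<gamma> \<in> \<Gamma>"
  shows "norm (c \<gamma> * \<psi> \<gamma>) \<le> (M * (schwartz_seminorm 0 0 \<psi> + schwartz_seminorm 2 0 \<psi>)) * (1 / (1 + \<gamma>\<^sup>2))"
proof -
  let ?P = "schwartz_seminorm 0 0 \<psi> + schwartz_seminorm 2 0 \<psi>"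
  have "norm (\<psi> \<gamma>) * (1 + \<gamma>\<^sup>2) \<le> ?P"
    using schwartz_bound[OF assms(1), of \<gamma> 0 0] schwartz_bound[OF assms(1), of \<gamma> 2 0]
    by (simp add: algebra_simps)
  then have "norm (\<psi> \<gamma>) \<le> ?P * (1 / (1 + \<gamma>\<^sup>2))" by (simp add: pos_le_divide_eq add_pos_nonneg)
  then have "norm (c \<gamma>) * norm (\<psi> \<gamma>) \<le> M * (?P * (1 / (1 + \<gamma>\<^sup>2)))"
    using cM[OF assms(2)] M by (intro mult_mono) auto
  then show ?thesis by (simp only: norm_mult mult.assoc)
qed

lemma schwartz_pairing_summable: "\<psi> \<in> schwartz \<Longrightarrow> (\<lambda>\<gamma>. c \<gamma> * \<psi> \<gamma>) summable_on \<Gamma>"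
  by (rule norm_infsum_le(1)[OF summable_on_cmult_right[OF inverse_square_summable] schwartz_majorant])

lemma schwartz_pairing_bound:
  assumes "\<psi> \<in> schwartz"
  shows "norm (\<Sum>\<^sub>\<infinity>\<gamma>\<in>\<Gamma>. c \<gamma> * \<psi> \<gamma>) \<le>
    (M * infsum (\<lambda>\<gamma>. 1 / (1 + \<gamma>\<^sup>2)) \<Gamma>) * (schwartz_seminorm 0 0 \<psi> + schwartz_seminorm 2 0 \<psi>)"
proof -
  have "norm (\<Sum>\<^sub>\<infinity>\<gamma>\<in>\<Gamma>. c \<gamma> * \<psi> \<gamma>) \<le>
      (\<Sum>\<^sub>\<infinity>\<gamma>\<in>\<Gamma>. (M * (schwartz_seminorm 0 0 \<psi> + schwartz_seminorm 2 0 \<psi>)) * (1 / (1 + \<gamma>\<^sup>2)))"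
    by (rule norm_infsum_le(3)[OF summable_on_cmult_right[OF inverse_square_summable] schwartz_majorant[OF assms]])
  also have "\<dots> = (M * (schwartz_seminorm 0 0 \<psi> + schwartz_seminorm 2 0 \<psi>)) * infsum (\<lambda>\<gamma>. 1 / (1 + \<gamma>\<^sup>2)) \<Gamma>"
    by (rule infsum_cmult_right')
  finally show ?thesis by (simp only: mult_ac)
qed

text \<open>The limit of cutoffs, on the side of the measure.\<close>

lemma schwartz_pairing_limit:
  fixes h :: "nat \<Rightarrow> real \<Rightarrow> complex"
  assumes \<psi>: "\<psi> \<in> schwartz" and hB: "\<And>n x. norm (h n x) \<le> B" and h1: "\<And>x. (\<lambda>n. h n x) \<longlonglongrightarrow> 1"
  shows "(\<lambda>n. \<Sum>\<^sub>\<infinity>\<gamma>\<in>\<Gamma>. c \<gamma> * (h n \<gamma> * \<psi> \<gamma>)) \<longlonglongrightarrow> (\<Sum>\<^sub>\<infinity>\<gamma>\<in>\<Gamma>. c \<gamma> * \<psi> \<gamma>)"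
proof (rule infsum_dominated_convergence[OF summable_on_cmult_right[OF summable_on_cmult_right[OF inverse_square_summable]]])
  have B: "B \<ge> 0" using hB[of 0 0] norm_ge_zero order_trans by blast
  let ?P = "schwartz_seminorm 0 0 \<psi> + schwartz_seminorm 2 0 \<psi>"
  fix n \<gamma> assume \<gamma>: "\<gamma> \<in> \<Gamma>"
  have "norm (h n \<gamma>) * norm (c \<gamma> * \<psi> \<gamma>) \<le> B * ((M * ?P) * (1 / (1 + \<gamma>\<^sup>2)))"
    by (intro mult_mono hB schwartz_majorant[OF \<psi> \<gamma>] B) simp
  moreover have "norm (c \<gamma> * (h n \<gamma> * \<psi> \<gamma>)) = norm (h n \<gamma>) * norm (c \<gamma> * \<psi> \<gamma>)"
    by (simp only: norm_mult mult_ac)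
  ultimately show "norm (c \<gamma> * (h n \<gamma> * \<psi> \<gamma>)) \<le> B * ((M * ?P) * (1 / (1 + \<gamma>\<^sup>2)))" by simp
next
  fix \<gamma>
  have "(\<lambda>n. c \<gamma> * (h n \<gamma> * \<psi> \<gamma>)) \<longlonglongrightarrow> c \<gamma> * (1 * \<psi> \<gamma>)" by (intro tendsto_intros h1)
  then show "(\<lambda>n. c \<gamma> * (h n \<gamma> * \<psi> \<gamma>)) \<longlonglongrightarrow> c \<gamma> * \<psi> \<gamma>" by simp
qed

lemma tempered_distribution_masses:
  "tempered_distribution (\<lambda>\<psi>. \<Sum>\<^sub>\<infinity>\<gamma>\<in>\<Gamma>. c \<gamma> * \<psi> \<gamma>)"
proof -
  let ?Q = "M * infsum (\<lambda>\<gamma>. 1 / (1 + \<gamma>\<^sup>2)) \<Gamma>"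
  have Q: "?Q \<ge> 0" using M by (intro mult_nonneg_nonneg infsum_nonneg) auto
  show ?thesis
    unfolding tempered_distribution_def
  proof (intro conjI ballI allI)
    fix \<phi> \<psi> assume "\<phi> \<in> schwartz" "\<psi> \<in> schwartz"
    then show "(\<Sum>\<^sub>\<infinity>\<gamma>\<in>\<Gamma>. c \<gamma> * (\<phi> \<gamma> + \<psi> \<gamma>)) = (\<Sum>\<^sub>\<infinity>\<gamma>\<in>\<Gamma>. c \<gamma> * \<phi> \<gamma>) + (\<Sum>\<^sub>\<infinity>\<gamma>\<in>\<Gamma>. c \<gamma> * \<psi> \<gamma>)"
      unfolding distrib_left by (intro infsum_add schwartz_pairing_summable)
  next
    fix a \<phi>
    show "(\<Sum>\<^sub>\<infinity>\<gamma>\<in>\<Gamma>. c \<gamma> * (a * \<phi> \<gamma>)) = a * (\<Sum>\<^sub>\<infinity>\<gamma>\<in>\<Gamma>. c \<gamma> * \<phi> \<gamma>)"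
      unfolding mult.left_commute[of _ a] by (rule infsum_cmult_right')
  next
    show "\<exists>C N. \<forall>\<phi>\<in>schwartz. norm (\<Sum>\<^sub>\<infinity>\<gamma>\<in>\<Gamma>. c \<gamma> * \<phi> \<gamma>) \<le>
        C * (\<Sum>m\<le>N. \<Sum>n\<le>N. schwartz_seminorm m n \<phi>)"
    proof (intro exI[of _ ?Q] exI[of _ 2] ballI)
      fix \<phi> assume \<phi>: "\<phi> \<in> schwartz"
      have p0: "schwartz_seminorm m n \<phi> \<ge> 0" for m n
        using schwartz_bound[OF \<phi>, of 0 m n] by (meson norm_ge_zero order_trans zero_le_mult_iff zero_le_power_abs)
      have "schwartz_seminorm 0 0 \<phi> + schwartz_seminorm 2 0 \<phi> = (\<Sum>m\<in>{0, 2}. schwartz_seminorm m 0 \<phi>)" by simp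
      also have "\<dots> \<le> (\<Sum>m\<le>2. schwartz_seminorm m 0 \<phi>)" by (intro sum_mono2 p0) auto
      also have "\<dots> \<le> (\<Sum>m\<le>2. \<Sum>n\<le>2. schwartz_seminorm m n \<phi>)"
        by (intro sum_mono member_le_sum p0) auto
      finally have "?Q * (schwartz_seminorm 0 0 \<phi> + schwartz_seminorm 2 0 \<phi>) \<le>
          ?Q * (\<Sum>m\<le>2. \<Sum>n\<le>2. schwartz_seminorm m n \<phi>)" using Q by (rule mult_left_mono)
      with schwartz_pairing_bound[OF \<phi>] show "norm (\<Sum>\<^sub>\<infinity>\<gamma>\<in>\<Gamma>. c \<gamma> * \<phi> \<gamma>) \<le>
          ?Q * (\<Sum>m\<le>2. \<Sum>n\<le>2. schwartz_seminorm m n \<phi>)" by (rule order_trans)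
    qed
  qed
qed

theorem vanishing_series_imp_crystalline:
  assumes G: "amalgam G" "continuous_on UNIV G"
    and zero: "\<And>x. shift_series G \<Gamma> c x = 0"
    and fin: "\<And>x :: real. finite (zeros (fourier G) \<inter> {x<..<x + 1})"
  shows "\<exists>S. sparse_crystalline_with_spectrum masses S \<and> S \<subseteq> zeros (fourier G)"
proof -
  note finR = finite_zeros_bounded[OF fin]
  obtain a where a: "\<And>s. a s \<noteq> 0 \<Longrightarrow> fourier G s = 0"
    "\<And>\<eta>. \<eta> \<in> test_functions \<Longrightarrow> sp \<eta> 0 = (\<Sum>\<^sub>\<infinity>s. a s * \<eta> s)"
    by (rule dirac_decomposition[OF G zero finR]) (rule that)
  have aZ: "atoms a \<subseteq> zeros (fourier G)" using a(1) by (auto simp: atoms_def zeros_def)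
  have lf: "locally_finite_set (atoms a)"
    unfolding locally_finite_set_def
    by (intro allI finite_subset[OF Int_mono[OF aZ order_refl] finR])
  have am: "atomic_measure a"
    unfolding atomic_measure_def
  proof
    fix R
    have "(\<lambda>x. norm (a x)) summable_on (atoms a \<inter> {-R..R})"
      using lf by (intro summable_on_finite) (simp add: locally_finite_set_def)
    then show "(\<lambda>x. norm (a x)) summable_on {-R..R}"
      by (rule summable_on_cong_neutral[THEN iffD1, rotated -1]) (auto simp: atoms_def)
  qed
  have "atomic_fourier masses a"
    unfolding atomic_fourier_def
  proof (intro exI conjI)
    let ?T = "\<lambda>\<psi>. \<Sum>\<^sub>\<infinity>\<gamma>\<in>\<Gamma>. c \<gamma> * \<psi> \<gamma>"
    show "tempered_distribution ?T" by (rule tempered_distribution_masses)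
    show "distr_of_atomic ?T masses"
      unfolding distr_of_atomic_def masses_pairing using atomic_measure_masses by blast
    show "distr_of_atomic (distr_fourier ?T) a"
      unfolding distr_of_atomic_def distr_fourier_def
    proof (intro conjI am ballI)
      fix \<phi> assume "\<phi> \<in> test_functions"
      from a(2)[OF this] show "?T (fourier \<phi>) = (\<Sum>\<^sub>\<infinity>x. a x * \<phi> x)"
        by (simp add: spectral_part_def)
    qed
  qed
  moreover have "locally_finite_set (atoms masses)"
    unfolding locally_finite_set_def using masses_finite by blast
  moreover have "separated_set (atoms masses)"
  proof -
    have "sep (min d 1) (atoms masses)"
      using sep\<Gamma> unfolding sep_def atoms_def masses_def by (auto split: if_splits intro: min.coboundedI1)
    then show ?thesis unfolding separated_set_iff using d by (intro exI[of _ "min d 1"]) auto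
  qed
  ultimately have "sparse_crystalline_with_spectrum masses (atoms a)"
    unfolding sparse_crystalline_with_spectrum_def crystalline_with_spectrum_def using lf by blast
  with aZ show ?thesis by blast
qed

text \<open>The tempered distribution is given on test functions only, and by density it is the sum over the
  masses on all Schwartz functions. So spectral parts are finite sums of exponentials with frequencies
  in the zeros, and are annihilated by convolution with \<open>G\<close>. Dilating the plateau turns its transform
  into an approximate identity, which recovers the series pointwise.\<close>

theorem crystalline_imp_vanishing_series:
  assumes G: "amalgam G" "continuous_on UNIV G"
    and cr: "crystalline_with_spectrum masses S" and S: "S \<subseteq> zeros (fourier G)"
  shows "shift_series G \<Gamma> c x = 0"
proof -
  have Gm [measurable]: "G \<in> borel_measurable borel" by (intro borel_measurable_continuous_onI G)
  have Gi: "integrable lborel G" by (rule amalgam_integrable[OF G(1) Gm])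
  obtain a where a: "atomic_fourier masses a" "S = atoms a" and lf: "locally_finite_set S"
    using cr unfolding crystalline_with_spectrum_def by blast
  obtain T where T: "tempered_distribution T"
    "\<And>\<phi>. \<phi> \<in> test_functions \<Longrightarrow> T \<phi> = (\<Sum>\<^sub>\<infinity>\<gamma>\<in>\<Gamma>. c \<gamma> * \<phi> \<gamma>)"
    "\<And>\<phi>. \<phi> \<in> test_functions \<Longrightarrow> T (fourier \<phi>) = (\<Sum>\<^sub>\<infinity>s. a s * \<phi> s)"
    using a(1) unfolding atomic_fourier_def distr_of_atomic_def distr_fourier_def masses_pairing by blast
  obtain BV where BV: "\<And>x. norm (plateau x) \<le> BV" using test_function_bounded[OF plateau_test_function] by blast
  have plim: "(\<lambda>n. plateau (x / real (Suc n))) \<longlonglongrightarrow> 1" for x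
  proof -
    have "(\<lambda>n. x * (1 / real (Suc n))) \<longlonglongrightarrow> x * 0"
      using LIMSEQ_inverse_real_of_nat by (intro tendsto_intros) (simp add: inverse_eq_divide)
    then have "(\<lambda>n. plateau (x * (1 / real (Suc n)))) \<longlonglongrightarrow> plateau (x * 0)"
      using smooth_continuous[OF smooth_plateau, of UNIV]
      by (intro isCont_tendsto_compose[of _ plateau]) (simp_all add: continuous_on_eq_continuous_at)
    then show ?thesis by (simp add: plateau_1)
  qed
  have T_schwartz: "T \<psi> = (\<Sum>\<^sub>\<infinity>\<gamma>\<in>\<Gamma>. c \<gamma> * \<psi> \<gamma>)" if "\<psi> \<in> schwartz" for \<psi>
  proof (rule LIMSEQ_unique[OF tempered_distribution_cutoff_limit[OF T(1) that]])
    have "T (\<lambda>x. plateau (x / real (Suc n)) * \<psi> x) = (\<Sum>\<^sub>\<infinity>\<gamma>\<in>\<Gamma>. c \<gamma> * (plateau (\<gamma> / real (Suc n)) * \<psi> \<gamma>))" for n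
      by (intro T(2) schwartz_mult_plateau that) simp
    then show "(\<lambda>n. T (\<lambda>x. plateau (x / real (Suc n)) * \<psi> x)) \<longlonglongrightarrow> (\<Sum>\<^sub>\<infinity>\<gamma>\<in>\<Gamma>. c \<gamma> * \<psi> \<gamma>)"
      using schwartz_pairing_limit[OF that, of "\<lambda>n x. plateau (x / real (Suc n))", OF BV plim] by simp
  qed
  have spec: "sp \<eta> y = (\<Sum>\<^sub>\<infinity>s. a s * (\<eta> s * chr y s))" if \<eta>: "\<eta> \<in> test_functions" for \<eta> y
  proof -
    have \<phi>: "(\<lambda>t. \<eta> t * chr y t) \<in> test_functions" by (intro test_function_mult \<eta> smooth_chr)
    have "sp \<eta> y = sp (\<lambda>t. \<eta> t * chr y t) 0" using sp_chr_mult[OF \<eta>, of y 0] by simp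
    also have "\<dots> = T (fourier (\<lambda>t. \<eta> t * chr y t))"
      unfolding T_schwartz[OF fourier_test_function_schwartz[OF \<phi>]] by (simp add: spectral_part_def)
    also have "\<dots> = (\<Sum>\<^sub>\<infinity>s. a s * (\<eta> s * chr y s))" by (rule T(3)[OF \<phi>])
    finally show ?thesis .
  qed
  have conv0: "(LBINT y. fourier \<eta> (y - x) * shift_series G \<Gamma> c y) = 0" if \<eta>: "\<eta> \<in> test_functions" for \<eta> x
  proof -
    obtain R where R: "R > 0" "\<And>t. \<bar>t\<bar> > R \<Longrightarrow> \<eta> t = 0" using test_functionE[OF \<eta>] by blast
    let ?A = "S \<inter> {-R..R}"
    have finA: "finite ?A" using lf by (simp add: locally_finite_set_def)
    have fs: "sp \<eta> y = (\<Sum>s\<in>?A. a s * (\<eta> s * chr y s))" for y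
    proof -
      have "sp \<eta> y = (\<Sum>\<^sub>\<infinity>s\<in>?A. a s * (\<eta> s * chr y s))"
        unfolding spec[OF \<eta>]
        by (rule infsum_cong_neutral) (use R(2) a(2) in \<open>force simp: atoms_def\<close>)+
      with finA show ?thesis by simp
    qed
    have "(LBINT y. fourier \<eta> (y - x) * shift_series G \<Gamma> c y) = (LBINT u. G u * sp \<eta> (x - u))"
      by (rule convolution_identity[OF G \<eta>])
    also have "\<dots> = (LBINT u. \<Sum>s\<in>?A. (a s * \<eta> s * chr x s) * (chr (- s) u * G u))"
    proof (rule Bochner_Integration.integral_cong[OF refl])
      fix u
      have "G u * (a s * (\<eta> s * chr (x - u) s)) = (a s * \<eta> s * chr x s) * (chr (- s) u * G u)" for s
        using chr_add_left[of x "- u" s] chr_commute[of "- u" s] by (simp add: chr_minus mult_ac)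
      then show "G u * sp \<eta> (x - u) = (\<Sum>s\<in>?A. (a s * \<eta> s * chr x s) * (chr (- s) u * G u))"
        unfolding fs sum_distrib_left by (intro sum.cong) auto
    qed
    also have "\<dots> = (\<Sum>s\<in>?A. LBINT u. (a s * \<eta> s * chr x s) * (chr (- s) u * G u))"
      by (intro Bochner_Integration.integral_sum integrable_mult_right integrable_chr_mult Gi)
    also have "\<dots> = (\<Sum>s\<in>?A. (a s * \<eta> s * chr x s) * fourier G s)"
      unfolding fourier_eq_lborel[OF Gm] by simp
    also have "\<dots> = 0" using S by (intro sum.neutral) (auto simp: zeros_def)
    finally show ?thesis .
  qed
  let ?f = "shift_series G \<Gamma> c"
  have fc: "continuous_on UNIV ?f" by (rule shift_series_continuous[OF G sep\<Gamma> d cM])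
  have [measurable]: "?f \<in> borel_measurable borel" by (intro borel_measurable_continuous_onI fc)
  have "\<exists>B. \<forall>y. norm (?f y) \<le> B"
  proof (rule shift_bound[OF G(1) d])
    fix K assume K: "\<And>A (c :: real \<Rightarrow> complex) M x. sep d A \<Longrightarrow> M \<ge> 0 \<Longrightarrow>
      (\<And>\<gamma>. \<gamma> \<in> A \<Longrightarrow> norm (c \<gamma>) \<le> M) \<Longrightarrow> norm (shift_series G A c x) \<le> M * K"
    show ?thesis
      by (intro exI[of _ "M * K"] allI K[of \<Gamma> M c, OF sep\<Gamma> less_imp_le[OF M] cM])
  qed
  then obtain B where fb: "\<And>y. norm (?f y) \<le> B" by blast
  have rescaled: "(LBINT z. kernel z * ?f (x + 1 / real (Suc n) * z)) = 0" for n
  proof -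
    let ?N = "real (Suc n)"
    have \<eta>: "(\<lambda>t. plateau ((t - 0) / ?N)) \<in> test_functions" by (rule plateau_scaled_test_function) simp
    have ft: "fourier (\<lambda>t. plateau ((t - 0) / ?N)) y = of_real ?N * kernel (?N * y)" for y
      by (subst fourier_dilate[OF test_function_borel[OF plateau_test_function]]) (simp_all add: kernel_def)
    have "0 = (LBINT y. of_real ?N * kernel (?N * (y - x)) * ?f y)"
      using conv0[OF \<eta>, of x] unfolding ft by simp
    also have "\<dots> = \<bar>1 / ?N\<bar> *\<^sub>R (LBINT z. of_real ?N * kernel (?N * ((x + 1 / ?N * z) - x)) * ?f (x + 1 / ?N * z))"
      by (rule lborel_integral_real_affine) simp
    also have "\<dots> = \<bar>1 / ?N\<bar> *\<^sub>R (LBINT z. of_real ?N * (kernel z * ?f (x + 1 / ?N * z)))"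
    proof -
      have "?N * ((x + 1 / ?N * z) - x) = z" for z by simp
      then show ?thesis by (simp only: mult.assoc)
    qed
    also have "\<dots> = (LBINT z. kernel z * ?f (x + 1 / ?N * z))"
      by (subst integral_mult_right_zero) (simp add: scaleR_conv_of_real del: of_nat_Suc)
    finally show ?thesis by simp
  qed
  have "(\<lambda>n. LBINT z. kernel z * ?f (x + 1 / real (Suc n) * z)) \<longlonglongrightarrow> (LBINT z. kernel z * ?f x)"
  proof (rule integral_dominated_convergence[where w = "\<lambda>z. norm (kernel z) * B"])
    show "AE z in lborel. (\<lambda>n. kernel z * ?f (x + 1 / real (Suc n) * z)) \<longlonglongrightarrow> kernel z * ?f x"
    proof (rule AE_I2)
      fix z
      have "(\<lambda>n. x + 1 / real (Suc n) * z) \<longlonglongrightarrow> x + 0 * z"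
        using LIMSEQ_inverse_real_of_nat by (intro tendsto_intros) (simp add: inverse_eq_divide)
      then have "(\<lambda>n. ?f (x + 1 / real (Suc n) * z)) \<longlonglongrightarrow> ?f (x + 0 * z)"
        using fc by (intro isCont_tendsto_compose[of _ ?f]) (simp_all add: continuous_on_eq_continuous_at)
      then show "(\<lambda>n. kernel z * ?f (x + 1 / real (Suc n) * z)) \<longlonglongrightarrow> kernel z * ?f x"
        by (intro tendsto_mult_left) simp
    qed
    show "AE z in lborel. norm (kernel z * ?f (x + 1 / real (Suc n) * z)) \<le> norm (kernel z) * B" for n
      unfolding norm_mult by (intro AE_I2 mult_left_mono fb) simp
    show "integrable lborel (\<lambda>z. norm (kernel z) * B)" using kernel_integrable by auto
  qed measurable
  then have "(LBINT z. kernel z * ?f x) = 0"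
    unfolding rescaled using LIMSEQ_unique[OF _ tendsto_const] by blast
  moreover have "(LBINT z. kernel z) = 1"
    using fourier_inversion_test_function[OF plateau_test_function, of 0] by (simp add: kernel_def plateau_1)
  ultimately show ?thesis by (simp add: kernel_integrable)
qed

end

section \<open>The equivalences\<close>

theorem theorem5p1:
  fixes \<Gamma> :: "real set" and G :: "real \<Rightarrow> complex"
  assumes "separated_set \<Gamma>"
    and "G \<in> wiener" and "continuous_on UNIV G"
    and "\<And>x :: real. finite (zeros (fourier G) \<inter> {x<..<x + 1})"
  shows "(\<not> linf_stable \<Gamma> G \<longleftrightarrow> \<not> c0_stable \<Gamma> G) \<and>
         (\<not> linf_stable \<Gamma> G \<longleftrightarrow> \<not> c00_stable \<Gamma> G) \<and>
         (\<not> linf_stable \<Gamma> G \<longleftrightarrow> (\<exists>\<Gamma>'\<in>weak_limits \<Gamma>. \<not> linf_independent \<Gamma>' G)) \<and>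
         (\<not> linf_stable \<Gamma> G \<longleftrightarrow>
            (\<exists>\<Gamma>'\<in>weak_limits \<Gamma>. \<exists>c\<in>linf_seqs \<Gamma>'. (\<exists>\<gamma>\<in>\<Gamma>'. c \<gamma> \<noteq> 0) \<and>
               (\<exists>S. sparse_crystalline_with_spectrum (\<lambda>x. if x \<in> \<Gamma>' then c x else 0) S \<and>
                    S \<subseteq> zeros (fourier G))))"
proof -
  have g: "amalgam G" "continuous_on UNIV G"
    using assms(2,3) wiener_amalgam by auto
  have mono: "stable_shifts X \<Gamma> G \<Longrightarrow> Y \<subseteq> X \<Longrightarrow> stable_shifts Y \<Gamma> G" for X Y
    unfolding stable_shifts_def by blast
  have 1: "linf_stable \<Gamma> G \<Longrightarrow> c0_stable \<Gamma> G" "c0_stable \<Gamma> G \<Longrightarrow> c00_stable \<Gamma> G"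
    unfolding linf_stable_def c0_stable_def c00_stable_def
    using mono c0_subset_linf c00_subset_c0 by blast+
  have 2: "\<not> linf_stable \<Gamma> G \<Longrightarrow> \<exists>\<Gamma>'\<in>weak_limits \<Gamma>. \<not> linf_independent \<Gamma>' G"
    by (rule not_linf_stable_imp_dependent_limit[OF g assms(1)])
  have 3: "\<exists>\<Gamma>'\<in>weak_limits \<Gamma>. \<not> linf_independent \<Gamma>' G \<Longrightarrow> \<not> c00_stable \<Gamma> G"
    using dependent_limit_imp_not_c00_stable[OF g assms(1)] by blast
  have 4: "(\<forall>x. shift_series G \<Gamma>' c x = 0) \<longleftrightarrow>
      (\<exists>S. sparse_crystalline_with_spectrum (\<lambda>x. if x \<in> \<Gamma>' then c x else 0) S \<and> S \<subseteq> zeros (fourier G))"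
    if \<Gamma>': "\<Gamma>' \<in> weak_limits \<Gamma>" and c: "c \<in> linf_seqs \<Gamma>'" for \<Gamma>' c
  proof -
    have "separated_set \<Gamma>'" using \<Gamma>' by (auto simp: weak_limits_def weakly_converges_def)
    then obtain d where d: "d > 0" "sep d \<Gamma>'" using separated_set_iff by blast
    obtain M where M: "M > 0" "\<And>\<gamma>. \<gamma> \<in> \<Gamma>' \<Longrightarrow> norm (c \<gamma>) \<le> M" using linf_seqs_bound[OF c] by blast
    interpret bounded_masses \<Gamma>' c d M by unfold_locales (use d M in auto)
    have m: "(\<lambda>x. if x \<in> \<Gamma>' then c x else 0) = masses" by (simp add: fun_eq_iff masses_def)
    show ?thesis
      unfolding m using vanishing_series_imp_crystalline[OF g _ assms(4)]
        crystalline_imp_vanishing_series[OF g] unfolding sparse_crystalline_with_spectrum_def by blast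
  qed
  have 5: "(\<exists>\<Gamma>'\<in>weak_limits \<Gamma>. \<not> linf_independent \<Gamma>' G) \<longleftrightarrow>
      (\<exists>\<Gamma>'\<in>weak_limits \<Gamma>. \<exists>c\<in>linf_seqs \<Gamma>'. (\<exists>\<gamma>\<in>\<Gamma>'. c \<gamma> \<noteq> 0) \<and>
         (\<exists>S. sparse_crystalline_with_spectrum (\<lambda>x. if x \<in> \<Gamma>' then c x else 0) S \<and>
              S \<subseteq> zeros (fourier G)))"
    unfolding linf_independent_def not_not by (intro bex_cong refl conj_cong 4)
  show ?thesis
    using 1 2 3 unfolding 5[symmetric] by blast
qed

end
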